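(* The tropical Torelli map $t_g^{\rm tr}:M_g^{\rm tr}\to A_g^{\rm tr,V}$ is full, and its image is equal to the stacky subfan $A_g^{\rm cogr}\subset A_g^{\rm tr,V}$.
   Context: A tropical curve of genus $g$ is $C=(\Gamma,w,l)$: $\Gamma$ a finite connected graph (loops, multiple edges allowed), $w:V(\Gamma)\to\mathbb{Z}_{\ge0}$ with every weight-$0$ vertex of valence $\geq3$, $b_1(\Gamma)+\sum_vw(v)=g$, $l:E(\Gamma)\to\mathbb{R}_{>0}$. $M_g^{\rm tr}$ is the stacky fan of tropical curves of genus $g$ with cells $C(\Gamma,w)=\mathbb{R}^{|E(\Gamma)|}_{>0}/\operatorname{Aut}(\Gamma,w)$ (curves with combinatorial type $(\Gamma,w)$), closures glued along faces corresponding to edge contractions. $t_g^{\rm tr}(C)=\operatorname{Jac}(C)$, the torus $(H_1(\Gamma,\mathbb{R})\oplus\mathbb{R}^{|w|})/(H_1(\Gamma,\mathbb{Z})\oplus\mathbb{Z}^{|w|})$ with the form $Q_C$ vanishing on $\mathbb{R}^{|w|}$ and $Q_C(\sum_e\alpha_ee)=\sum_e\alpha_e^2l(e)$ on the cycle space $H_1(\Gamma,\mathbb{R})$, viewed as a point of $\Omega_g^{\rm rt}/\mathrm{GL}_g(\mathbb{Z})$ after choice of a lattice basis. $\Omega_g^{\rm rt}$: positive semi-definite real symmetric $g\times g$ matrices with rationally spanned null space, $\mathrm{GL}_g(\mathbb{Z})$ acting by $Q\mapsto hQh^t$. $A_g^{\rm tr,V}$: stacky fan structure on $\Omega_g^{\rm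 rt}/\mathrm{GL}_g(\mathbb{Z})$ with cells the classes of Voronoi cones $\sigma^0_P=\{Q:\mathrm{Vor}(Q)=P\}$ modulo their stabilizers, where $\mathrm{Vor}(Q)=\{x:Q(x)\le Q(v-x)\ \forall v\in\mathbb{Z}^g\}$ for positive definite $Q$ (extended by reduction to $\mathrm{diag}(Q',0)$). For totally unimodular $A\in M_{g,n}(\mathbb{R})$ of rank $\le g$ with columns $v_i$ (linear forms on $\mathbb{R}^g$), $\sigma^0(A)=\{\sum_il_iv_i(x)^2:\underline l\in\mathbb{R}^n_{>0}\}$ is a Voronoi cone; for a regular matroid $M=M[A]$ of rank $\le g$, $C(M)$ is the corresponding cell. The cographic matroid $M^*(\Gamma)$ of a graph has ground set $E(\Gamma)$ and circuits the bonds (minimal nonempty cuts); a matroid is simple if it has no one- or two-element circuits. $A_g^{\rm cogr}$ is the stacky subfan of $A_g^{\rm tr,V}$ whose cells are the $C(M)$ with $M$ simple cographic of rank $\le g$. A map of stacky fans is full if it maps every cell of the source surjectively onto some cell of the target.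
   Formalization: Proved for g ≥ 2: for g = 1 the only tropical curve is a weight-1 vertex, so the image misses the cell of M*(one loop), and for g = 0 there are no curves. Voronoi cones are read as forms whose Voronoi tilings have the same combinatorial type. *)

theory Defs
  imports "HOL-Analysis.Analysis"
begin

section \<open>Lattices, quadratic forms, GL_g(Z), Omega_g^rt\<close>

text \<open>g is the cardinality of the finite index type 'g; R^g = real^'g;
  a g x g matrix Q is read as the quadratic form x |-> x . (Q x).\<close>

definition Zlat :: "(real^'g) set" where
  "Zlat = {v. \<forall>i. v $ i \<in> \<int>}"

definition Qlat :: "(real^'g) set" where
  "Qlat = {v. \<forall>i. v $ i \<in> \<rat>}"

definition qf :: "real^'g^'g \<Rightarrow> real^'g \<Rightarrow> real" where
  "qf Q x = x \<bullet> (Q *v x)"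

definition GLZ :: "(real^'g^'g) set" where
  "GLZ = {h. (\<forall>i j. h $ i $ j \<in> \<int>) \<and> \<bar>det h\<bar> = 1}"

definition gl_act :: "real^'g^'g \<Rightarrow> real^'g^'g \<Rightarrow> real^'g^'g" where
  "gl_act h Q = h ** Q ** transpose h"

text \<open>Positive semidefinite symmetric matrices with rationally spanned null space.\<close>
definition Omega_rt :: "(real^'g^'g) set" where
  "Omega_rt = {Q. transpose Q = Q \<and> (\<forall>x. 0 \<le> qf Q x)
       \<and> {x. Q *v x = 0} \<subseteq> span ({x. Q *v x = 0} \<inter> Qlat)}"

text \<open>GL_g(Z)-saturation of a set of forms (= its image in Omega/GL_g(Z)).\<close>
definition gl_sat :: "(real^'g^'g) set \<Rightarrow> (real^'g^'g) set" where
  "gl_sat S = {Q. \<exists>h\<in>GLZ. gl_act h Q \<in> S}"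

section \<open>Voronoi cells and the Voronoi stacky fan A_g^{tr,V}\<close>

definition vor :: "real^'g^'g \<Rightarrow> (real^'g) set" where
  "vor Q = {x. \<forall>v\<in>Zlat. qf Q x \<le> qf Q (v - x)}"

text \<open>Combinatorial type of the Voronoi tiling Z^g + Vor(Q): for each point x the set of
  lattice translates of Vor(Q) containing x.  Two forms have the same Voronoi polytope
  (in the sense of the paper, i.e. lie in the same Voronoi cone sigma^0_P) iff these agree.\<close>
definition vor_type :: "real^'g^'g \<Rightarrow> (real^'g) set set" where
  "vor_type Q = range (\<lambda>x. {v\<in>Zlat. x - v \<in> vor Q})"

text \<open>The cell of A_g^{tr,V} through Q, as a GL_g(Z)-invariant subset of Omega_rt.\<close>
definition vcell :: "real^'g^'g \<Rightarrow> (real^'g^'g) set" where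
  "vcell Q = {Q'\<in>Omega_rt. \<exists>h\<in>GLZ. vor_type (gl_act h Q') = vor_type Q}"

definition voronoi_cells :: "(real^'g^'g) set set" where
  "voronoi_cells = vcell ` Omega_rt"

section \<open>Graphs (loops and multiple edges allowed)\<close>

text \<open>A finite graph: vertex set V, edge set E, and an endpoint map (oriented arbitrarily;
  the orientation is only used to define cycles).\<close>
definition fin_graph :: "nat set \<Rightarrow> nat set \<Rightarrow> (nat \<Rightarrow> nat \<times> nat) \<Rightarrow> bool" where
  "fin_graph V E ends \<longleftrightarrow> finite V \<and> finite E \<and> V \<noteq> {} \<and>
     (\<forall>e\<in>E. fst (ends e) \<in> V \<and> snd (ends e) \<in> V)"

definition graph_adj :: "nat set \<Rightarrow> (nat \<Rightarrow> nat \<times> nat) \<Rightarrow> (nat \<times> nat) set" where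
  "graph_adj E ends = {(a, b). \<exists>e\<in>E. ends e = (a, b) \<or> ends e = (b, a)}"

definition graph_connected :: "nat set \<Rightarrow> nat set \<Rightarrow> (nat \<Rightarrow> nat \<times> nat) \<Rightarrow> bool" where
  "graph_connected V E ends \<longleftrightarrow> (\<forall>u\<in>V. \<forall>v\<in>V. (u, v) \<in> (graph_adj E ends)\<^sup>*)"

text \<open>Valence; a loop contributes 2.\<close>
definition valence :: "nat set \<Rightarrow> (nat \<Rightarrow> nat \<times> nat) \<Rightarrow> nat \<Rightarrow> nat" where
  "valence E ends v = card {e\<in>E. fst (ends e) = v} + card {e\<in>E. snd (ends e) = v}"

text \<open>First Betti number of a connected graph.\<close>
definition betti1 :: "nat set \<Rightarrow> nat set \<Rightarrow> nat" where
  "betti1 V E = card E + 1 - card V"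

text \<open>Integral cycle space H_1(Gamma, Z), as integer edge labellings with zero boundary.\<close>
definition H1Z :: "nat set \<Rightarrow> nat set \<Rightarrow> (nat \<Rightarrow> nat \<times> nat) \<Rightarrow> (nat \<Rightarrow> int) set" where
  "H1Z V E ends = {\<alpha>. (\<forall>e. e \<notin> E \<longrightarrow> \<alpha> e = 0) \<and>
     (\<forall>v\<in>V. (\<Sum>e\<in>{e\<in>E. snd (ends e) = v}. \<alpha> e) - (\<Sum>e\<in>{e\<in>E. fst (ends e) = v}. \<alpha> e) = 0)}"

section \<open>Tropical curves and the tropical Torelli map\<close>

text \<open>(Gamma, w) is a combinatorial type of a tropical curve of genus g.\<close>
definition stable_type :: "nat \<Rightarrow> nat set \<Rightarrow> nat set \<Rightarrow> (nat \<Rightarrow> nat \<times> nat) \<Rightarrow> (nat \<Rightarrow> nat) \<Rightarrow> bool" where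
  "stable_type g V E ends w \<longleftrightarrow> fin_graph V E ends \<and> graph_connected V E ends \<and>
     (\<forall>v\<in>V. w v = 0 \<longrightarrow> valence E ends v \<ge> 3) \<and>
     betti1 V E + (\<Sum>v\<in>V. w v) = g"

text \<open>Q represents Jac(C), C = (Gamma, w, l), in some lattice basis: there is a Z-basis of
  H_1(Gamma,Z) (+) Z^{|w|}, i.e. an isomorphism Z^g -> H_1(Gamma,Z) x Z^{|w|} given by the
  images (gamma i, delta i) of the standard basis vectors, such that Q is the Gram matrix of
  Q_C (which vanishes on the Z^{|w|} part).\<close>
definition jac_rep :: "nat set \<Rightarrow> nat set \<Rightarrow> (nat \<Rightarrow> nat \<times> nat) \<Rightarrow> (nat \<Rightarrow> nat) \<Rightarrow>
     (nat \<Rightarrow> real) \<Rightarrow> real^'g^'g \<Rightarrow> bool" where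
  "jac_rep V E ends w l Q \<longleftrightarrow>
    (\<exists>(\<gamma> :: 'g \<Rightarrow> nat \<Rightarrow> int) (\<delta> :: 'g \<Rightarrow> nat \<Rightarrow> int).
       bij_betw (\<lambda>x::'g \<Rightarrow> int. ((\<lambda>e. \<Sum>i\<in>UNIV. x i * \<gamma> i e), (\<lambda>k. \<Sum>i\<in>UNIV. x i * \<delta> i k)))
         UNIV (H1Z V E ends \<times> {f. \<forall>k. k \<ge> (\<Sum>v\<in>V. w v) \<longrightarrow> f k = 0})
     \<and> (\<forall>i j. Q $ i $ j = (\<Sum>e\<in>E. l e * of_int (\<gamma> i e) * of_int (\<gamma> j e))))"

text \<open>Image under t_g^tr of the cell C(Gamma, w) of M_g^tr (a GL_g(Z)-invariant subset of Omega).\<close>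
definition torelli_cell :: "nat set \<Rightarrow> nat set \<Rightarrow> (nat \<Rightarrow> nat \<times> nat) \<Rightarrow> (nat \<Rightarrow> nat) \<Rightarrow>
     (real^'g^'g) set" where
  "torelli_cell V E ends w = {Q. \<exists>l. (\<forall>e\<in>E. l e > 0) \<and> jac_rep V E ends w l Q}"

section \<open>Regular and cographic matroids, the cells C(M)\<close>

text \<open>A real g x n matrix is given by its columns a 0, ..., a (n-1) in R^g.\<close>
definition det_nat :: "nat \<Rightarrow> (nat \<Rightarrow> nat \<Rightarrow> real) \<Rightarrow> real" where
  "det_nat k M = (\<Sum>p | p permutes {..<k}. of_int (sign p) * (\<Prod>i<k. M i (p i)))"

definition totally_unimodular :: "nat \<Rightarrow> (nat \<Rightarrow> real^'g) \<Rightarrow> bool" where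
  "totally_unimodular n a \<longleftrightarrow>
    (\<forall>k (r :: nat \<Rightarrow> 'g) (c :: nat \<Rightarrow> nat). inj_on r {..<k} \<longrightarrow> inj_on c {..<k} \<longrightarrow>
        c ` {..<k} \<subseteq> {..<n} \<longrightarrow> det_nat k (\<lambda>i j. a (c j) $ r i) \<in> {-1, 0, 1})"

definition col_dependent :: "(nat \<Rightarrow> real^'g) \<Rightarrow> nat set \<Rightarrow> bool" where
  "col_dependent a C \<longleftrightarrow> (\<exists>c. (\<exists>i\<in>C. c i \<noteq> 0) \<and> (\<Sum>i\<in>C. c i *\<^sub>R a i) = 0)"

text \<open>Circuits of the column matroid M[A] on ground set {0..n-1}.\<close>
definition col_circuits :: "nat \<Rightarrow> (nat \<Rightarrow> real^'g) \<Rightarrow> nat set set" where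
  "col_circuits n a = {C. C \<subseteq> {..<n} \<and> C \<noteq> {} \<and> col_dependent a C \<and>
      (\<forall>D. D \<subset> C \<longrightarrow> \<not> col_dependent a D)}"

definition graph_cut :: "nat set \<Rightarrow> (nat \<Rightarrow> nat \<times> nat) \<Rightarrow> nat set \<Rightarrow> nat set" where
  "graph_cut E ends S = {e\<in>E. (fst (ends e) \<in> S) \<noteq> (snd (ends e) \<in> S)}"

definition is_cut :: "nat set \<Rightarrow> nat set \<Rightarrow> (nat \<Rightarrow> nat \<times> nat) \<Rightarrow> nat set \<Rightarrow> bool" where
  "is_cut V E ends B \<longleftrightarrow> (\<exists>S\<subseteq>V. B = graph_cut E ends S)"

text \<open>Bonds = minimal nonempty cuts = circuits of the cographic matroid M*(Gamma).\<close>
definition bonds :: "nat set \<Rightarrow> nat set \<Rightarrow> (nat \<Rightarrow> nat \<times> nat) \<Rightarrow> nat set set" where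
  "bonds V E ends = {B. B \<noteq> {} \<and> is_cut V E ends B \<and>
      (\<forall>B'. B' \<noteq> {} \<and> is_cut V E ends B' \<longrightarrow> \<not> B' \<subset> B)}"

text \<open>M[A] is isomorphic to the cographic matroid M*(Gamma) of some finite graph.\<close>
definition cographic_col :: "nat \<Rightarrow> (nat \<Rightarrow> real^'g) \<Rightarrow> bool" where
  "cographic_col n a \<longleftrightarrow> (\<exists>V E ends f. fin_graph V E ends \<and> bij_betw f {..<n} E \<and>
      (`) f ` col_circuits n a = bonds V E ends)"

definition simple_col :: "nat \<Rightarrow> (nat \<Rightarrow> real^'g) \<Rightarrow> bool" where
  "simple_col n a \<longleftrightarrow> (\<forall>C\<in>col_circuits n a. card C \<ge> 3)"

text \<open>sigma^0(A) = { sum_i l_i v_i(x)^2 : l > 0 }.\<close>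
definition sigma0 :: "nat \<Rightarrow> (nat \<Rightarrow> real^'g) \<Rightarrow> (real^'g^'g) set" where
  "sigma0 n a = {Q. \<exists>l. (\<forall>i<n. l i > 0) \<and>
      Q = (\<Sum>i<n. l i *\<^sub>R (\<chi> r s. a i $ r * a i $ s))}"

text \<open>Cells C(M) of A_g^cogr, M = M[A] simple cographic, A totally unimodular g x n.\<close>
definition cogr_cells :: "(real^'g^'g) set set" where
  "cogr_cells = {gl_sat (sigma0 n a) | n a. totally_unimodular n a \<and>
      cographic_col n a \<and> simple_col n a}"

end

theory Submission
  imports Defs
begin

text \<open>Let A be totally unimodular with columns \<open>a\<^sub>i\<close>.  The Delaunay subdivision of every form
  \<open>Q = \<Sum> l\<^sub>i a\<^sub>i\<^sup>2\<close> with \<open>l > 0\<close> is the lattice dicing cut out by the hyperplanes \<open>a\<^sub>i(x) \<in> \<int>\<close>, so it does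
  not depend on l.  Conversely, if the Delaunay subdivision of Q is this dicing, the piecewise affine
  interpolation of Q at the lattice points is convex with gradient jumping only across those
  hyperplanes, and its difference from Q is periodic.  Averaging second differences over a finer and
  finer grid of the torus kills the periodic part and writes Q as \<open>\<Sum> l\<^sub>i a\<^sub>i\<^sup>2\<close> with \<open>l \<ge> 0\<close>; no coefficient
  vanishes, because the interpolation is not affine across a wall.  Hence \<open>\<sigma>\<^sup>0(A)\<close> is a whole Voronoi cone.

  The Jacobians of a combinatorial type are the forms \<open>\<sigma>\<^sup>0\<close> of the columns dual to a cycle basis, which are
  totally unimodular with the bonds as circuits; dropping bridges and merging two-edge cuts makes
  them simple.  Conversely, a cographic system is realised on a connected graph, and it agrees up to signs
  with the cycle columns of that graph: its kernel contains a vector supported on each vertex star,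
  and a linear relation among these vectors orients the edges.\<close>

section \<open>Totally unimodular columns\<close>

text \<open>A Voronoi cell is a class of forms of equal combinatorial type, so placing
  \<open>sigma0 n a\<close> inside one class is not enough: every form of the same type must be
  shown to be a positive combination of the given squares. Such a form may be degenerate, and its
  Delaunay cells are then unbounded along the common kernel of the columns; this is why the affine
  functions in the argument are required to be constant along that kernel. The averages run over
  finite grids because translation by a grid vector permutes the grid modulo the lattice, so
  periodic terms cancel exactly and not only in the limit. They can be evaluated only on lattice
  vectors where each column form has absolute value at most 1; total unimodularity supplies enough
  of these to recover all matrix entries. That g is at least 2 enters twice: grid points on two
  walls are counted by \<open>N ^ (CARD('g) - 2)\<close>, and in genus 1 a single loop has no stable
  model, because its vertex of weight 0 has valence 2.\<close>

definition rowmix :: "'g set \<Rightarrow> ('g \<Rightarrow> real^'g) \<Rightarrow> real^'g^'g" where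
  "rowmix R f = (\<chi> i. if i \<in> R then f i else axis i 1)"

text \<open>Padding a minor with unit rows keeps its determinant and gives it the fixed size g, so
  that minors of every size fall under the theory of square matrices. In the Leibniz sum a
  permutation that moves an index outside the chosen rows picks a zero entry of a unit row.\<close>

lemma det_rowmix:
  fixes r :: "nat \<Rightarrow> 'g::finite" and a :: "nat \<Rightarrow> real^'g"
  assumes inj: "inj_on r {..<k}" and f: "\<And>m. m < k \<Longrightarrow> f (r m) = a (c m)"
  shows "det (rowmix (r ` {..<k}) f) = det_nat k (\<lambda>i j. a (c j) $ r i)"
proof -
  let ?R = "r ` {..<k}" and ?B = "rowmix (r ` {..<k}) f"
  let ?m = "map_permutation {..<k} r"
  have bij: "bij_betw r {..<k} ?R" using inj by (simp add: bij_betw_def)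
  have pr: "(\<Prod>i\<in>UNIV. ?B $ p i $ i) = (\<Prod>i\<in>?R. ?B $ p i $ i)" if p: "p permutes ?R" for p
  proof (rule prod.mono_neutral_right)
    show "\<forall>i\<in>UNIV - ?R. ?B $ p i $ i = 1"
      using permutes_not_in[OF p] by (simp add: rowmix_def)
  qed auto
  have "det ?B = det (transpose ?B)" by simp
  also have "\<dots> = (\<Sum>p | p permutes UNIV. of_int (sign p) * (\<Prod>i\<in>UNIV. ?B $ p i $ i))"
    by (simp add: det_def transpose_def)
  also have "\<dots> = (\<Sum>p | p permutes ?R. of_int (sign p) * (\<Prod>i\<in>UNIV. ?B $ p i $ i))"
  proof (rule sum.mono_neutral_right)
    show "finite {p :: 'g \<Rightarrow> 'g. p permutes UNIV}" by simp
    show "{p. p permutes ?R} \<subseteq> {p. p permutes UNIV}"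
      using permutes_subset by blast
    show "\<forall>p\<in>{p. p permutes UNIV} - {p. p permutes ?R}.
       of_int (sign p) * (\<Prod>i\<in>UNIV. ?B $ p i $ i) = 0"
    proof
      fix p assume p: "p \<in> {p. p permutes UNIV} - {p. p permutes ?R}"
      then obtain j where j: "j \<notin> ?R" "p j \<noteq> j"
        using permutes_superset[of p UNIV ?R] by blast
      have "surj p" using p permutes_surj by auto
      then obtain i where i: "p i = j" by (metis surjD)
      then have "?B $ p i $ i = 0" using j by (auto simp: rowmix_def axis_def)
      then show "of_int (sign p) * (\<Prod>i\<in>UNIV. ?B $ p i $ i) = 0"
        by (auto intro!: prod_zero)
    qed
  qed
  also have "\<dots> = (\<Sum>p | p permutes ?R. of_int (sign p) * (\<Prod>i\<in>?R. ?B $ p i $ i))"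
    by (rule sum.cong) (auto simp: pr)
  also have "\<dots> = (\<Sum>p | p permutes {..<k}. of_int (sign (?m p)) * (\<Prod>i\<in>?R. ?B $ ?m p i $ i))"
  proof (rule sum.reindex_bij_betw[symmetric])
    show "bij_betw ?m {p. p permutes {..<k}} {p. p permutes ?R}"
    proof (rule bij_betw_byWitness[where f' = "map_permutation ?R (inv_into {..<k} r)"])
      show "\<forall>p\<in>{p. p permutes {..<k}}. map_permutation ?R (inv_into {..<k} r) (?m p) = p"
        by (auto intro!: map_permutation_compose_inv[OF bij] simp: inv_into_f_f[OF inj])
      show "\<forall>p\<in>{p. p permutes ?R}. ?m (map_permutation ?R (inv_into {..<k} r) p) = p"
      proof
        fix p assume "p \<in> {p. p permutes ?R}"
        then show "?m (map_permutation ?R (inv_into {..<k} r) p) = p"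
          by (intro map_permutation_compose_inv[OF bij_betw_inv_into[OF bij]]) (auto intro: f_inv_into_f)
      qed
      show "?m ` {p. p permutes {..<k}} \<subseteq> {p. p permutes ?R}"
        using map_permutation_permutes[OF bij] by auto
      show "map_permutation ?R (inv_into {..<k} r) ` {p. p permutes ?R} \<subseteq> {p. p permutes {..<k}}"
        using map_permutation_permutes[OF bij_betw_inv_into[OF bij]] by auto
    qed
  qed
  also have "\<dots> = (\<Sum>p | p permutes {..<k}. of_int (sign p) * (\<Prod>i<k. a (c (p i)) $ r i))"
  proof (rule sum.cong)
    fix p assume "p \<in> {p. p permutes {..<k}}"
    then have p: "p permutes {..<k}" by simp
    have "(\<Prod>i\<in>?R. ?B $ ?m p i $ i) = (\<Prod>i<k. ?B $ ?m p (r i) $ r i)"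
      by (rule prod.reindex_cong[OF inj]) auto
    also have "\<dots> = (\<Prod>i<k. a (c (p i)) $ r i)"
    proof (rule prod.cong)
      fix i assume i: "i \<in> {..<k}"
      have pi: "p i < k" using p i permutes_in_image by fastforce
      then show "?B $ ?m p (r i) $ r i = a (c (p i)) $ r i"
        using i by (simp add: map_permutation_apply[OF inj] rowmix_def f)
    qed simp
    finally show "of_int (sign (?m p)) * (\<Prod>i\<in>?R. ?B $ ?m p i $ i)
        = of_int (sign p) * (\<Prod>i<k. a (c (p i)) $ r i)"
      using sign_map_permutation[OF inj p] by simp
  qed simp
  finally show ?thesis by (simp add: det_nat_def)
qed

lemma det_Ints:
  fixes B :: "real^'g^'g::finite"
  assumes "\<And>i j. B $ i $ j \<in> \<int>"
  shows "det B \<in> \<int>"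
  unfolding det_def by (intro Ints_sum Ints_mult Ints_prod) (auto simp: assms)

lemma matrix_inv_inverse:
  assumes "invertible (B :: real^'g^'g)"
  shows "B ** matrix_inv B = mat 1 \<and> matrix_inv B ** B = mat 1"
  using assms unfolding invertible_def matrix_inv_def by (rule someI_ex)

lemma GLZ_entry: "h \<in> GLZ \<Longrightarrow> h $ i $ j \<in> \<int>"
  by (simp add: GLZ_def)

lemma GLZ_det_nz: "h \<in> GLZ \<Longrightarrow> det h \<noteq> 0"
  by (auto simp: GLZ_def)

lemma Zlat_mult:
  fixes B :: "real^'g^'g::finite"
  assumes "\<And>i j. B $ i $ j \<in> \<int>" "v \<in> Zlat"
  shows "B *v v \<in> Zlat"
  using assms by (auto simp: Zlat_def matrix_vector_mult_def intro!: Ints_sum Ints_mult)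

text \<open>Cramer's rule: every numerator is an integral determinant and the denominator is a
  unit.\<close>

lemma GLZ_solve:
  fixes B :: "real^'g^'g::finite"
  assumes B: "B \<in> GLZ" and x: "B *v x \<in> Zlat"
  shows "x \<in> Zlat"
proof -
  have d: "det B = 1 \<or> det B = -1" using B by (auto simp: GLZ_def)
  have "x = (\<chi> k. det (\<chi> i j. if j = k then (B *v x) $ i else B $ i $ j) / det B)"
    using cramer[OF GLZ_det_nz[OF B], of x "B *v x"] by simp
  then have xk: "x $ k = det (\<chi> i j. if j = k then (B *v x) $ i else B $ i $ j) / det B" for k
    by (metis (lifting) vec_lambda_beta)
  have "det (\<chi> i j. if j = k then (B *v x) $ i else B $ i $ j) \<in> \<int>" for k
    using x by (intro det_Ints) (auto simp: GLZ_entry[OF B] Zlat_def)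
  then show ?thesis unfolding Zlat_def using xk d
    by (auto simp: divide_minus_right)
qed

lemma axis_Zlat [simp]: "axis i 1 \<in> Zlat"
  by (simp add: Zlat_def axis_def)

lemma Ints_mult_eq_1:
  fixes a b :: real
  assumes "a \<in> \<int>" "b \<in> \<int>" "a * b = 1" shows "\<bar>a\<bar> = 1"
proof -
  obtain m n where mn: "a = of_int m" "b = of_int n" using assms by (auto elim!: Ints_cases)
  then have "of_int (m * n) = (1::real)" using assms by simp
  then have "m * n = 1" by linarith
  then have "\<bar>m\<bar> = 1" by (metis zmult_eq_1_iff abs_1 abs_minus_cancel)
  then show ?thesis using mn by linarith
qed

text \<open>Injectivity is automatic: a nonzero kernel vector could be scaled out of the lattice.\<close>
lemma GLZ_I:
  fixes B :: "real^'g^'g::finite"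
  assumes int: "\<And>i j. B $ i $ j \<in> \<int>" and sol: "\<And>x. B *v x \<in> Zlat \<Longrightarrow> x \<in> Zlat"
  shows "B \<in> GLZ" "matrix_inv B \<in> GLZ"
proof -
  have "x = 0" if "B *v x = 0" for x
  proof (rule ccontr)
    assume "x \<noteq> 0"
    then obtain i where i: "x $ i \<noteq> 0" by (metis vec_eq_iff zero_index)
    have "B *v ((1 / (2 * x $ i)) *\<^sub>R x) = 0" using that by (simp add: matrix_vector_mult_scaleR)
    then have "B *v ((1 / (2 * x $ i)) *\<^sub>R x) \<in> Zlat" by (simp add: Zlat_def)
    then have "(1 / (2 * x $ i)) *\<^sub>R x \<in> Zlat" by (rule sol)
    then have "((1 / (2 * x $ i)) *\<^sub>R x) $ i \<in> \<int>" unfolding Zlat_def by blast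
    then have "(1/2::real) \<in> \<int>" using i by simp
    then obtain m :: int where "(1/2::real) = of_int m" by (auto elim: Ints_cases)
    then have "(1::real) = of_int (2 * m)" by simp
    then have "1 = 2 * m" by linarith
    then show False by presburger
  qed
  then have inv: "invertible B"
    using matrix_left_invertible_ker invertible_left_inverse by blast
  then have BB: "B ** matrix_inv B = mat 1" "matrix_inv B ** B = mat 1"
    by (simp_all add: matrix_inv_inverse)
  have int': "matrix_inv B $ i $ j \<in> \<int>" for i j
  proof -
    have "B *v (matrix_inv B *v axis j 1) = axis j 1"
      unfolding matrix_vector_mul_assoc BB(1) by (rule matrix_vector_mul_lid)
    then have "matrix_inv B *v axis j 1 \<in> Zlat" by (metis sol axis_Zlat)
    then have "column j (matrix_inv B) \<in> Zlat" by (simp only: matrix_vector_mult_basis)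
    then show ?thesis by (simp add: Zlat_def column_def)
  qed
  have dd: "det B * det (matrix_inv B) = 1" unfolding det_mul[symmetric] BB by simp
  then have "\<bar>det B\<bar> = 1" using det_Ints[of B] det_Ints[of "matrix_inv B"] int int'
    by (intro Ints_mult_eq_1[of _ "det (matrix_inv B)"]) auto
  moreover have "\<bar>det (matrix_inv B)\<bar> = 1" using det_Ints[of B] det_Ints[of "matrix_inv B"] int int' dd
    by (intro Ints_mult_eq_1[of _ "det B"]) (auto simp: mult.commute)
  ultimately show "B \<in> GLZ" "matrix_inv B \<in> GLZ" using int int' by (auto simp: GLZ_def)
qed

lemma GLZ_inv: "h \<in> GLZ \<Longrightarrow> matrix_inv h \<in> GLZ"
  by (rule GLZ_I(2)) (auto simp: GLZ_entry intro: GLZ_solve)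

lemma GLZ_transpose: "h \<in> GLZ \<Longrightarrow> transpose h \<in> GLZ"
  unfolding GLZ_def mem_Collect_eq det_transpose by (simp add: transpose_def)

lemma GLZ_inv_mult:
  "h \<in> GLZ \<Longrightarrow> h ** matrix_inv h = mat 1" "h \<in> GLZ \<Longrightarrow> matrix_inv h ** h = mat 1"
  using GLZ_det_nz invertible_det_nz matrix_inv_inverse by blast+

lemma tu_entry:
  assumes tu: "totally_unimodular n a" and i: "i < n"
  shows "a i $ s \<in> {-1, 0, 1}"
proof -
  have "det_nat 1 (\<lambda>i' j. a i $ s) \<in> {-1, 0, 1}"
    using tu[unfolded totally_unimodular_def, rule_format, of "\<lambda>_. s" 1 "\<lambda>_. i"] i
    by (auto simp: inj_on_def)
  moreover have "{p. p permutes {..<1::nat}} = {id}"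
    by (auto simp: lessThan_Suc permutes_sing)
  ultimately show ?thesis by (simp add: det_nat_def)
qed

lemma tu_Zlat: "totally_unimodular n a \<Longrightarrow> i < n \<Longrightarrow> a i \<in> Zlat"
  unfolding Zlat_def mem_Collect_eq
proof
  fix s assume "totally_unimodular n a" "i < n"
  then have "a i $ s \<in> {-1, 0, 1}" by (rule tu_entry)
  then show "a i $ s \<in> \<int>" by auto
qed

lemma inner_Zlat: "u \<in> Zlat \<Longrightarrow> v \<in> Zlat \<Longrightarrow> u \<bullet> v \<in> \<int>"
  by (auto simp: Zlat_def inner_vec_def intro!: Ints_sum Ints_mult)

lemma rowmix_mult: "(rowmix R f *v x) $ j = (if j \<in> R then f j \<bullet> x else x $ j)"
  by (simp add: rowmix_def matrix_vector_mul_component inner_axis' )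

text \<open>An independent family of columns extends to a basis of the ambient space by unit vectors;
  total unimodularity makes the resulting matrix unimodular.\<close>
lemma tu_rowmix:
  fixes a :: "nat \<Rightarrow> real^'g::finite"
  assumes tu: "totally_unimodular n a" and I: "I \<subseteq> {..<n}" "inj_on a I" "independent (a ` I)"
  obtains R \<rho> where "bij_betw \<rho> R I" "rowmix R (\<lambda>j. a (\<rho> j)) \<in> GLZ"
proof -
  let ?U = "range (\<lambda>i. axis i 1) :: (real^'g) set"
  obtain S where S: "a ` I \<subseteq> S" "S \<subseteq> a ` I \<union> ?U" "independent S" "a ` I \<union> ?U \<subseteq> span S"
    using maximal_independent_subset_extend[of "a ` I" "a ` I \<union> ?U"] I(3) by blast
  have "Basis = ?U" by (auto simp: Basis_vec_def)
  then have "(UNIV :: (real^'g) set) = span ?U" using span_Basis by metis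
  then have spS: "span S = UNIV"
    by (metis S(4) le_sup_iff span_mono span_span top.extremum_uniqueI)
  \<comment> \<open>A unit vector that occurs among the columns counts as a column. This makes the
    columns and the completing unit vectors disjoint, so R has as many elements as I.\<close>
  define R where "R = {j. axis j 1 \<notin> S - a ` I}"
  have finS: "finite S" using S(3) independent_imp_finite by blast
  have Seq: "S = a ` I \<union> (\<lambda>j. axis j 1) ` (- R)" using S(1,2) by (auto simp: R_def)
  have cS: "card S = CARD('g)" using S(3) spS
    by (metis dim_UNIV dim_span_eq_card_independent DIM_cart DIM_real mult.right_neutral)
  have injax: "inj_on (\<lambda>j. axis j 1 :: real^'g) A" for A
    by (auto simp: inj_on_def axis_eq_axis)
  have fI: "finite I" using I finite_subset by blast
  have disj: "a ` I \<inter> (\<lambda>j. axis j 1) ` (- R) = {}" unfolding R_def by force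
  have "card S = card I + card (- R)"
    unfolding Seq by (subst card_Un_disjoint) (auto simp: disj fI card_image I(2) injax)
  moreover have "card (- R) = CARD('g) - card R" by (simp add: Compl_eq_Diff_UNIV card_Diff_subset)
  moreover have "card R \<le> CARD('g)" by (simp add: card_mono)
  ultimately have cR: "card R = card I" using cS by linarith
  define k where "k = card I"
  obtain r where r: "bij_betw r {..<k} R"
    using ex_bij_betw_nat_finite[of R] cR by (auto simp: k_def atLeast0LessThan)
  obtain c where c: "bij_betw c {..<k} I"
    using ex_bij_betw_nat_finite[OF fI] by (auto simp: k_def atLeast0LessThan)
  define \<rho> where "\<rho> = c \<circ> inv_into {..<k} r"
  have rho: "bij_betw \<rho> R I"
    unfolding \<rho>_def by (rule bij_betw_trans[OF bij_betw_inv_into[OF r] c])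
  have rr: "r ` {..<k} = R" "inj_on r {..<k}" using r by (auto simp: bij_betw_def)
  let ?B = "rowmix R (\<lambda>j. a (\<rho> j))"
  have "det ?B = det_nat k (\<lambda>i j. a (c j) $ r i)"
    unfolding rr(1)[symmetric] by (rule det_rowmix[OF rr(2)]) (simp add: \<rho>_def inv_into_f_f rr(2))
  also have "\<dots> \<in> {-1, 0, 1}"
    using tu c rr(2) I(1) unfolding totally_unimodular_def by (auto simp: bij_betw_def)
  finally have dB: "det ?B \<in> {-1, 0, 1}" .
  have "?B *v x = 0 \<Longrightarrow> x = 0" for x
  proof -
    assume "?B *v x = 0"
    then have e: "(if j \<in> R then a (\<rho> j) \<bullet> x else x $ j) = 0" for j
      by (metis rowmix_mult zero_index)
    have "s \<bullet> x = 0" if "s \<in> S" for s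
    proof -
      consider m where "m \<in> R" "s = a (\<rho> m)" | j where "j \<notin> R" "s = axis j 1"
        using \<open>s \<in> S\<close> bij_betw_imp_surj_on[OF rho] unfolding Seq by blast
      then show ?thesis
        using e by cases (metis, metis inner_axis' inner_real_def mult_1)
    qed
    then have "S \<subseteq> {y. y \<bullet> x = 0}" by auto
    moreover have "subspace {y. y \<bullet> x = 0}"
      by (auto simp: subspace_def inner_left_distrib)
    ultimately have "UNIV \<subseteq> {y. y \<bullet> x = 0}" using spS span_minimal by blast
    then show "x = 0" using inner_eq_zero_iff by blast
  qed
  then have "invertible ?B" using matrix_left_invertible_ker invertible_left_inverse by blast
  then have "det ?B \<noteq> 0" using invertible_det_nz by blast
  then have "\<bar>det ?B\<bar> = 1" using dB by auto
  moreover have "?B $ i $ j \<in> \<int>" for i j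
  proof (cases "i \<in> R")
    case True
    then have "\<rho> i < n" using bij_betwE[OF rho] I(1) by blast
    then show ?thesis using True tu_Zlat[OF tu] by (auto simp: rowmix_def Zlat_def)
  qed (simp add: rowmix_def axis_def)
  ultimately have "?B \<in> GLZ" by (auto simp: GLZ_def)
  then show thesis using that rho by blast
qed

text \<open>Indices are selected instead of vectors because columns may coincide.\<close>

lemma maximal_independent_columns:
  fixes a :: "nat \<Rightarrow> real^'g::finite"
  assumes "finite I"
  obtains J where "J \<subseteq> I" "inj_on a J" "independent (a ` J)" "a ` I \<subseteq> span (a ` J)"
proof -
  obtain T where T: "T \<subseteq> a ` I" "independent T" "a ` I \<subseteq> span T"
    using maximal_independent_subset[of "a ` I"] by blast
  obtain J where "J \<subseteq> I" "inj_on a J" "a ` J = T"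
    using subset_image_inj[of T a I] T(1) by blast
  then show thesis using T that by metis
qed

lemma orth_span:
  fixes x :: "'a::real_inner"
  assumes "\<And>s. s \<in> S \<Longrightarrow> s \<bullet> x = 0" "y \<in> span S" shows "y \<bullet> x = 0"
proof -
  have "subspace {y. y \<bullet> x = 0}" by (auto simp: subspace_def inner_left_distrib)
  then show ?thesis using assms span_minimal[of S "{y. y \<bullet> x = 0}"] by blast
qed

lemma GLZ_surj:
  assumes "h \<in> GLZ" obtains v where "h *v v = b"
  by (metis GLZ_inv_mult(1)[OF assms] matrix_vector_mul_assoc matrix_vector_mul_lid)

lemma GLZ_cancel:
  assumes "h \<in> GLZ" "h *v x = h *v y" shows "x = y"
proof -
  have "matrix_inv h *v (h *v x) = matrix_inv h *v (h *v y)" using assms(2) by simp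
  then show ?thesis
    unfolding matrix_vector_mul_assoc GLZ_inv_mult(2)[OF assms(1)] matrix_vector_mul_lid .
qed

text \<open>An independent subfamily is completed to a unimodular matrix and the system is solved
  with the values at x on its rows and 0 on the unit rows. The remaining forms lie in the span of
  the subfamily and follow.\<close>

lemma tu_integral_solution:
  fixes a :: "nat \<Rightarrow> real^'g::finite"
  assumes tu: "totally_unimodular n a" and I: "I \<subseteq> {..<n}" and x: "\<And>i. i \<in> I \<Longrightarrow> a i \<bullet> x \<in> \<int>"
  obtains v where "v \<in> Zlat" "\<And>i. i \<in> I \<Longrightarrow> a i \<bullet> v = a i \<bullet> x"
proof -
  have "finite I" using I finite_subset by blast
  then obtain J where J: "J \<subseteq> I" "inj_on a J" "independent (a ` J)" "a ` I \<subseteq> span (a ` J)"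
    using maximal_independent_columns by blast
  obtain R \<rho> where rho: "bij_betw \<rho> R J" and B: "rowmix R (\<lambda>j. a (\<rho> j)) \<in> GLZ"
    using tu_rowmix[OF tu _ J(2,3)] J(1) I by (metis order_trans)
  obtain v where v: "rowmix R (\<lambda>j. a (\<rho> j)) *v v = (\<chi> j. if j \<in> R then a (\<rho> j) \<bullet> x else 0)"
    using GLZ_surj[OF B] by blast
  have "(\<chi> j. if j \<in> R then a (\<rho> j) \<bullet> x else 0) \<in> Zlat"
    using bij_betwE[OF rho] J(1) x by (auto simp: Zlat_def)
  then have vZ: "v \<in> Zlat" using GLZ_solve[OF B] v by metis
  have aJ: "a i \<bullet> (v - x) = 0" if "i \<in> J" for i
  proof -
    obtain j where j: "j \<in> R" "i = \<rho> j" using rho \<open>i \<in> J\<close> unfolding bij_betw_def by blast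
    have "(rowmix R (\<lambda>j. a (\<rho> j)) *v v) $ j = a (\<rho> j) \<bullet> x" using v j by simp
    then show ?thesis using j by (simp add: rowmix_mult inner_diff_right)
  qed
  have "a i \<bullet> (v - x) = 0" if "i \<in> I" for i
    by (rule orth_span[of "a ` J"]) (use aJ J(4) that in auto)
  then show thesis using that[OF vZ] by (simp add: inner_diff_right)
qed

text \<open>The preimages of the unit vectors outside R under the unimodular completion are integral
  and span the common kernel. This is the source of the rational null space.\<close>

lemma tu_kernel_span:
  fixes a :: "nat \<Rightarrow> real^'g::finite"
  assumes tu: "totally_unimodular n a"
  shows "{x. \<forall>i<n. a i \<bullet> x = 0} \<subseteq> span ({x. \<forall>i<n. a i \<bullet> x = 0} \<inter> Zlat)"
proof
  fix x assume "x \<in> {x. \<forall>i<n. a i \<bullet> x = 0}"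
  then have x: "\<And>i. i < n \<Longrightarrow> a i \<bullet> x = 0" by auto
  obtain J where J: "J \<subseteq> {..<n}" "inj_on a J" "independent (a ` J)" "a ` {..<n} \<subseteq> span (a ` J)"
    using maximal_independent_columns[of "{..<n}"] by blast
  obtain R \<rho> where rho: "bij_betw \<rho> R J" and B: "rowmix R (\<lambda>j. a (\<rho> j)) \<in> GLZ"
    using tu_rowmix[OF tu J(1-3)] by metis
  let ?B = "rowmix R (\<lambda>j. a (\<rho> j))"
  have "\<exists>v. ?B *v v = axis j 1" for j using GLZ_surj[OF B] by metis
  then obtain u where u: "\<And>j. ?B *v u j = axis j 1" by metis
  have uZ: "u j \<in> Zlat" for j using GLZ_solve[OF B] u by (metis axis_Zlat)
  have uK: "a i \<bullet> u j = 0" if "j \<notin> R" "i < n" for i j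
  proof (rule orth_span[of "a ` J"])
    show "a i \<in> span (a ` J)" using J(4) that by auto
    fix s assume "s \<in> a ` J"
    then obtain m where m: "m \<in> R" "s = a (\<rho> m)" using rho unfolding bij_betw_def by blast
    have "(?B *v u j) $ m = axis j 1 $ m" using u by simp
    then show "s \<bullet> u j = 0" using m that by (auto simp: rowmix_mult axis_def)
  qed
  have "?B *v x = ?B *v (\<Sum>j\<in>-R. x $ j *\<^sub>R u j)"
  proof -
    have "?B *v (\<Sum>j\<in>-R. x $ j *\<^sub>R u j) = (\<Sum>j\<in>-R. x $ j *\<^sub>R axis j 1)"
      by (simp add: linear_sum[OF matrix_vector_mul_linear] matrix_vector_mult_scaleR u)
    also have "\<dots> = ?B *v x"
    proof (subst vec_eq_iff, rule allI)
      fix m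
      have "(\<Sum>j\<in>-R. x $ j *\<^sub>R axis j 1 :: real^'g) $ m = (\<Sum>j\<in>-R. if j = m then x $ j else 0)"
        unfolding sum_component by (rule sum.cong) (auto simp: axis_def)
      also have "\<dots> = (if m \<in> R then 0 else x $ m)" by simp
      also have "\<dots> = (?B *v x) $ m"
        using x J(1) bij_betwE[OF rho] by (auto simp: rowmix_mult)
      finally show "(\<Sum>j\<in>-R. x $ j *\<^sub>R axis j 1 :: real^'g) $ m = (?B *v x) $ m" .
    qed
    finally show ?thesis by simp
  qed
  then have "x = (\<Sum>j\<in>-R. x $ j *\<^sub>R u j)" by (rule GLZ_cancel[OF B])
  moreover have "(\<Sum>j\<in>-R. x $ j *\<^sub>R u j) \<in> span ({x. \<forall>i<n. a i \<bullet> x = 0} \<inter> Zlat)"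
    using uZ uK by (intro span_sum span_scale span_base) auto
  ultimately show "x \<in> span ({x. \<forall>i<n. a i \<bullet> x = 0} \<inter> Zlat)" by simp
qed

text \<open>Move along a direction that fixes the integral coordinates until another coordinate becomes
  integral.\<close>
lemma tu_rounding:
  fixes a :: "nat \<Rightarrow> real^'g::finite"
  assumes tu: "totally_unimodular n a" and c: "\<And>z. (\<And>i. i < n \<Longrightarrow> a i \<bullet> z = 0) \<Longrightarrow> c \<bullet> z = 0"
  shows "\<exists>v\<in>Zlat. (\<forall>i<n. of_int \<lfloor>a i \<bullet> y\<rfloor> \<le> a i \<bullet> v \<and> a i \<bullet> v \<le> of_int \<lceil>a i \<bullet> y\<rceil>) \<and> c \<bullet> v \<le> c \<bullet> y"
proof (induction "card {i. i < n \<and> a i \<bullet> y \<notin> \<int>}" arbitrary: y rule: less_induct)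
  case less
  define N where "N = {i. i < n \<and> a i \<bullet> y \<notin> \<int>}"
  have finN: "finite N" by (simp add: N_def)
  have "a i \<bullet> y \<in> \<int>" if "i \<in> {..<n} - N" for i using that by (auto simp: N_def)
  then obtain v0 where v0: "v0 \<in> Zlat" "\<And>i. i \<in> {..<n} - N \<Longrightarrow> a i \<bullet> v0 = a i \<bullet> y"
    using tu_integral_solution[OF tu Diff_subset[of _ N], of y] by blast
  show ?case
  proof (cases "N = {}")
    case True
    then have e: "a i \<bullet> v0 = a i \<bullet> y" if "i < n" for i using v0(2) that by auto
    then have "c \<bullet> (v0 - y) = 0" by (intro c) (auto simp: inner_diff_right)
    then show ?thesis using v0(1) e by (intro bexI[of _ v0]) (auto simp: inner_diff_right)
  next
    case False
    define d0 where "d0 = v0 - y"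
    have d0: "a i \<bullet> d0 \<noteq> 0" if "i \<in> N" for i
    proof
      assume "a i \<bullet> d0 = 0"
      then have "a i \<bullet> y = a i \<bullet> v0" by (simp add: d0_def inner_diff_right)
      also have "\<dots> \<in> \<int>" using that tu_Zlat[OF tu] v0(1) by (intro inner_Zlat) (auto simp: N_def)
      finally show False using that by (simp add: N_def)
    qed
    \<comment> \<open>Moving along \<open>- d0\<close> fixes the same integral values, so the sign
      can be chosen such that c does not increase.\<close>
    define d where "d = (if c \<bullet> d0 \<le> 0 then d0 else - d0)"
    have cd: "c \<bullet> d \<le> 0" by (simp add: d_def)
    have dN: "a i \<bullet> d \<noteq> 0" if "i \<in> N" for i using d0[OF that] by (simp add: d_def)
    have dn: "a i \<bullet> d = 0" if "i < n" "i \<notin> N" for i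
      using v0(2)[of i] that by (simp add: d_def d0_def inner_diff_right)
    \<comment> \<open>The time at which form i reaches an integer in its direction of motion.
      Stopping at the least such time makes one more form integral and keeps all forms between their
      floors and ceilings.\<close>
    define \<tau> where "\<tau> i = (if a i \<bullet> d > 0 then (of_int \<lceil>a i \<bullet> y\<rceil> - a i \<bullet> y) / (a i \<bullet> d)
       else (of_int \<lfloor>a i \<bullet> y\<rfloor> - a i \<bullet> y) / (a i \<bullet> d))" for i
    define t where "t = Min (\<tau> ` N)"
    have strict: "of_int \<lfloor>a i \<bullet> y\<rfloor> < a i \<bullet> y \<and> a i \<bullet> y < of_int \<lceil>a i \<bullet> y\<rceil>" if "i \<in> N" for i
      using that unfolding N_def
      by (metis (mono_tags, lifting) Ints_of_int ceiling_correct floor_correct less_eq_real_def mem_Collect_eq)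
    have taupos: "\<tau> i > 0" if "i \<in> N" for i
      using strict[OF that] dN[OF that] by (auto simp: \<tau>_def divide_simps)
    have tpos: "t > 0" unfolding t_def using False finN taupos by simp
    have tle: "t \<le> \<tau> i" if "i \<in> N" for i unfolding t_def using that finN by simp
    have "t \<in> \<tau> ` N" unfolding t_def using False finN by (intro Min_in) auto
    then obtain i0 where i0: "i0 \<in> N" "t = \<tau> i0" by blast
    define y' where "y' = y + t *\<^sub>R d"
    have ay': "a i \<bullet> y' = a i \<bullet> y + t * (a i \<bullet> d)" for i by (simp add: y'_def inner_add_right)
    have bnd: "of_int \<lfloor>a i \<bullet> y\<rfloor> \<le> a i \<bullet> y' \<and> a i \<bullet> y' \<le> of_int \<lceil>a i \<bullet> y\<rceil>" if i: "i < n" for i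
    proof (cases "i \<in> N")
      case iN: True
      consider "a i \<bullet> d > 0" | "a i \<bullet> d < 0" using dN[OF iN] by linarith
      then show ?thesis
      proof cases
        case 1
        then have "t * (a i \<bullet> d) \<le> of_int \<lceil>a i \<bullet> y\<rceil> - a i \<bullet> y"
          using tle[OF iN] by (simp add: \<tau>_def pos_le_divide_eq)
        moreover have "t * (a i \<bullet> d) > 0" using tpos 1 by simp
        ultimately show ?thesis unfolding ay' by linarith
      next
        case 2
        then have "t * (a i \<bullet> d) \<ge> of_int \<lfloor>a i \<bullet> y\<rfloor> - a i \<bullet> y"
          using tle[OF iN] by (simp add: \<tau>_def neg_le_divide_eq)
        moreover have "t * (a i \<bullet> d) < 0" using tpos 2 by (simp add: mult_pos_neg)
        ultimately show ?thesis unfolding ay' by linarith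
      qed
    next
      case False
      then show ?thesis using dn[OF i] by (simp add: ay')
    qed
    have sub: "{i. i < n \<and> a i \<bullet> y' \<notin> \<int>} \<subseteq> N - {i0}"
    proof
      fix i assume i: "i \<in> {i. i < n \<and> a i \<bullet> y' \<notin> \<int>}"
      have "i \<in> N"
      proof (rule ccontr)
        assume "i \<notin> N"
        then show False using i dn[of i] by (auto simp: ay' N_def)
      qed
      moreover have "a i0 \<bullet> y' \<in> \<int>" using dN[OF i0(1)] by (auto simp: ay' i0(2) \<tau>_def)
      ultimately show "i \<in> N - {i0}" using i by auto
    qed
    have "card {i. i < n \<and> a i \<bullet> y' \<notin> \<int>} \<le> card (N - {i0})"
      using sub finN by (intro card_mono) auto
    also have "\<dots> < card N" using finN i0(1) by (rule card_Diff1_less)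
    finally have lt: "card {i. i < n \<and> a i \<bullet> y' \<notin> \<int>} < card {i. i < n \<and> a i \<bullet> y \<notin> \<int>}"
      unfolding N_def .
    obtain v where v: "v \<in> Zlat" "\<And>i. i < n \<Longrightarrow> of_int \<lfloor>a i \<bullet> y'\<rfloor> \<le> a i \<bullet> v \<and> a i \<bullet> v \<le> of_int \<lceil>a i \<bullet> y'\<rceil>"
        "c \<bullet> v \<le> c \<bullet> y'"
      using less.hyps[OF lt] by blast
    have "of_int \<lfloor>a i \<bullet> y\<rfloor> \<le> a i \<bullet> v \<and> a i \<bullet> v \<le> of_int \<lceil>a i \<bullet> y\<rceil>" if i: "i < n" for i
    proof -
      have "\<lfloor>a i \<bullet> y\<rfloor> \<le> \<lfloor>a i \<bullet> y'\<rfloor>" "\<lceil>a i \<bullet> y'\<rceil> \<le> \<lceil>a i \<bullet> y\<rceil>"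
        using bnd[OF i] by (auto simp: le_floor_iff ceiling_le_iff)
      then show ?thesis using v(2)[OF i] by linarith
    qed
    moreover have "c \<bullet> v \<le> c \<bullet> y"
      using v(3) cd tpos by (simp add: y'_def inner_add_right mult_nonneg_nonpos order_trans)
    ultimately show ?thesis using v(1) by blast
  qed
qed

section \<open>Delaunay cells of the forms in sigma0\<close>

definition oform :: "nat \<Rightarrow> (nat \<Rightarrow> real^'g) \<Rightarrow> (nat \<Rightarrow> real) \<Rightarrow> real^'g^'g" where
  "oform n a l = (\<Sum>i<n. l i *\<^sub>R (\<chi> r s. a i $ r * a i $ s))"

lemma oform_mult: "oform n a l *v x = (\<Sum>i<n. (l i * (a i \<bullet> x)) *\<^sub>R a i)" for a :: "nat \<Rightarrow> real^'g::finite"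
proof -
  have "(\<chi> r s. a i $ r * a i $ s) *v x = (a i \<bullet> x) *\<^sub>R a i" for i
    by (simp add: vec_eq_iff matrix_vector_mult_def inner_vec_def sum_distrib_left sum_distrib_right mult_ac)
  then show ?thesis
    unfolding oform_def
    by (induction n) (simp_all add: matrix_vector_mult_add_rdistrib scaleR_matrix_vector_assoc[symmetric])
qed

lemma qf_oform: "qf (oform n a l) x = (\<Sum>i<n. l i * (a i \<bullet> x)\<^sup>2)"
  by (simp add: qf_def oform_mult inner_sum_right power2_eq_square inner_commute mult_ac)

lemma oform_ker:
  assumes l: "\<And>i. i < n \<Longrightarrow> l i > 0"
  shows "oform n a l *v x = 0 \<longleftrightarrow> (\<forall>i<n. a i \<bullet> x = 0)"
proof
  assume "oform n a l *v x = 0"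
  then have "(\<Sum>i<n. l i * (a i \<bullet> x)\<^sup>2) = 0" by (simp add: qf_oform[symmetric] qf_def)
  then have "\<forall>i\<in>{..<n}. l i * (a i \<bullet> x)\<^sup>2 = 0"
    using l by (subst (asm) sum_nonneg_eq_0_iff) (auto simp: less_imp_le)
  then have "i < n \<Longrightarrow> l i * (a i \<bullet> x)\<^sup>2 = 0" for i by simp
  then show "\<forall>i<n. a i \<bullet> x = 0" using l by (metis less_irrefl mult_eq_0_iff zero_eq_power2)
qed (simp add: oform_mult)

lemma oform_sym: "transpose (oform n a l) = oform n a l" for a :: "nat \<Rightarrow> real^'g::finite"
  by (simp add: vec_eq_iff transpose_def oform_def sum_component mult.commute)

text \<open>The vertices of a Delaunay cell.\<close>
definition nearest :: "real^'g^'g \<Rightarrow> real^'g \<Rightarrow> (real^'g) set" where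
  "nearest Q x = {v\<in>Zlat. \<forall>w\<in>Zlat. qf Q (x - v) \<le> qf Q (x - w)}"

lemma Zlat_add: "u \<in> Zlat \<Longrightarrow> v \<in> Zlat \<Longrightarrow> u + v \<in> Zlat"
  and Zlat_diff: "u \<in> Zlat \<Longrightarrow> v \<in> Zlat \<Longrightarrow> u - v \<in> Zlat"
  and Zlat_minus: "u \<in> Zlat \<Longrightarrow> - u \<in> Zlat"
  and Zlat_0: "0 \<in> Zlat"
  by (auto simp: Zlat_def)

lemma qf_minus: "qf Q (- x) = qf Q x" for Q :: "real^'g^'g::finite"
proof -
  have "Q *v (- x) = - (Q *v x)" by (metis matrix_vector_mult_scaleR scaleR_minus1_left)
  then show ?thesis by (simp add: qf_def)
qed

lemma qf_minus_commute: "qf Q (x - y) = qf Q (y - x)" for Q :: "real^'g^'g::finite"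
  using qf_minus[of Q "x - y"] by simp

text \<open>The translates of the Voronoi cell that contain x are centred at the lattice points
  nearest to x. The type of the Voronoi tiling is therefore the collection of Delaunay vertex sets,
  which is the form used from here on.\<close>

lemma vor_type_nearest: "vor_type Q = range (nearest Q)" for Q :: "real^'g^'g::finite"
proof -
  have "{v\<in>Zlat. x - v \<in> vor Q} = nearest Q x" for x
  proof -
    have "(\<forall>u\<in>Zlat. qf Q (x - v) \<le> qf Q (u - (x - v))) \<longleftrightarrow> (\<forall>w\<in>Zlat. qf Q (x - v) \<le> qf Q (x - w))"
      if v: "v \<in> Zlat" for v
    proof
      assume L: "\<forall>u\<in>Zlat. qf Q (x - v) \<le> qf Q (u - (x - v))"
      show "\<forall>w\<in>Zlat. qf Q (x - v) \<le> qf Q (x - w)"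
      proof
        fix w :: "real^'g" assume "w \<in> Zlat"
        then have "qf Q (x - v) \<le> qf Q ((w - v) - (x - v))" using L v Zlat_diff by blast
        then show "qf Q (x - v) \<le> qf Q (x - w)" by (simp add: qf_minus_commute[of Q x w])
      qed
    next
      assume L: "\<forall>w\<in>Zlat. qf Q (x - v) \<le> qf Q (x - w)"
      show "\<forall>u\<in>Zlat. qf Q (x - v) \<le> qf Q (u - (x - v))"
      proof
        fix u :: "real^'g" assume "u \<in> Zlat"
        then have "qf Q (x - v) \<le> qf Q (x - (u + v))" using L v Zlat_add by blast
        then show "qf Q (x - v) \<le> qf Q (u - (x - v))"
          by (simp add: qf_minus_commute[of Q x "u + v"] algebra_simps)
      qed
    qed
    then show ?thesis by (auto simp: vor_def nearest_def)
  qed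
  then show ?thesis by (simp add: vor_type_def)
qed

definition dface :: "nat \<Rightarrow> (nat \<Rightarrow> real^'g) \<Rightarrow> (nat \<Rightarrow> int) \<Rightarrow> (nat \<Rightarrow> int) \<Rightarrow> (real^'g) set" where
  "dface n a lo hi = {v\<in>Zlat. \<forall>i<n. of_int (lo i) \<le> a i \<bullet> v \<and> a i \<bullet> v \<le> of_int (hi i)}"

text \<open>Width 0 is allowed in each coordinate, so that faces of every dimension are
  boxes.\<close>

definition unit_box :: "nat \<Rightarrow> (nat \<Rightarrow> int) \<Rightarrow> (nat \<Rightarrow> int) \<Rightarrow> bool" where
  "unit_box n lo hi \<longleftrightarrow> (\<forall>i<n. lo i \<le> hi i \<and> hi i \<le> lo i + 1)"

text \<open>The faces of the lattice dicing by the hyperplanes on which some column form is integral.\<close>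
definition dicing :: "nat \<Rightarrow> (nat \<Rightarrow> real^'g) \<Rightarrow> (real^'g) set set" where
  "dicing n a = {dface n a lo hi | lo hi. unit_box n lo hi \<and> dface n a lo hi \<noteq> {}}"

text \<open>No integer lies strictly between two integers at distance at most 1, so this quadratic,
  negative only between its roots, is a nonnegative penalty on integers.\<close>

lemma int_box_product:
  fixes t lo hi :: int
  assumes "lo \<le> hi" "hi \<le> lo + 1"
  shows "(t - lo) * (t - hi) \<ge> 0" "(t - lo) * (t - hi) = 0 \<longleftrightarrow> lo \<le> t \<and> t \<le> hi"
proof -
  consider "t < lo" | "t = lo" | "t = hi" | "t > hi" using assms by linarith
  then have "(t - lo) * (t - hi) \<ge> 0 \<and> ((t - lo) * (t - hi) = 0 \<longleftrightarrow> lo \<le> t \<and> t \<le> hi)"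
    using assms by cases (auto simp: mult_neg_neg less_imp_le)
  then show "(t - lo) * (t - hi) \<ge> 0" "(t - lo) * (t - hi) = 0 \<longleftrightarrow> lo \<le> t \<and> t \<le> hi" by auto
qed

text \<open>The weighted penalty differs from the form by an affine function, so it exhibits an
  affine function that lies below the form on the lattice and touches it exactly on the
  face.\<close>

lemma dface_penalty:
  fixes a :: "nat \<Rightarrow> real^'g::finite"
  assumes az: "\<And>i. i < n \<Longrightarrow> a i \<in> Zlat" and l: "\<And>i. i < n \<Longrightarrow> l i > 0" and bx: "unit_box n lo hi"
    and v: "v \<in> Zlat"
  shows "(\<Sum>i<n. l i * ((a i \<bullet> v - of_int (lo i)) * (a i \<bullet> v - of_int (hi i)))) \<ge> (0::real)"
    "(\<Sum>i<n. l i * ((a i \<bullet> v - of_int (lo i)) * (a i \<bullet> v - of_int (hi i)))) = (0::real) \<longleftrightarrow> v \<in> dface n a lo hi"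
proof -
  have e: "l i * ((a i \<bullet> v - of_int (lo i)) * (a i \<bullet> v - of_int (hi i))) \<ge> 0 \<and>
     (l i * ((a i \<bullet> v - of_int (lo i)) * (a i \<bullet> v - of_int (hi i))) = 0 \<longleftrightarrow>
       of_int (lo i) \<le> a i \<bullet> v \<and> a i \<bullet> v \<le> of_int (hi i))" if i: "i < n" for i
  proof -
    obtain t where t: "a i \<bullet> v = of_int t" using inner_Zlat[OF az[OF i] v] by (auto elim: Ints_cases)
    have b: "lo i \<le> hi i" "hi i \<le> lo i + 1" using bx i by (auto simp: unit_box_def)
    have p: "(a i \<bullet> v - of_int (lo i)) * (a i \<bullet> v - of_int (hi i)) = of_int ((t - lo i) * (t - hi i))"
      by (simp add: t)
    have "(0::real) \<le> of_int ((t - lo i) * (t - hi i))" using int_box_product(1)[OF b] by (simp only: of_int_0_le_iff)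
    moreover have "(of_int ((t - lo i) * (t - hi i)) = (0::real)) \<longleftrightarrow> lo i \<le> t \<and> t \<le> hi i"
      using int_box_product(2)[OF b] by (simp only: of_int_eq_0_iff)
    ultimately show ?thesis unfolding p using l[OF i] by (auto simp: t)
  qed
  then show "(\<Sum>i<n. l i * ((a i \<bullet> v - of_int (lo i)) * (a i \<bullet> v - of_int (hi i)))) \<ge> 0"
    by (intro sum_nonneg) auto
  show "(\<Sum>i<n. l i * ((a i \<bullet> v - of_int (lo i)) * (a i \<bullet> v - of_int (hi i)))) = 0 \<longleftrightarrow> v \<in> dface n a lo hi"
    using e v by (subst sum_nonneg_eq_0_iff) (auto simp: dface_def)
qed

lemma sym_range:
  fixes Q :: "real^'g^'g::finite"
  assumes sym: "transpose Q = Q" and y: "\<And>z. Q *v z = 0 \<Longrightarrow> y \<bullet> z = 0"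
  obtains c where "Q *v c = y"
proof -
  let ?U = "range ((*v) Q)"
  have sub: "subspace ?U" by (simp add: linear_subspace_image matrix_vector_mul_linear)
  obtain u z where uz: "u \<in> span ?U" "\<And>w. w \<in> span ?U \<Longrightarrow> orthogonal z w" "y = u + z"
    using orthogonal_subspace_decomp_exists[of ?U y] by metis
  have "z \<bullet> (Q *v w) = 0" for w using uz(2)[of "Q *v w"] by (simp add: orthogonal_def span_base)
  then have "(Q *v z) \<bullet> w = 0" for w by (metis dot_lmul_matrix inner_commute sym transpose_matrix_vector)
  then have "Q *v z = 0" using inner_eq_zero_iff by blast
  then have "y \<bullet> z = 0" by (rule y)
  moreover have "u \<bullet> z = 0" using uz by (simp add: orthogonal_def inner_commute)
  ultimately have "z \<bullet> z = 0" using uz(3) by (simp add: inner_add_left)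
  then have "y = u" using uz(3) by simp
  moreover have "span ?U = ?U" using sub span_eq_iff by blast
  ultimately have "y \<in> ?U" using uz(1) by metis
  then show thesis using that by auto
qed

lemma qf_diff:
  fixes Q :: "real^'g^'g::finite"
  assumes "transpose Q = Q"
  shows "qf Q (c - v) = qf Q c - 2 * ((Q *v c) \<bullet> v) + qf Q v"
proof -
  have "c \<bullet> (Q *v v) = (Q *v c) \<bullet> v" by (metis assms dot_lmul_matrix transpose_matrix_vector)
  then show ?thesis
    by (simp add: qf_def matrix_vector_mult_diff_distrib inner_diff_left inner_diff_right inner_commute)
qed

text \<open>On a face of the dicing the form agrees with an affine function, which it dominates
  elsewhere; the linear part of that function determines the centre.\<close>
lemma dicing_face_is_nearest:
  fixes a :: "nat \<Rightarrow> real^'g::finite"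
  assumes az: "\<And>i. i < n \<Longrightarrow> a i \<in> Zlat" and l: "\<And>i. i < n \<Longrightarrow> l i > 0" and bx: "unit_box n lo hi"
    and ne: "dface n a lo hi \<noteq> {}"
  shows "\<exists>x. nearest (oform n a l) x = dface n a lo hi"
proof -
  let ?Q = "oform n a l"
  \<comment> \<open>Completing the square: with \<open>?Q *v c = ?y\<close> the linear terms of the
    penalty and of the squared distance from c agree.\<close>
  let ?y = "(1/2) *\<^sub>R (\<Sum>i<n. (l i * of_int (lo i + hi i)) *\<^sub>R a i)"
  let ?p = "\<lambda>v. \<Sum>i<n. l i * ((a i \<bullet> v - of_int (lo i)) * (a i \<bullet> v - of_int (hi i)))"
  have "?y \<bullet> z = 0" if "?Q *v z = 0" for z
    using that oform_ker[where n=n and l=l and a=a and x=z, OF l] by (simp add: inner_sum_left)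
  then obtain c where c: "?Q *v c = ?y" using sym_range[OF oform_sym, of n a l ?y] by blast
  have p: "?p v = qf ?Q (c - v) - qf ?Q c + (\<Sum>i<n. l i * (of_int (lo i) * of_int (hi i)))" for v
    unfolding qf_diff[OF oform_sym] unfolding c qf_oform
    by (simp add: inner_sum_left sum_subtractf[symmetric] sum.distrib[symmetric])
       (intro sum.cong refl, simp add: algebra_simps power2_eq_square)
  obtain f where f: "f \<in> dface n a lo hi" using ne by auto
  then have fZ: "f \<in> Zlat" by (simp add: dface_def)
  have P: "?p v \<ge> 0" "?p v = 0 \<longleftrightarrow> v \<in> dface n a lo hi" if "v \<in> Zlat" for v
    using dface_penalty[where a=a and l=l, OF az l bx that] by simp_all
  have pf: "?p f = 0" using P(2)[OF fZ] f by simp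
  have "nearest ?Q c = dface n a lo hi"
  proof (intro set_eqI iffI)
    fix v assume "v \<in> nearest ?Q c"
    then have v: "v \<in> Zlat" "qf ?Q (c - v) \<le> qf ?Q (c - f)" using fZ by (auto simp: nearest_def)
    then have "?p v \<le> ?p f" unfolding p by simp
    then have "?p v = 0" using pf P(1)[OF v(1)] by linarith
    then show "v \<in> dface n a lo hi" using P(2)[OF v(1)] by simp
  next
    fix v assume v: "v \<in> dface n a lo hi"
    then have vZ: "v \<in> Zlat" by (simp add: dface_def)
    have pv: "?p v = 0" using P(2)[OF vZ] v by simp
    have "qf ?Q (c - v) \<le> qf ?Q (c - w)" if "w \<in> Zlat" for w
    proof -
      have "?p v \<le> ?p w" using pv P(1)[OF that] by linarith
      then show ?thesis unfolding p by simp
    qed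
    then show "v \<in> nearest ?Q c" using vZ by (simp add: nearest_def)
  qed
  then show ?thesis by blast
qed

text \<open>Infinitely many lattice points can be as close to x as 0 when the form is degenerate.
  The cost depends only on the integers \<open>a i \<bullet> v\<close>, and these are bounded there,
  so it takes finitely many values.\<close>

lemma nearest_oform_nonempty:
  fixes a :: "nat \<Rightarrow> real^'g::finite"
  assumes az: "\<And>i. i < n \<Longrightarrow> a i \<in> Zlat" and l: "\<And>i. i < n \<Longrightarrow> l i > 0"
  shows "nearest (oform n a l) x \<noteq> {}"
proof -
  define cost where "cost v = qf (oform n a l) (x - v)" for v
  have cost: "cost v = (\<Sum>i<n. l i * (a i \<bullet> x - a i \<bullet> v)\<^sup>2)" for v
    by (simp add: cost_def qf_oform inner_diff_right)
  define S where "S = {v\<in>Zlat. cost v \<le> cost 0}"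
  define m where "m v = (\<lambda>i\<in>{..<n}. \<lfloor>a i \<bullet> v\<rfloor>)" for v
  \<comment> \<open>The bound comes from \<open>\<bar>s\<bar> \<le> 1 + s\<^sup>2\<close>, applied
    to the difference of the values of form i at x and at v.\<close>
  define K where "K i = \<lceil>\<bar>a i \<bullet> x\<bar> + 1 + cost 0 / l i\<rceil>" for i
  have S0: "0 \<in> S" by (simp add: S_def Zlat_0)
  have "m ` S \<subseteq> (\<Pi>\<^sub>E i\<in>{..<n}. {- K i .. K i})"
  proof clarify
    fix v assume v: "v \<in> S"
    have "\<lfloor>a i \<bullet> v\<rfloor> \<in> {- K i .. K i}" if i: "i < n" for i
    proof -
      obtain t where t: "a i \<bullet> v = of_int t"
        using inner_Zlat[OF az[OF i]] v by (auto simp: S_def elim: Ints_cases)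
      have "l i * (a i \<bullet> x - a i \<bullet> v)\<^sup>2 \<le> cost v"
        unfolding cost using i l by (intro member_le_sum) (auto simp: less_imp_le)
      also have "\<dots> \<le> cost 0" using v by (simp add: S_def)
      finally have "(a i \<bullet> x - a i \<bullet> v)\<^sup>2 \<le> cost 0 / l i"
        using l[OF i] by (simp add: field_simps)
      moreover have "\<bar>s\<bar> \<le> 1 + s\<^sup>2" for s :: real
        using zero_le_power2[of "\<bar>s\<bar> - 1"] by (simp add: power2_eq_square algebra_simps)
      ultimately have "\<bar>a i \<bullet> v\<bar> \<le> \<bar>a i \<bullet> x\<bar> + 1 + cost 0 / l i"
        by (smt (verit, best))
      also have "\<dots> \<le> of_int (K i)" unfolding K_def by (rule le_of_int_ceiling)
      finally show ?thesis unfolding t by (simp, linarith)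
    qed
    then show "m v \<in> (\<Pi>\<^sub>E i\<in>{..<n}. {- K i .. K i})" by (auto simp: m_def)
  qed
  then have "finite (m ` S)" by (rule finite_subset) (auto intro: finite_PiE)
  moreover have "cost v = (\<Sum>i<n. l i * (a i \<bullet> x - of_int (m v i))\<^sup>2)" if "v \<in> S" for v
    unfolding cost
  proof (rule sum.cong)
    fix i assume "i \<in> {..<n}"
    then have "a i \<bullet> v \<in> \<int>" using inner_Zlat[OF az] that by (auto simp: S_def)
    then show "l i * (a i \<bullet> x - a i \<bullet> v)\<^sup>2 = l i * (a i \<bullet> x - of_int (m v i))\<^sup>2"
      using \<open>i \<in> {..<n}\<close> by (auto simp: m_def elim!: Ints_cases)
  qed simp
  then have "cost ` S = (\<lambda>m. \<Sum>i<n. l i * (a i \<bullet> x - of_int (m i))\<^sup>2) ` m ` S"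
    by (simp add: image_image)
  ultimately have fin: "finite (cost ` S)" by simp
  then obtain v where v: "v \<in> S" "cost v = Min (cost ` S)"
  proof -
    have "Min (cost ` S) \<in> cost ` S" using Min_in[OF fin] S0 by blast
    then show thesis using that by force
  qed
  have "cost v \<le> cost w" if "w \<in> Zlat" for w
  proof (cases "w \<in> S")
    case True then show ?thesis using v(2) fin by simp
  next
    case False
    then have "cost 0 < cost w" using that by (simp add: S_def)
    moreover have "cost v \<le> cost 0" using v(1) by (simp add: S_def)
    ultimately show ?thesis by simp
  qed
  then have "v \<in> nearest (oform n a l) x" using v(1) by (simp add: nearest_def cost_def S_def)
  then show ?thesis by auto
qed

text \<open>Twice a sum of two squares is the square of the sum plus the square of the difference.
  The differences \<open>p - q\<close> and \<open>r - s\<close> have the same parity, so the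
  balanced pair has the smaller one.\<close>

lemma int_balanced_squares:
  fixes p q r s :: int
  assumes "p + q = r + s" "\<bar>r - s\<bar> \<le> 1"
  shows "r\<^sup>2 + s\<^sup>2 \<le> p\<^sup>2 + q\<^sup>2" "\<bar>p - q\<bar> \<ge> 2 \<Longrightarrow> r\<^sup>2 + s\<^sup>2 < p\<^sup>2 + q\<^sup>2"
proof -
  have id: "2 * (p\<^sup>2 + q\<^sup>2) - 2 * (r\<^sup>2 + s\<^sup>2) = (p - q)\<^sup>2 - (r - s)\<^sup>2"
  proof -
    have "(p + q)\<^sup>2 = (r + s)\<^sup>2" using assms(1) by simp
    then show ?thesis by (simp add: power2_eq_square algebra_simps)
  qed
  have "\<bar>r - s\<bar> \<le> \<bar>p - q\<bar>" using assms by presburger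
  then have "(r - s)\<^sup>2 \<le> (p - q)\<^sup>2" by (simp add: abs_le_square_iff)
  then have "0 \<le> 2 * (p\<^sup>2 + q\<^sup>2) - 2 * (r\<^sup>2 + s\<^sup>2)" unfolding id by simp
  moreover have "0 \<le> 2 * A - 2 * B \<Longrightarrow> B \<le> A" for A B :: int by linarith
  ultimately show "r\<^sup>2 + s\<^sup>2 \<le> p\<^sup>2 + q\<^sup>2" by blast
  assume "\<bar>p - q\<bar> \<ge> 2"
  then have "\<bar>r - s\<bar> < \<bar>p - q\<bar>" using assms by linarith
  then have "(r - s)\<^sup>2 < (p - q)\<^sup>2" by (metis abs_ge_zero power2_abs power_strict_mono zero_less_numeral)
  then have "0 < 2 * (p\<^sup>2 + q\<^sup>2) - 2 * (r\<^sup>2 + s\<^sup>2)" unfolding id by simp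
  moreover have "0 < 2 * A - 2 * B \<Longrightarrow> B < A" for A B :: int by linarith
  ultimately show "r\<^sup>2 + s\<^sup>2 < p\<^sup>2 + q\<^sup>2" by blast
qed

text \<open>The midpoint of u and v is rounded to a lattice point r, and s is its mirror image.
  Along every form r and s have the same sum as u and v but are balanced, so their total cost is not
  larger, and it is smaller if u and v are 2 apart along some form. Then u and v cannot both be
  nearest.\<close>

lemma nearest_oform_close:
  fixes a :: "nat \<Rightarrow> real^'g::finite"
  assumes tu: "totally_unimodular n a" and l: "\<And>i. i < n \<Longrightarrow> l i > 0"
    and u: "u \<in> nearest (oform n a l) x" and v: "v \<in> nearest (oform n a l) x" and i: "i < n"
  shows "\<bar>a i \<bullet> u - a i \<bullet> v\<bar> \<le> 1"
proof (rule ccontr)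
  assume far: "\<not> ?thesis"
  let ?Q = "oform n a l"
  have uZ: "u \<in> Zlat" and vZ: "v \<in> Zlat" using u v by (auto simp: nearest_def)
  obtain r where r: "r \<in> Zlat" "\<And>j. j < n \<Longrightarrow>
      of_int \<lfloor>a j \<bullet> ((1/2) *\<^sub>R (u + v))\<rfloor> \<le> a j \<bullet> r \<and> a j \<bullet> r \<le> of_int \<lceil>a j \<bullet> ((1/2) *\<^sub>R (u + v))\<rceil>"
    using tu_rounding[OF tu, of 0 "(1/2) *\<^sub>R (u + v)"] by auto
  define s where "s = u + v - r"
  have sZ: "s \<in> Zlat" using uZ vZ r(1) by (auto simp: s_def intro: Zlat_add Zlat_diff)
  have key: "l j * (a j \<bullet> (x - r))\<^sup>2 + l j * (a j \<bullet> (x - s))\<^sup>2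
       \<le> l j * (a j \<bullet> (x - u))\<^sup>2 + l j * (a j \<bullet> (x - v))\<^sup>2 \<and> (j = i \<longrightarrow>
       l j * (a j \<bullet> (x - r))\<^sup>2 + l j * (a j \<bullet> (x - s))\<^sup>2
       < l j * (a j \<bullet> (x - u))\<^sup>2 + l j * (a j \<bullet> (x - v))\<^sup>2)" if j: "j < n" for j
  proof -
    have aj: "a j \<in> Zlat" by (rule tu_Zlat[OF tu j])
    obtain p q k where pq: "a j \<bullet> u = of_int p" "a j \<bullet> v = of_int q" "a j \<bullet> r = of_int k"
      using inner_Zlat[OF aj uZ] inner_Zlat[OF aj vZ] inner_Zlat[OF aj r(1)] by (auto elim!: Ints_cases)
    define m where "m = p + q - k"
    have sm: "a j \<bullet> s = of_int m" by (simp add: s_def m_def pq inner_diff_right inner_add_right)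
    have "of_int \<lfloor>(of_int p + of_int q) / 2 :: real\<rfloor> \<le> (of_int k :: real) \<and> (of_int k::real) \<le> of_int \<lceil>(of_int p + of_int q) / 2 :: real\<rceil>"
      using r(2)[OF j] by (simp add: pq inner_add_right)
    then have "\<bar>2 * k - (p + q)\<bar> \<le> 1"
      by (simp add: floor_le_iff le_ceiling_iff) linarith
    then have km: "p + q = k + m" "\<bar>k - m\<bar> \<le> 1" by (auto simp: m_def)
    let ?t = "a j \<bullet> x"
    have "(?t - of_int k)\<^sup>2 + (?t - of_int m)\<^sup>2 - ((?t - of_int p)\<^sup>2 + (?t - of_int q)\<^sup>2)
       = of_int (k\<^sup>2 + m\<^sup>2) - of_int (p\<^sup>2 + q\<^sup>2)"
    proof -
      show ?thesis by (simp add: m_def power2_eq_square algebra_simps)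
    qed
    moreover have "(of_int (k\<^sup>2 + m\<^sup>2) :: real) \<le> of_int (p\<^sup>2 + q\<^sup>2)"
      using int_balanced_squares(1)[OF km] by (simp only: of_int_le_iff)
    moreover have "(of_int (k\<^sup>2 + m\<^sup>2) :: real) < of_int (p\<^sup>2 + q\<^sup>2)" if "j = i"
    proof -
      have "\<bar>p - q\<bar> \<ge> 2" using far that pq by simp
      then show ?thesis using int_balanced_squares(2)[OF km] by (simp only: of_int_less_iff)
    qed
    ultimately have A: "(?t - of_int k)\<^sup>2 + (?t - of_int m)\<^sup>2 \<le> (?t - of_int p)\<^sup>2 + (?t - of_int q)\<^sup>2"
      and B: "j = i \<Longrightarrow> (?t - of_int k)\<^sup>2 + (?t - of_int m)\<^sup>2 < (?t - of_int p)\<^sup>2 + (?t - of_int q)\<^sup>2"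
      by linarith+
    show ?thesis
      using A B l[OF j] unfolding inner_diff_right pq sm distrib_left[symmetric] by auto
  qed
  have "qf ?Q (x - r) + qf ?Q (x - s) < qf ?Q (x - u) + qf ?Q (x - v)"
    unfolding qf_oform sum.distrib[symmetric]
    by (rule sum_strict_mono_ex1) (use key i in auto)
  moreover have "qf ?Q (x - u) \<le> qf ?Q (x - r)" using u r(1) by (simp add: nearest_def)
  moreover have "qf ?Q (x - v) \<le> qf ?Q (x - s)" using v sZ by (simp add: nearest_def)
  ultimately show False by linarith
qed

text \<open>A nearest set spans a box; averaging its extreme points gives an interior point of the
  box, from which one could move away from any box point that is not nearest.\<close>
lemma nearest_oform_dface:
  fixes a :: "nat \<Rightarrow> real^'g::finite"
  assumes tu: "totally_unimodular n a" and l: "\<And>i. i < n \<Longrightarrow> l i > 0"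
  shows "nearest (oform n a l) x \<in> dicing n a"
proof -
  let ?Q = "oform n a l"
  let ?N = "nearest ?Q x"
  have az: "\<And>i. i < n \<Longrightarrow> a i \<in> Zlat" by (rule tu_Zlat[OF tu])
  obtain v0 where v0: "v0 \<in> ?N" using nearest_oform_nonempty[where a=a and l=l, OF az l] by blast
  have NZ: "v \<in> Zlat" if "v \<in> ?N" for v using that by (simp add: nearest_def)
  have flo: "a i \<bullet> v = of_int \<lfloor>a i \<bullet> v\<rfloor>" if "i < n" "v \<in> Zlat" for i v
    using inner_Zlat[OF az[OF that(1)] that(2)] by (auto elim: Ints_cases)
  define Z where "Z i = (\<lambda>v. \<lfloor>a i \<bullet> v\<rfloor>) ` ?N" for i
  define lo where "lo i = Min (Z i)" for i
  define hi where "hi i = Max (Z i)" for i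
  have close: "\<bar>\<lfloor>a i \<bullet> u\<rfloor> - \<lfloor>a i \<bullet> v\<rfloor>\<bar> \<le> 1" if "i < n" "u \<in> ?N" "v \<in> ?N" for i u v
  proof -
    have "\<bar>a i \<bullet> u - a i \<bullet> v\<bar> \<le> 1" by (rule nearest_oform_close[where a=a and l=l, OF tu l that(2,3,1)])
    then have "\<bar>of_int \<lfloor>a i \<bullet> u\<rfloor> - of_int \<lfloor>a i \<bullet> v\<rfloor>\<bar> \<le> (1::real)"
      using flo[OF that(1) NZ[OF that(2)]] flo[OF that(1) NZ[OF that(3)]] by simp
    then show ?thesis by linarith
  qed
  have finZ: "finite (Z i)" if "i < n" for i
  proof (rule finite_subset)
    show "Z i \<subseteq> {\<lfloor>a i \<bullet> v0\<rfloor> - 1 .. \<lfloor>a i \<bullet> v0\<rfloor> + 1}"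
      using close[OF that _ v0] by (fastforce simp: Z_def)
  qed simp
  have neZ: "Z i \<noteq> {}" for i using v0 by (auto simp: Z_def)
  have "\<exists>u v. u \<in> ?N \<and> v \<in> ?N \<and> lo i = \<lfloor>a i \<bullet> u\<rfloor> \<and> hi i = \<lfloor>a i \<bullet> v\<rfloor>" if "i < n" for i
    using Min_in[OF finZ[OF that] neZ] Max_in[OF finZ[OF that] neZ]
    unfolding lo_def hi_def by (auto simp: Z_def)
  then obtain u w where uw0: "\<And>i. i < n \<Longrightarrow> u i \<in> ?N \<and> w i \<in> ?N \<and> lo i = \<lfloor>a i \<bullet> u i\<rfloor> \<and> hi i = \<lfloor>a i \<bullet> w i\<rfloor>"
    by metis
  then have uw: "u i \<in> ?N" "w i \<in> ?N" "lo i = \<lfloor>a i \<bullet> u i\<rfloor>" "hi i = \<lfloor>a i \<bullet> w i\<rfloor>" if "i < n" for i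
    using that by blast+
  have bnd: "of_int (lo i) \<le> a i \<bullet> v \<and> a i \<bullet> v \<le> of_int (hi i)" if "i < n" "v \<in> ?N" for i v
  proof -
    have "\<lfloor>a i \<bullet> v\<rfloor> \<in> Z i" using that by (simp add: Z_def)
    then have "lo i \<le> \<lfloor>a i \<bullet> v\<rfloor>" "\<lfloor>a i \<bullet> v\<rfloor> \<le> hi i" using finZ[OF that(1)] by (auto simp: lo_def hi_def)
    then show ?thesis using flo[OF that(1) NZ[OF that(2)]] by (metis of_int_le_iff)
  qed
  have bx: "unit_box n lo hi"
    unfolding unit_box_def
  proof (intro allI impI)
    fix i assume i: "i < n"
    have "lo i \<le> hi i" unfolding lo_def hi_def using finZ[OF i] neZ[of i] by simp
    moreover have "hi i \<le> lo i + 1" using close[OF i uw(2,1)[OF i]] uw(3,4)[OF i] by linarith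
    ultimately show "lo i \<le> hi i \<and> hi i \<le> lo i + 1" ..
  qed
  let ?F = "dface n a lo hi"
  have NF: "?N \<subseteq> ?F" using bnd NZ by (auto simp: dface_def)
  have "?F \<subseteq> ?N"
  proof
    fix f assume f: "f \<in> ?F"
    have fZ: "f \<in> Zlat" using f by (simp add: dface_def)
    \<comment> \<open>The squared distance from x is the penalty of the box plus an affine function
      with linear part c. On the lattice points of the box it is therefore affine, and the nearest
      points are the minima of c there.\<close>
    define c where "c = (\<Sum>i<n. (l i * (of_int (lo i) + of_int (hi i) - 2 * (a i \<bullet> x))) *\<^sub>R a i)"
    define K where "K = (\<Sum>i<n. l i * ((a i \<bullet> x)\<^sup>2 - of_int (lo i) * of_int (hi i)))"
    let ?p = "\<lambda>v. \<Sum>i<n. l i * ((a i \<bullet> v - of_int (lo i)) * (a i \<bullet> v - of_int (hi i)))"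
    have cost: "qf ?Q (x - v) = ?p v + c \<bullet> v + K" for v
      unfolding qf_oform c_def K_def inner_sum_left sum.distrib[symmetric]
      by (intro sum.cong refl) (simp add: algebra_simps power2_eq_square inner_diff_right)
    have costF: "qf ?Q (x - v) = c \<bullet> v + K" if "v \<in> ?F" for v
      using dface_penalty(2)[where a=a and l=l, OF az l bx, of v] that cost[of v] by (simp add: dface_def)
    have cker: "c \<bullet> z = 0" if "\<And>i. i < n \<Longrightarrow> a i \<bullet> z = 0" for z
      using that by (simp add: c_def inner_sum_left)
    define M where "M = c \<bullet> v0"
    have v0F: "v0 \<in> ?F" using v0 NF by blast
    have cN: "c \<bullet> v = M" if "v \<in> ?N" for v
    proof -
      have "qf ?Q (x - v) = qf ?Q (x - v0)"
        using that v0 by (auto simp: nearest_def intro!: antisym)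
      moreover have "v \<in> ?F" using that NF by blast
      ultimately show ?thesis using costF[of v] costF[OF v0F] by (simp add: M_def)
    qed
    have low: "M \<le> c \<bullet> v" if "v \<in> ?F" for v
    proof -
      have "qf ?Q (x - v0) \<le> qf ?Q (x - v)" using v0 that by (simp add: nearest_def dface_def)
      then show ?thesis using costF[OF that] costF[OF v0F] by (simp add: M_def)
    qed
    \<comment> \<open>The average runs over the 2n points that realise the bounds and over
      \<open>v0\<close>, which keeps it defined for n = 0.\<close>
    define \<epsilon> where "\<epsilon> = 1 / (2 * real n + 1)"
    have eps: "\<epsilon> > 0" by (simp add: \<epsilon>_def)
    define y0 where "y0 = \<epsilon> *\<^sub>R (v0 + (\<Sum>i<n. u i + w i))"
    \<comment> \<open>Each form keeps distance at least \<epsilon> times its box width from the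
      bounds at \<open>y0\<close>, so one can step from \<open>y0\<close> away from f without
      leaving the box. If f were costlier than the minimum, c would drop below M at y, and rounding
      would give a lattice point of the box below M.\<close>
    define y where "y = y0 - \<epsilon> *\<^sub>R (f - y0)"
    have en: "\<epsilon> * (2 * real n + 1) = 1" by (simp add: \<epsilon>_def)
    have y0b: "of_int (lo j) + \<epsilon> * of_int (hi j - lo j) \<le> a j \<bullet> y0 \<and> a j \<bullet> y0 \<le> of_int (hi j) - \<epsilon> * of_int (hi j - lo j)"
      if j: "j < n" for j
    proof -
      let ?l = "of_int (lo j) :: real" and ?h = "of_int (hi j) :: real"
      let ?s = "\<lambda>i. a j \<bullet> u i + a j \<bullet> w i"
      have ayy: "a j \<bullet> y0 = \<epsilon> * (a j \<bullet> v0 + (\<Sum>i<n. ?s i))"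
        by (simp add: y0_def inner_add_right inner_sum_right)
      have val: "a j \<bullet> v = of_int k" if "v \<in> ?N" "k = \<lfloor>a j \<bullet> v\<rfloor>" for v k
        unfolding that(2) by (rule flo[OF j NZ[OF that(1)]])
      have "a j \<bullet> u j = ?l" by (rule val[OF uw(1,3)[OF j]])
      moreover have "a j \<bullet> w j = ?h" by (rule val[OF uw(2,4)[OF j]])
      ultimately have sj: "?s j = ?l + ?h" by simp
      have split: "(\<Sum>i<n. ?s i) = ?s j + (\<Sum>i\<in>{..<n}-{j}. ?s i)"
        using j by (subst sum.remove[of _ j]) auto
      have cardm: "real (card ({..<n} - {j})) = real n - 1"
        using j by (simp add: of_nat_diff)
      have sb: "2 * ?l \<le> ?s i" "?s i \<le> 2 * ?h" if "i \<in> {..<n}-{j}" for i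
        using bnd[OF j uw(1)[of i]] bnd[OF j uw(2)[of i]] that by auto
      have "(\<Sum>i\<in>{..<n}-{j}. ?s i) \<le> (\<Sum>i\<in>{..<n}-{j}. 2 * ?h)"
        by (rule sum_mono[OF sb(2)])
      moreover have "(\<Sum>i\<in>{..<n}-{j}. 2 * ?l) \<le> (\<Sum>i\<in>{..<n}-{j}. ?s i)"
        by (rule sum_mono[OF sb(1)])
      ultimately have A: "a j \<bullet> v0 + (\<Sum>i<n. ?s i) \<le> (2 * real n + 1) * ?h - (?h - ?l)"
        and B: "(2 * real n + 1) * ?l + (?h - ?l) \<le> a j \<bullet> v0 + (\<Sum>i<n. ?s i)"
        using bnd[OF j v0] cardm unfolding split sj by (auto simp: algebra_simps)
      have "a j \<bullet> y0 \<le> \<epsilon> * ((2 * real n + 1) * ?h - (?h - ?l))"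
        unfolding ayy using A eps by (intro mult_left_mono) auto
      also have "\<dots> = (\<epsilon> * (2 * real n + 1)) * ?h - \<epsilon> * (?h - ?l)" by (simp add: algebra_simps)
      also have "\<dots> = ?h - \<epsilon> * (?h - ?l)" by (simp only: en mult_1)
      finally have 1: "a j \<bullet> y0 \<le> ?h - \<epsilon> * (?h - ?l)" .
      have "?l + \<epsilon> * (?h - ?l) = (\<epsilon> * (2 * real n + 1)) * ?l + \<epsilon> * (?h - ?l)" by (simp only: en mult_1)
      also have "\<dots> = \<epsilon> * ((2 * real n + 1) * ?l + (?h - ?l))" by (simp add: algebra_simps)
      also have "\<dots> \<le> a j \<bullet> y0" unfolding ayy using B eps by (intro mult_left_mono) auto
      finally show ?thesis using 1 by simp
    qed
    have yb: "of_int (lo j) \<le> a j \<bullet> y \<and> a j \<bullet> y \<le> of_int (hi j)" if j: "j < n" for j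
    proof -
      have b: "lo j \<le> hi j" using bx j by (simp add: unit_box_def)
      have fb: "of_int (lo j) \<le> a j \<bullet> f" "a j \<bullet> f \<le> of_int (hi j)" using f j by (auto simp: dface_def)
      have d: "\<bar>a j \<bullet> f - a j \<bullet> y0\<bar> \<le> of_int (hi j - lo j)"
      proof -
        have "0 \<le> \<epsilon> * of_int (hi j - lo j)" using eps b by simp
        then show ?thesis using fb y0b[OF j] by (simp add: abs_le_iff)
      qed
      have "\<bar>\<epsilon> * (a j \<bullet> f - a j \<bullet> y0)\<bar> \<le> \<epsilon> * of_int (hi j - lo j)"
        unfolding abs_mult using d eps by (simp add: mult_left_mono)
      moreover have "a j \<bullet> y = a j \<bullet> y0 - \<epsilon> * (a j \<bullet> f - a j \<bullet> y0)"
        by (simp add: y_def inner_diff_right)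
      ultimately show ?thesis using y0b[OF j] by (simp add: abs_le_iff)
    qed
    have cy0: "c \<bullet> y0 = M"
    proof -
      have "c \<bullet> y0 = \<epsilon> * (c \<bullet> v0 + (\<Sum>i<n. c \<bullet> u i + c \<bullet> w i))"
        by (simp add: y0_def inner_add_right inner_sum_right)
      also have "(\<Sum>i<n. c \<bullet> u i + c \<bullet> w i) = (\<Sum>i<n. 2 * M)"
        using uw(1,2) cN by (intro sum.cong) auto
      also have "\<epsilon> * (c \<bullet> v0 + (\<Sum>i<n. 2 * M)) = (\<epsilon> * (2 * real n + 1)) * M"
        by (simp add: M_def algebra_simps)
      finally show ?thesis by (simp only: en mult_1)
    qed
    obtain v where v: "v \<in> Zlat" "\<And>i. i < n \<Longrightarrow> of_int \<lfloor>a i \<bullet> y\<rfloor> \<le> a i \<bullet> v \<and> a i \<bullet> v \<le> of_int \<lceil>a i \<bullet> y\<rceil>"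
        "c \<bullet> v \<le> c \<bullet> y"
      using tu_rounding[OF tu, of c y] cker by blast
    have "v \<in> ?F"
    proof -
      have "of_int (lo i) \<le> a i \<bullet> v \<and> a i \<bullet> v \<le> of_int (hi i)" if i: "i < n" for i
      proof -
        have "lo i \<le> \<lfloor>a i \<bullet> y\<rfloor>" "\<lceil>a i \<bullet> y\<rceil> \<le> hi i"
          using yb[OF i] by (auto simp: le_floor_iff ceiling_le_iff)
        then show ?thesis using v(2)[OF i] by linarith
      qed
      then show ?thesis using v(1) by (simp add: dface_def)
    qed
    then have "M \<le> c \<bullet> y" using low v(3) by fastforce
    then have "\<epsilon> * (c \<bullet> f - M) \<le> 0" by (simp add: y_def inner_diff_right cy0)
    then have "c \<bullet> f \<le> M" using eps by (simp add: mult_le_0_iff)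
    then have "qf ?Q (x - f) \<le> qf ?Q (x - v0)"
      using costF[OF f] costF[OF v0F] by (simp add: M_def)
    then show "f \<in> ?N" using v0 fZ by (auto simp: nearest_def intro: order_trans)
  qed
  then have "?N = ?F" using NF by blast
  then show ?thesis using bx v0 unfolding dicing_def by blast
qed

theorem vor_type_oform:
  fixes a :: "nat \<Rightarrow> real^'g::finite"
  assumes tu: "totally_unimodular n a" and l: "\<And>i. i < n \<Longrightarrow> l i > 0"
  shows "vor_type (oform n a l) = dicing n a"
proof
  show "vor_type (oform n a l) \<subseteq> dicing n a"
    unfolding vor_type_nearest using nearest_oform_dface[where a=a and l=l, OF tu l] by blast
  show "dicing n a \<subseteq> vor_type (oform n a l)"
  proof
    fix F assume "F \<in> dicing n a"
    then obtain lo hi where F: "F = dface n a lo hi" "unit_box n lo hi" "F \<noteq> {}"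
      unfolding dicing_def by blast
    then obtain x where "nearest (oform n a l) x = F"
      using dicing_face_is_nearest[where a=a and l=l, OF tu_Zlat[OF tu] l F(2)] by blast
    then show "F \<in> vor_type (oform n a l)" unfolding vor_type_nearest by blast
  qed
qed

lemma Zlat_Qlat: "Zlat \<subseteq> Qlat"
  unfolding Zlat_def Qlat_def using Ints_subset_Rats by blast

lemma oform_Omega:
  fixes a :: "nat \<Rightarrow> real^'g::finite"
  assumes tu: "totally_unimodular n a" and l: "\<And>i. i < n \<Longrightarrow> l i > 0"
  shows "oform n a l \<in> Omega_rt"
proof -
  have ker: "{x. oform n a l *v x = 0} = {x. \<forall>i<n. a i \<bullet> x = 0}"
    using oform_ker[where a=a and l=l, OF l] by blast
  have "{x. \<forall>i<n. a i \<bullet> x = 0} \<subseteq> span ({x. \<forall>i<n. a i \<bullet> x = 0} \<inter> Zlat)"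
    by (rule tu_kernel_span[OF tu])
  also have "\<dots> \<subseteq> span ({x. \<forall>i<n. a i \<bullet> x = 0} \<inter> Qlat)"
    using Zlat_Qlat by (intro span_mono) blast
  finally show ?thesis
    unfolding Omega_rt_def mem_Collect_eq ker
    using oform_sym l by (auto simp: qf_oform less_imp_le intro!: sum_nonneg mult_nonneg_nonneg)
qed

section \<open>The action of the integral linear group on forms\<close>

lemma gl_act_mult: "gl_act h Q *v x = h *v (Q *v (transpose h *v x))" for h :: "real^'g^'g::finite"
  by (simp only: gl_act_def matrix_vector_mul_assoc[symmetric])

lemma qf_gl_act: "qf (gl_act h Q) x = qf Q (transpose h *v x)" for h :: "real^'g^'g::finite"
  unfolding qf_def gl_act_mult by (metis dot_lmul_matrix transpose_matrix_vector)

lemma gl_act_gl_act: "gl_act h (gl_act k Q) = gl_act (h ** k) Q" for h :: "real^'g^'g::finite"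
  by (simp add: gl_act_def matrix_transpose_mul matrix_mul_assoc)

lemma gl_act_id: "gl_act (mat 1) Q = Q" for Q :: "real^'g^'g::finite"
  by (simp add: gl_act_def)

text \<open>The null space is transported by the inverse transpose of h, which is integral and hence
  preserves rational vectors.\<close>

lemma gl_act_Omega:
  fixes h :: "real^'g^'g::finite"
  assumes h: "h \<in> GLZ" and Q: "Q \<in> Omega_rt"
  shows "gl_act h Q \<in> Omega_rt"
proof -
  let ?t = "transpose h" and ?k = "matrix_inv (transpose h)"
  have tG: "?t \<in> GLZ" by (rule GLZ_transpose[OF h])
  have kG: "?k \<in> GLZ" by (rule GLZ_inv[OF tG])
  have tk: "?t *v (?k *v x) = x" "?k *v (?t *v x) = x" for x
    unfolding matrix_vector_mul_assoc GLZ_inv_mult[OF tG] by (rule matrix_vector_mul_lid)+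
  let ?K = "{x. Q *v x = 0}"
  have ker: "{x. gl_act h Q *v x = 0} = (*v) ?k ` ?K"
  proof (intro set_eqI iffI)
    fix x assume "x \<in> {x. gl_act h Q *v x = 0}"
    then have "h *v (Q *v (?t *v x)) = h *v 0" by (simp add: gl_act_mult)
    then have "Q *v (?t *v x) = 0" by (rule GLZ_cancel[OF h])
    then show "x \<in> (*v) ?k ` ?K" by (intro image_eqI[of _ _ "?t *v x"]) (simp only: tk, blast)
  next
    fix x assume "x \<in> (*v) ?k ` ?K"
    then obtain z where z: "x = ?k *v z" "Q *v z = 0" by blast
    have "gl_act h Q *v x = h *v (Q *v z)" unfolding gl_act_mult z(1) tk ..
    then show "x \<in> {x. gl_act h Q *v x = 0}" using z(2) by simp
  qed
  have Qk: "(*v) ?k ` (?K \<inter> Qlat) \<subseteq> (*v) ?k ` ?K \<inter> Qlat"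
  proof -
    have "?k $ i $ j \<in> \<rat>" for i j using GLZ_entry[OF kG] Ints_subset_Rats by blast
    then have "?k *v x \<in> Qlat" if "x \<in> Qlat" for x
      using that by (auto simp: Qlat_def matrix_vector_mult_def intro!: Rats_sum Rats_mult)
    then show ?thesis by blast
  qed
  have "?K \<subseteq> span (?K \<inter> Qlat)" using Q by (simp add: Omega_rt_def)
  then have "(*v) ?k ` ?K \<subseteq> (*v) ?k ` span (?K \<inter> Qlat)" by blast
  also have "\<dots> = span ((*v) ?k ` (?K \<inter> Qlat))"
    by (simp add: linear_span_image matrix_vector_mul_linear)
  also have "\<dots> \<subseteq> span ((*v) ?k ` ?K \<inter> Qlat)" by (rule span_mono[OF Qk])
  finally have "{x. gl_act h Q *v x = 0} \<subseteq> span ({x. gl_act h Q *v x = 0} \<inter> Qlat)"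
    unfolding ker .
  moreover have "transpose (gl_act h Q) = gl_act h Q"
    using Q by (simp add: Omega_rt_def gl_act_def matrix_transpose_mul matrix_mul_assoc)
  moreover have "0 \<le> qf (gl_act h Q) x" for x using Q by (simp add: Omega_rt_def qf_gl_act)
  ultimately show ?thesis unfolding Omega_rt_def by blast
qed

lemma gl_act_Omega_iff:
  assumes "h \<in> GLZ"
  shows "gl_act h Q \<in> Omega_rt \<longleftrightarrow> Q \<in> Omega_rt"
proof
  assume "gl_act h Q \<in> Omega_rt"
  then have "gl_act (matrix_inv h) (gl_act h Q) \<in> Omega_rt" by (rule gl_act_Omega[OF GLZ_inv[OF assms]])
  then show "Q \<in> Omega_rt" by (simp only: gl_act_gl_act GLZ_inv_mult[OF assms] gl_act_id)
qed (rule gl_act_Omega[OF assms])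

lemma sigma0_oform: "sigma0 n a = {oform n a l | l. \<forall>i<n. l i > 0}"
  by (auto simp: sigma0_def oform_def)

section \<open>Interpolation on the dicing\<close>

lemma tu_entry_abs:
  assumes "totally_unimodular n a" "i < n" shows "\<bar>a i $ s\<bar> \<le> 1"
  using tu_entry[OF assms, of s] by auto

text \<open>Otherwise a step from z against \<open>Q *v z\<close> would make the form negative; the
  denominator \<open>qf Q w + 1\<close> keeps the step so short that the linear term outweighs the
  quadratic one.\<close>

lemma psd_null:
  fixes Q :: "real^'g^'g::finite"
  assumes sym: "transpose Q = Q" and psd: "\<And>x. 0 \<le> qf Q x" and z: "qf Q z = 0"
  shows "Q *v z = 0"
proof (rule ccontr)
  assume nz: "Q *v z \<noteq> 0"
  define w where "w = Q *v z"
  define s where "s = w \<bullet> w"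
  define t where "t = s / (qf Q w + 1)"
  have s: "s > 0" using nz by (simp add: s_def w_def)
  have w1: "qf Q w + 1 > 0" using psd[of w] by simp
  have t: "t > 0" using s w1 by (simp add: t_def)
  have "qf Q (z - t *\<^sub>R w) = qf Q z - 2 * ((Q *v z) \<bullet> (t *\<^sub>R w)) + qf Q (t *\<^sub>R w)"
    by (rule qf_diff[OF sym])
  also have "\<dots> = t * (t * qf Q w - 2 * s)"
    unfolding z w_def[symmetric] inner_scaleR_right s_def[symmetric]
    by (simp add: qf_def matrix_vector_mult_scaleR algebra_simps)
  finally have "0 \<le> t * (t * qf Q w - 2 * s)" using psd[of "z - t *\<^sub>R w"] by simp
  then have "2 * s \<le> t * qf Q w" using t by (simp add: zero_le_mult_iff)
  also have "\<dots> = s * (qf Q w / (qf Q w + 1))" by (simp add: t_def)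
  also have "\<dots> \<le> s * 1" using s w1 by (intro mult_left_mono) auto
  finally show False using s by simp
qed

text \<open>A non-integral multiple of 1/N is at distance at least 1/N from the integers, so a step
  of this length cannot pass one.\<close>

lemma grid_step:
  fixes t s :: real
  assumes N: "N > 0" and Nt: "of_nat N * t \<in> \<int>" and t: "t \<notin> \<int>" and s: "\<bar>s\<bar> \<le> 1"
  shows "of_int \<lfloor>t\<rfloor> \<le> t + s / N \<and> t + s / N \<le> of_int \<lceil>t\<rceil>"
proof -
  obtain m where m: "of_nat N * t = of_int m" using Nt by (auto elim: Ints_cases)
  have NR: "real N > 0" using N by simp
  have st: "of_int \<lfloor>t\<rfloor> < t" "t < of_int \<lceil>t\<rceil>"
    using t by (metis Ints_of_int floor_correct ceiling_correct less_eq_real_def)+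
  have "of_nat N * of_int \<lfloor>t\<rfloor> < of_nat N * t" "of_nat N * t < of_nat N * (of_int \<lceil>t\<rceil> :: real)"
    using st NR by simp_all
  then have "real_of_int (int N * \<lfloor>t\<rfloor>) < of_int m" "of_int m < real_of_int (int N * \<lceil>t\<rceil>)"
    unfolding m by simp_all
  then have "int N * \<lfloor>t\<rfloor> + 1 \<le> m" "m + 1 \<le> int N * \<lceil>t\<rceil>" by linarith+
  then have "real_of_int (int N * \<lfloor>t\<rfloor> + 1) \<le> of_int m" "real_of_int (m + 1) \<le> of_int (int N * \<lceil>t\<rceil>)"
    by (simp_all only: of_int_le_iff)
  then have "real N * of_int \<lfloor>t\<rfloor> + 1 \<le> real N * t" "real N * t + 1 \<le> real N * of_int \<lceil>t\<rceil>"
    by (simp_all add: m)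
  then have "real N * of_int \<lfloor>t\<rfloor> \<le> real N * t + s" "real N * t + s \<le> real N * of_int \<lceil>t\<rceil>" using s by auto
  moreover have "real N * (t + s / N) = real N * t + s" using NR by (simp add: field_simps)
  ultimately have "real N * of_int \<lfloor>t\<rfloor> \<le> real N * (t + s / N)" "real N * (t + s / N) \<le> real N * of_int \<lceil>t\<rceil>" by simp_all
  then show ?thesis using NR by (simp only: mult_le_cancel_left_pos)
qed

lemma functional_multiple:
  fixes b c :: "'a::real_inner"
  assumes "b \<noteq> 0" "\<And>d. b \<bullet> d = 0 \<Longrightarrow> c \<bullet> d = 0"
  obtains \<mu> where "c = \<mu> *\<^sub>R b"
proof -
  define \<mu> where "\<mu> = (b \<bullet> c) / (b \<bullet> b)"
  define d where "d = c - \<mu> *\<^sub>R b"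
  have bd: "b \<bullet> d = 0" using assms(1) by (simp add: d_def \<mu>_def inner_diff_right)
  then have "c \<bullet> d = 0" by (rule assms(2))
  then have "d \<bullet> d = 0" using bd by (simp add: d_def inner_diff_left)
  then have "c = \<mu> *\<^sub>R b" by (simp add: d_def)
  then show thesis by (rule that)
qed

text \<open>The setting of the converse direction: Q is known only through its Delaunay sets. By
  \<open>pair\<close> and \<open>nz\<close> the columns are nonzero and pairwise non-proportional,
  so that walls of different columns meet in codimension 2.\<close>

locale dicing_form =
  fixes n :: nat and a :: "nat \<Rightarrow> real^'g::finite" and Q :: "real^'g^'g"
  assumes tu: "totally_unimodular n a"
    and pair: "\<And>i j s t. i < n \<Longrightarrow> j < n \<Longrightarrow> i \<noteq> j \<Longrightarrow> s *\<^sub>R a i + t *\<^sub>R a j = 0 \<Longrightarrow> s = 0 \<and> t = (0::real)"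
    and nz: "\<And>i. i < n \<Longrightarrow> a i \<noteq> 0"
    and sym: "transpose Q = Q" and psd: "\<And>x. 0 \<le> qf Q x"
    and vt: "vor_type Q = dicing n a"
begin

lemma aZ: "i < n \<Longrightarrow> a i \<in> Zlat"
  by (rule tu_Zlat[OF tu])

definition kerA :: "(real^'g) set" where
  "kerA = {z. \<forall>i<n. a i \<bullet> z = 0}"

text \<open>For a lattice vector z of the kernel, the points 0, z and -z lie in one face, hence at
  equal distance from its centre. Adding the two equations cancels the linear term and leaves
  \<open>qf Q z = 0\<close>. Lattice vectors span the kernel.\<close>

lemma Q_kerA:
  assumes "z \<in> kerA" shows "Q *v z = 0"
proof -
  have "Q *v z = 0" if zZ: "z \<in> Zlat" and zK: "z \<in> kerA" for z
  proof -
    let ?F = "dface n a (\<lambda>_. 0) (\<lambda>_. 0)"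
    have F: "0 \<in> ?F" "z \<in> ?F" "- z \<in> ?F"
      using zZ zK by (auto simp: dface_def kerA_def Zlat_0 Zlat_minus)
    have "?F \<in> dicing n a" unfolding dicing_def mem_Collect_eq
      using F by (intro exI[of _ "\<lambda>_. 0"] conjI) (auto simp: unit_box_def)
    then have "?F \<in> range (nearest Q)" using vt unfolding vor_type_nearest by simp
    then obtain x where x: "nearest Q x = ?F" by (metis imageE)
    have eq: "qf Q (x - u) = qf Q (x - v)" if "u \<in> ?F" "v \<in> ?F" for u v
      using that unfolding x[symmetric] nearest_def by (auto intro: antisym)
    have "qf Q (x - z) = qf Q (x - 0)" "qf Q (x - (- z)) = qf Q (x - 0)"
      using eq F by blast+
    then have "qf Q z = 0"
      unfolding qf_diff[OF sym] by (simp add: qf_minus qf_def[of Q 0])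
    then show ?thesis by (rule psd_null[OF sym psd])
  qed
  then have "kerA \<inter> Zlat \<subseteq> {z. Q *v z = 0}" by blast
  moreover have "subspace {z. Q *v z = 0}"
    by (auto simp: subspace_def matrix_vector_right_distrib matrix_vector_mult_scaleR)
  ultimately have "span (kerA \<inter> Zlat) \<subseteq> {z. Q *v z = 0}" by (rule span_minimal)
  then show ?thesis using tu_kernel_span[OF tu] assms unfolding kerA_def by blast
qed

text \<open>Vanishing on \<open>kerA\<close> is the condition under which a linear functional can be
  controlled when a point is rounded to a lattice point.\<close>

definition minorant :: "real^'g \<Rightarrow> real \<Rightarrow> bool" where
  "minorant g h \<longleftrightarrow> (\<forall>v\<in>Zlat. g \<bullet> v + h \<le> qf Q v) \<and> (\<forall>z\<in>kerA. g \<bullet> z = 0)"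

definition touches :: "(real^'g) set \<Rightarrow> real^'g \<Rightarrow> real \<Rightarrow> bool" where
  "touches F g h \<longleftrightarrow> minorant g h \<and> (\<forall>v\<in>Zlat. g \<bullet> v + h = qf Q v \<longleftrightarrow> v \<in> F)"

text \<open>The squared distance \<open>qf Q (x - v)\<close> differs from \<open>qf Q v\<close> by
  an affine function of v. Subtracting the distance from the form, normalised to vanish on the
  nearest points, leaves the required support function.\<close>

lemma touches_exists:
  assumes "F \<in> dicing n a"
  shows "\<exists>g h. touches F g h"
proof -
  have "F \<in> range (nearest Q)" using assms vt unfolding vor_type_nearest by simp
  then obtain x where x: "nearest Q x = F" by (metis imageE)
  obtain f where f: "f \<in> F" using assms by (auto simp: dicing_def)
  define g where "g = 2 *\<^sub>R (Q *v x)"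
  define h where "h = qf Q (x - f) - qf Q x"
  have e: "qf Q v - (g \<bullet> v + h) = qf Q (x - v) - qf Q (x - f)" for v
    unfolding h_def g_def using qf_diff[OF sym, of x v] by simp
  have fx: "f \<in> Zlat" "\<And>w. w \<in> Zlat \<Longrightarrow> qf Q (x - f) \<le> qf Q (x - w)"
    using f unfolding x[symmetric] nearest_def by auto
  have "g \<bullet> v + h \<le> qf Q v" if "v \<in> Zlat" for v using e[of v] fx(2)[OF that] by linarith
  moreover have "g \<bullet> v + h = qf Q v \<longleftrightarrow> v \<in> F" if v: "v \<in> Zlat" for v
  proof
    assume "g \<bullet> v + h = qf Q v"
    then have "qf Q (x - v) = qf Q (x - f)" using e[of v] by linarith
    then show "v \<in> F" using v fx(2) unfolding x[symmetric] nearest_def by simp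
  next
    assume "v \<in> F"
    then have "qf Q (x - v) \<le> qf Q (x - f)" using fx(1) unfolding x[symmetric] nearest_def by blast
    then show "g \<bullet> v + h = qf Q v" using e[of v] fx(2)[OF v] by linarith
  qed
  moreover have "g \<bullet> z = 0" if "z \<in> kerA" for z
  proof -
    have "(Q *v x) \<bullet> z = x \<bullet> (Q *v z)" by (metis sym dot_lmul_matrix transpose_matrix_vector)
    then show ?thesis using Q_kerA[OF that] by (simp add: g_def)
  qed
  ultimately show ?thesis unfolding touches_def minorant_def by blast
qed

text \<open>The support function of a lower-dimensional face is not unique. Any choice serves, since
  its values on the box of the face are determined by the form at the vertices.\<close>

definition "slope F = (SOME g. \<exists>h. touches F g h)"
definition "offset F = (SOME h. touches F (slope F) h)"

lemma touches: "F \<in> dicing n a \<Longrightarrow> touches F (slope F) (offset F)"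
  using touches_exists unfolding slope_def offset_def by (metis (mono_tags, lifting) someI_ex)

text \<open>The vertices of the smallest face around x: the two bounds coincide for the forms that
  are integral at x.\<close>

definition hull_face :: "real^'g \<Rightarrow> (real^'g) set" where
  "hull_face x = dface n a (\<lambda>i. \<lfloor>a i \<bullet> x\<rfloor>) (\<lambda>i. \<lceil>a i \<bullet> x\<rceil>)"

lemma rounding:
  assumes "\<And>z. z \<in> kerA \<Longrightarrow> c \<bullet> z = 0"
  obtains v where "v \<in> hull_face x" "c \<bullet> v \<le> c \<bullet> x"
  using tu_rounding[OF tu, of c x] assms unfolding hull_face_def dface_def kerA_def by blast

lemma hull_face_subset:
  assumes "\<And>i. i < n \<Longrightarrow> of_int (lo i) \<le> a i \<bullet> x \<and> a i \<bullet> x \<le> of_int (hi i)"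
  shows "hull_face x \<subseteq> dface n a lo hi"
proof
  fix v assume v: "v \<in> hull_face x"
  have "of_int (lo i) \<le> a i \<bullet> v \<and> a i \<bullet> v \<le> of_int (hi i)" if i: "i < n" for i
  proof -
    have "lo i \<le> \<lfloor>a i \<bullet> x\<rfloor>" "\<lceil>a i \<bullet> x\<rceil> \<le> hi i"
      using assms[OF i] by (auto simp: le_floor_iff ceiling_le_iff)
    then show ?thesis using v i unfolding hull_face_def dface_def by force
  qed
  then show "v \<in> dface n a lo hi" using v by (simp add: hull_face_def dface_def)
qed

lemma hull_face_nonempty: "hull_face x \<noteq> {}"
  using rounding[of 0 x] by auto

lemma hull_face_dicing: "hull_face x \<in> dicing n a"
proof -
  have "unit_box n (\<lambda>i. \<lfloor>a i \<bullet> x\<rfloor>) (\<lambda>i. \<lceil>a i \<bullet> x\<rceil>)"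
    unfolding unit_box_def by (auto intro: floor_le_ceiling ceiling_diff_floor_le_1) (smt (verit) ceiling_diff_floor_le_1)
  then show ?thesis using hull_face_nonempty[of x] unfolding dicing_def hull_face_def by blast
qed

text \<open>The piecewise affine interpolation of the form on the dicing.\<close>
definition pl :: "real^'g \<Rightarrow> real" where
  "pl x = slope (hull_face x) \<bullet> x + offset (hull_face x)"

text \<open>The gap between the support function at x and the minorant is affine. Rounding x to a
  vertex of its face where the gap is not larger reduces the claim to a lattice point. So
  \<open>pl\<close> is the upper envelope of the minorants, which is the source of its
  convexity.\<close>

lemma pl_ge:
  assumes "minorant g h" shows "g \<bullet> x + h \<le> pl x"
proof -
  let ?F = "hull_face x"
  have t: "touches ?F (slope ?F) (offset ?F)" by (rule touches[OF hull_face_dicing])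
  have "(slope ?F - g) \<bullet> z = 0" if "z \<in> kerA" for z
    using t assms that by (simp add: touches_def minorant_def inner_diff_left)
  then obtain v where v: "v \<in> ?F" "(slope ?F - g) \<bullet> v \<le> (slope ?F - g) \<bullet> x" using rounding by blast
  have vZ: "v \<in> Zlat" using v(1) by (simp add: hull_face_def dface_def)
  have "slope ?F \<bullet> v + offset ?F = qf Q v" using t v(1) vZ unfolding touches_def by blast
  moreover have "g \<bullet> v + h \<le> qf Q v" using assms vZ unfolding minorant_def by blast
  ultimately have "g \<bullet> v + h \<le> slope ?F \<bullet> v + offset ?F" by simp
  then show ?thesis using v(2) by (simp add: pl_def inner_diff_left)
qed

lemma slope_minorant: "F \<in> dicing n a \<Longrightarrow> minorant (slope F) (offset F)"
  using touches by (simp add: touches_def)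

text \<open>Allows \<open>pl\<close> to be evaluated on a larger face than the smallest one around
  x, in particular from both sides of a wall.\<close>

lemma pl_face:
  assumes bx: "unit_box n lo hi" and x: "\<And>i. i < n \<Longrightarrow> of_int (lo i) \<le> a i \<bullet> x \<and> a i \<bullet> x \<le> of_int (hi i)"
  shows "dface n a lo hi \<in> dicing n a" "pl x = slope (dface n a lo hi) \<bullet> x + offset (dface n a lo hi)"
proof -
  let ?F = "dface n a lo hi" and ?H = "hull_face x"
  have sub: "?H \<subseteq> ?F" by (rule hull_face_subset[OF x])
  show F: "?F \<in> dicing n a" using sub hull_face_nonempty bx unfolding dicing_def by blast
  have tF: "touches ?F (slope ?F) (offset ?F)" by (rule touches[OF F])
  have tH: "touches ?H (slope ?H) (offset ?H)" by (rule touches[OF hull_face_dicing])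
  have "(slope ?F - slope ?H) \<bullet> z = 0" if "z \<in> kerA" for z
    using tF tH that by (simp add: touches_def minorant_def inner_diff_left)
  then obtain v where v: "v \<in> ?H" "(slope ?F - slope ?H) \<bullet> v \<le> (slope ?F - slope ?H) \<bullet> x" using rounding by blast
  have vZ: "v \<in> Zlat" using v(1) by (simp add: hull_face_def dface_def)
  have "slope ?F \<bullet> v + offset ?F = qf Q v" using tF v(1) sub vZ unfolding touches_def by blast
  moreover have "slope ?H \<bullet> v + offset ?H = qf Q v" using tH v(1) vZ unfolding touches_def by blast
  ultimately have "pl x \<le> slope ?F \<bullet> x + offset ?F"
    using v(2) by (simp add: pl_def inner_diff_left)
  then show "pl x = slope ?F \<bullet> x + offset ?F" using pl_ge[OF slope_minorant[OF F], of x] by linarith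
qed

text \<open>Translating a minorant by v and adding the affine function
  \<open>qf Q u - qf Q (u - v)\<close> of u gives a minorant again. Equality follows by using -v as
  well.\<close>

lemma pl_shift_ge:
  assumes v: "v \<in> Zlat"
  shows "pl x + 2 * ((Q *v v) \<bullet> x) + qf Q v \<le> pl (x + v)"
proof -
  let ?F = "hull_face x"
  let ?g = "slope ?F" and ?h = "offset ?F"
  have m: "minorant ?g ?h" by (rule slope_minorant[OF hull_face_dicing])
  have "minorant (?g + 2 *\<^sub>R (Q *v v)) (?h - ?g \<bullet> v - qf Q v)"
    unfolding minorant_def
  proof (intro conjI ballI)
    fix u :: "real^'g" assume u: "u \<in> Zlat"
    have "?g \<bullet> (u - v) + ?h \<le> qf Q (u - v)" using m Zlat_diff[OF u v] unfolding minorant_def by blast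
    moreover have "qf Q (u - v) = qf Q v - 2 * ((Q *v v) \<bullet> u) + qf Q u"
      unfolding qf_minus_commute[of Q u v] by (rule qf_diff[OF sym])
    ultimately show "(?g + 2 *\<^sub>R (Q *v v)) \<bullet> u + (?h - ?g \<bullet> v - qf Q v) \<le> qf Q u"
      by (simp add: inner_add_left inner_diff_right)
  next
    fix z assume z: "z \<in> kerA"
    have "(Q *v v) \<bullet> z = v \<bullet> (Q *v z)" by (metis sym dot_lmul_matrix transpose_matrix_vector)
    then show "(?g + 2 *\<^sub>R (Q *v v)) \<bullet> z = 0"
      using m z Q_kerA[OF z] by (simp add: minorant_def inner_add_left)
  qed
  then have "(?g + 2 *\<^sub>R (Q *v v)) \<bullet> (x + v) + (?h - ?g \<bullet> v - qf Q v) \<le> pl (x + v)" by (rule pl_ge)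
  then show ?thesis
    by (simp add: pl_def inner_add_left inner_add_right qf_def inner_commute)
qed

lemma pl_periodic:
  assumes v: "v \<in> Zlat"
  shows "pl (x + v) - qf Q (x + v) = pl x - qf Q x"
proof -
  have q: "qf Q (x + v) = qf Q x + 2 * ((Q *v v) \<bullet> x) + qf Q v"
    using qf_diff[OF sym, of v "- x"] by (simp add: qf_minus add.commute)
  have "(Q *v (- v)) = - (Q *v v)" by (metis matrix_vector_mult_scaleR scaleR_minus1_left)
  then have "pl (x + v) - 2 * ((Q *v v) \<bullet> (x + v)) + qf Q v \<le> pl x"
    using pl_shift_ge[OF Zlat_minus[OF v], of "x + v"] by (simp add: qf_minus)
  moreover have "(Q *v v) \<bullet> (x + v) = (Q *v v) \<bullet> x + qf Q v" by (simp add: inner_add_right qf_def inner_commute)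
  ultimately show ?thesis using pl_shift_ge[OF v, of x] q by linarith
qed

definition sdiff :: "real^'g \<Rightarrow> real^'g \<Rightarrow> real" where
  "sdiff w x = pl (x + w) + pl (x - w) - 2 * pl x"

lemma sdiff_nonneg: "0 \<le> sdiff w x"
proof -
  note m = slope_minorant[OF hull_face_dicing[of x]]
  show ?thesis using pl_ge[OF m, of "x + w"] pl_ge[OF m, of "x - w"]
    by (simp add: sdiff_def pl_def[of x] inner_add_right inner_diff_right)
qed

lemma sdiff_le: "sdiff w x \<le> (slope (hull_face (x + w)) - slope (hull_face (x - w))) \<bullet> w"
  using pl_ge[OF slope_minorant[OF hull_face_dicing[of "x + w"]], of x]
    pl_ge[OF slope_minorant[OF hull_face_dicing[of "x - w"]], of x]
  by (simp add: sdiff_def pl_def[of "x + w"] pl_def[of "x - w"] inner_add_right inner_diff_right inner_diff_left)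

text \<open>The test vectors: a step \<open>(1 / N) *\<^sub>R p\<close> changes each form by at most
  1/N, so from a point of the grid it never jumps over a wall.\<close>

definition short :: "real^'g \<Rightarrow> bool" where
  "short p \<longleftrightarrow> p \<in> Zlat \<and> (\<forall>i<n. \<bar>a i \<bullet> p\<bar> \<le> 1)"

text \<open>The three points of the second difference stay in the box of \<open>hull_face x\<close>,
  where the interpolation is affine.\<close>

lemma sdiff_generic:
  assumes N: "N > 0" and x: "\<And>i. i < n \<Longrightarrow> of_nat N * (a i \<bullet> x) \<in> \<int>" and p: "short p"
    and gen: "\<And>i. i < n \<Longrightarrow> a i \<bullet> p \<noteq> 0 \<Longrightarrow> a i \<bullet> x \<notin> \<int>"
  shows "sdiff ((1 / N) *\<^sub>R p) x = 0"
proof -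
  let ?lo = "\<lambda>i. \<lfloor>a i \<bullet> x\<rfloor>" and ?hi = "\<lambda>i. \<lceil>a i \<bullet> x\<rceil>"
  have bx: "unit_box n ?lo ?hi"
    unfolding unit_box_def by (auto intro: floor_le_ceiling) (smt (verit) ceiling_diff_floor_le_1)
  have s: "of_int (?lo i) \<le> a i \<bullet> (x + (\<sigma> / N) *\<^sub>R p) \<and> a i \<bullet> (x + (\<sigma> / N) *\<^sub>R p) \<le> of_int (?hi i)"
    if i: "i < n" and \<sigma>: "\<bar>\<sigma>\<bar> \<le> 1" for i \<sigma>
  proof (cases "a i \<bullet> p = 0")
    case True then show ?thesis by (simp add: inner_add_right)
  next
    case False
    have "\<bar>a i \<bullet> p\<bar> \<le> 1" using p i by (simp add: short_def)
    then have "\<bar>\<sigma> * (a i \<bullet> p)\<bar> \<le> 1" using \<sigma> by (simp add: abs_mult mult_le_one)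
    then show ?thesis using grid_step[OF N x[OF i] gen[OF i False], of "\<sigma> * (a i \<bullet> p)"]
      by (simp add: inner_add_right)
  qed
  have e: "pl (x + (\<sigma> / N) *\<^sub>R p) = slope (hull_face x) \<bullet> (x + (\<sigma> / N) *\<^sub>R p) + offset (hull_face x)"
    if "\<bar>\<sigma>\<bar> \<le> 1" for \<sigma>
    using pl_face(2)[OF bx s[OF _ that]] by (simp add: hull_face_def)
  show ?thesis
    using e[of 1] e[of "-1"] by (simp add: sdiff_def pl_def[of x] inner_add_right inner_diff_right)
qed

text \<open>At a grid point lying on exactly one hyperplane the second difference only sees the jump of
  the gradient across that hyperplane.\<close>
lemma sdiff_wall:
  assumes N: "N > 0" and x: "\<And>i. i < n \<Longrightarrow> of_nat N * (a i \<bullet> x) \<in> \<int>"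
    and i: "i < n" "a i \<bullet> x \<in> \<int>" and gen: "\<And>j. j < n \<Longrightarrow> j \<noteq> i \<Longrightarrow> a j \<bullet> x \<notin> \<int>"
  shows "\<exists>\<mu>\<ge>0. \<forall>p. short p \<longrightarrow> sdiff ((1 / N) *\<^sub>R p) x = (a i \<bullet> p)\<^sup>2 * \<mu> / N"
proof -
  obtain k where k: "a i \<bullet> x = of_int k" using i(2) by (auto elim: Ints_cases)
  let ?f = "\<lambda>i. \<lfloor>a i \<bullet> x\<rfloor>" and ?c = "\<lambda>i. \<lceil>a i \<bullet> x\<rceil>"
  \<comment> \<open>The box of x is opened by one unit upwards, respectively downwards, in the i-th
    form, which gives the faces on the two sides of the wall.\<close>
  define F1 where "F1 = dface n a ?f (?c(i := k + 1))"
  define F2 where "F2 = dface n a (?f(i := k - 1)) ?c"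
  have bx: "unit_box n ?f (?c(i := k + 1))" "unit_box n (?f(i := k - 1)) ?c"
    unfolding unit_box_def using k by (auto intro: floor_le_ceiling) (smt (verit) ceiling_diff_floor_le_1)+
  have other: "of_int (?f j) \<le> a j \<bullet> (x + (1 / N) *\<^sub>R d) \<and> a j \<bullet> (x + (1 / N) *\<^sub>R d) \<le> of_int (?c j)"
    if "j < n" "j \<noteq> i" "\<bar>a j \<bullet> d\<bar> \<le> 1" for j d
    using grid_step[OF N x[OF that(1)] gen[OF that(1,2)] that(3)] by (simp add: inner_add_right)
  have up: "pl (x + (1 / N) *\<^sub>R d) = slope F1 \<bullet> (x + (1 / N) *\<^sub>R d) + offset F1"
    if "\<And>j. j < n \<Longrightarrow> \<bar>a j \<bullet> d\<bar> \<le> 1" "0 \<le> a i \<bullet> d" for d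
  proof -
    have "a i \<bullet> d / N \<le> 1" using that(1)[OF i(1)] N by (auto simp: divide_le_eq)
    then have "of_int (?f j) \<le> a j \<bullet> (x + (1 / N) *\<^sub>R d) \<and> a j \<bullet> (x + (1 / N) *\<^sub>R d) \<le> of_int ((?c(i := k + 1)) j)"
      if "j < n" for j
      using other[OF that, of d] \<open>\<And>j. j < n \<Longrightarrow> \<bar>a j \<bullet> d\<bar> \<le> 1\<close>[OF that] k \<open>0 \<le> a i \<bullet> d\<close>
      by (cases "j = i") (auto simp: inner_add_right)
    then show ?thesis unfolding F1_def by (rule pl_face(2)[OF bx(1)])
  qed
  have down: "pl (x + (1 / N) *\<^sub>R d) = slope F2 \<bullet> (x + (1 / N) *\<^sub>R d) + offset F2"
    if "\<And>j. j < n \<Longrightarrow> \<bar>a j \<bullet> d\<bar> \<le> 1" "a i \<bullet> d \<le> 0" for d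
  proof -
    have "- 1 \<le> a i \<bullet> d / N" using that(1)[OF i(1)] N by (auto simp: le_divide_eq)
    moreover have "a i \<bullet> d / N \<le> 0" using that(2) N by (simp add: divide_nonpos_pos)
    ultimately have "of_int ((?f(i := k - 1)) j) \<le> a j \<bullet> (x + (1 / N) *\<^sub>R d) \<and> a j \<bullet> (x + (1 / N) *\<^sub>R d) \<le> of_int (?c j)"
      if "j < n" for j
      using other[OF that, of d] \<open>\<And>j. j < n \<Longrightarrow> \<bar>a j \<bullet> d\<bar> \<le> 1\<close>[OF that] k
      by (cases "j = i") (auto simp: inner_add_right)
    then show ?thesis unfolding F2_def by (rule pl_face(2)[OF bx(2)])
  qed
  have x1: "pl x = slope F1 \<bullet> x + offset F1" and x2: "pl x = slope F2 \<bullet> x + offset F2"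
    using up[of 0] down[of 0] by simp_all
  \<comment> \<open>Along the wall both formulas compute \<open>pl\<close>, so the slopes agree on
    its hyperplane and differ by a multiple of \<open>a i\<close>. The factor \<epsilon> shrinks d
    until every form is at most 1 on it.\<close>
  have "(slope F1 - slope F2) \<bullet> d = 0" if d: "a i \<bullet> d = 0" for d
  proof -
    define \<epsilon> where "\<epsilon> = 1 / (1 + (\<Sum>j<n. \<bar>a j \<bullet> d\<bar>))"
    have pos: "1 + (\<Sum>j<n. \<bar>a j \<bullet> d\<bar>) > 0" by (simp add: add_pos_nonneg sum_nonneg)
    then have eps: "\<epsilon> > 0" by (simp add: \<epsilon>_def)
    have "\<bar>a j \<bullet> (\<epsilon> *\<^sub>R d)\<bar> \<le> 1" if "j < n" for j
    proof -
      have "\<bar>a j \<bullet> d\<bar> \<le> (\<Sum>j<n. \<bar>a j \<bullet> d\<bar>)" using that by (intro member_le_sum) auto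
      then show ?thesis using pos eps by (simp add: \<epsilon>_def abs_mult)
    qed
    then have "slope F1 \<bullet> (x + (1 / N) *\<^sub>R (\<epsilon> *\<^sub>R d)) + offset F1 = slope F2 \<bullet> (x + (1 / N) *\<^sub>R (\<epsilon> *\<^sub>R d)) + offset F2"
      using up[of "\<epsilon> *\<^sub>R d"] down[of "\<epsilon> *\<^sub>R d"] d by simp
    then have "(1 / N) * (\<epsilon> * (slope F1 \<bullet> d)) = (1 / N) * (\<epsilon> * (slope F2 \<bullet> d))"
      unfolding inner_add_right inner_scaleR_right using x1 x2 by linarith
    then have "\<epsilon> / N * ((slope F1 - slope F2) \<bullet> d) = 0"
      by (simp add: inner_diff_left right_diff_distrib)
    then show ?thesis using eps N by simp
  qed
  then obtain \<mu> where mu: "slope F1 - slope F2 = \<mu> *\<^sub>R a i"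
    using functional_multiple[OF nz[OF i(1)], of "slope F1 - slope F2"] by blast
  have sd: "sdiff ((1 / N) *\<^sub>R p) x = (a i \<bullet> p)\<^sup>2 * \<mu> / N" if p: "short p" for p
  proof -
    have b: "\<bar>a j \<bullet> p\<bar> \<le> 1" "\<bar>a j \<bullet> (- p)\<bar> \<le> 1" if "j < n" for j using p that by (auto simp: short_def)
    have mp: "slope F1 \<bullet> p - slope F2 \<bullet> p = \<mu> * (a i \<bullet> p)"
      using mu by (metis inner_diff_left inner_scaleR_left)
    have pZ: "p \<in> Zlat" using p by (simp add: short_def)
    obtain q where q: "a i \<bullet> p = of_int q" by (rule Ints_cases[OF inner_Zlat[OF aZ[OF i(1)] pZ]])
    \<comment> \<open>The jump contributes the absolute value of \<open>a i \<bullet> p\<close>,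
      which for a short lattice vector equals its square. This makes the second difference quadratic
      in p.\<close>
    have "\<bar>q\<bar> \<le> 1" using b(1)[OF i(1)] q by simp
    then consider "a i \<bullet> p = 0" | "a i \<bullet> p = 1" | "a i \<bullet> p = -1"
      unfolding q by (cases "q = 0"; cases "q = 1"; cases "q = -1"; auto)
    then have sq: "0 \<le> a i \<bullet> p \<and> (a i \<bullet> p)\<^sup>2 = a i \<bullet> p \<or> a i \<bullet> p \<le> 0 \<and> (a i \<bullet> p)\<^sup>2 = - (a i \<bullet> p)"
      by cases auto
    have neg: "x - (1 / N) *\<^sub>R p = x + (1 / N) *\<^sub>R (- p)" by simp
    show ?thesis
    proof (cases "0 \<le> a i \<bullet> p \<and> (a i \<bullet> p)\<^sup>2 = a i \<bullet> p")
      case True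
      have "sdiff ((1 / N) *\<^sub>R p) x = (slope F1 \<bullet> p - slope F2 \<bullet> p) / N"
        unfolding sdiff_def neg using up[of p, OF b(1)] down[of "- p", OF b(2)] True x1 x2
        by (simp add: inner_add_right inner_diff_right diff_divide_distrib)
      then show ?thesis using True mp by (simp add: mult.commute)
    next
      case False
      then have le: "a i \<bullet> p \<le> 0" "0 \<le> a i \<bullet> (- p)" using sq by auto
      have "sdiff ((1 / N) *\<^sub>R p) x = - (slope F1 \<bullet> p - slope F2 \<bullet> p) / N"
        unfolding sdiff_def neg using up[of "- p", OF b(2) le(2)] down[of p, OF b(1) le(1)] x1 x2
        by (simp add: inner_add_right inner_diff_right diff_divide_distrib)
      moreover have "(a i \<bullet> p)\<^sup>2 = - (a i \<bullet> p)" using False sq by blast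
      ultimately show ?thesis using mp by (simp add: mult.commute)
    qed
  qed
  \<comment> \<open>A unit vector transverse to the wall is short, and convexity along it gives the
    sign of \<mu>.\<close>
  obtain r where r: "a i $ r \<noteq> 0" using nz[OF i(1)] by (metis vec_eq_iff zero_index)
  have "short (axis r 1)" using tu_entry_abs[OF tu] by (simp add: short_def inner_axis)
  then have "0 \<le> (a i \<bullet> axis r 1)\<^sup>2 * \<mu> / N" using sd sdiff_nonneg by metis
  then have "\<mu> \<ge> 0" using r N by (simp add: inner_axis zero_le_divide_iff zero_le_mult_iff)
  then show ?thesis using sd by blast
qed

end

section \<open>Averages over the grid points of the torus\<close>

definition grid :: "nat \<Rightarrow> (real^'g) set" where
  "grid N = {x. \<forall>r. \<exists>k<N. x $ r = real k / real N}"

lemma grid_card: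
  assumes N: "N > 0"
  shows "finite (grid N :: (real^'g::finite) set)" "card (grid N :: (real^'g) set) = N ^ CARD('g)"
proof -
  let ?\<phi> = "\<lambda>m :: 'g \<Rightarrow> nat. (\<chi> r. real (m r) / real N) :: real^'g"
  have eq: "grid N = ?\<phi> ` (UNIV \<rightarrow>\<^sub>E {..<N})"
  proof (intro set_eqI iffI)
    fix x :: "real^'g" assume "x \<in> grid N"
    then obtain m where m: "\<And>r. m r < N \<and> x $ r = real (m r) / real N" unfolding grid_def by (simp, metis)
    then have "x = ?\<phi> m" by (simp add: vec_eq_iff)
    then show "x \<in> ?\<phi> ` (UNIV \<rightarrow>\<^sub>E {..<N})" using m by (intro image_eqI[of _ _ m]) auto
  qed (force simp: grid_def)
  have inj: "inj_on ?\<phi> (UNIV \<rightarrow>\<^sub>E {..<N})"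
    using N by (auto simp: inj_on_def vec_eq_iff fun_eq_iff)
  show "finite (grid N :: (real^'g) set)" unfolding eq by (intro finite_imageI finite_PiE) auto
  show "card (grid N :: (real^'g) set) = N ^ CARD('g)"
    unfolding eq card_image[OF inj] by (simp add: card_funcsetE)
qed

lemma grid_bounds: "x \<in> grid N \<Longrightarrow> 0 \<le> x $ r \<and> x $ r < 1"
  unfolding grid_def by (smt (verit, best) divide_less_eq_1_pos divide_nonneg_nonneg mem_Collect_eq of_nat_0_le_iff of_nat_less_iff)

lemma grid_multiple:
  assumes "N > 0" "x \<in> grid N" "b \<in> Zlat"
  shows "of_nat N * (b \<bullet> x) \<in> \<int>"
proof -
  have "real N * x $ r \<in> \<int>" for r
  proof -
    obtain k where "x $ r = real k / real N" using assms(2) unfolding grid_def by blast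
    then have "real N * x $ r = of_nat k" using assms(1) by simp
    then show ?thesis by (metis Ints_of_nat)
  qed
  then have "b $ r * (real N * x $ r) \<in> \<int>" for r
    using assms(3) Ints_mult unfolding Zlat_def by blast
  then have "(\<Sum>r\<in>UNIV. b $ r * (real N * x $ r)) \<in> \<int>" by (rule Ints_sum)
  moreover have "of_nat N * (b \<bullet> x) = (\<Sum>r\<in>UNIV. b $ r * (real N * x $ r))"
    by (simp add: inner_vec_def sum_distrib_left mult_ac)
  ultimately show ?thesis by simp
qed

text \<open>Translation by \<open>(1 / N) *\<^sub>R p\<close> followed by taking fractional parts is
  injective on the finite grid, hence a permutation of it; the discarded integral parts are periods
  of \<theta>.\<close>

lemma grid_sum_shift:
  fixes \<theta> :: "real^'g::finite \<Rightarrow> real"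
  assumes N: "N > 0" and p: "p \<in> Zlat" and per: "\<And>x v. v \<in> Zlat \<Longrightarrow> \<theta> (x + v) = \<theta> x"
  shows "(\<Sum>x\<in>grid N. \<theta> (x + (1 / N) *\<^sub>R p)) = (\<Sum>x\<in>grid N. \<theta> x)"
proof -
  define s where "s x = (\<chi> r. frac (x $ r + p $ r / N))" for x :: "real^'g"
  have fin: "finite (grid N :: (real^'g) set)" by (rule grid_card[OF N])
  have sg: "s ` grid N \<subseteq> grid N"
  proof clarify
    fix x :: "real^'g" assume x: "x \<in> grid N"
    have "\<exists>k<N. frac (x $ r + p $ r / N) = real k / real N" for r
    proof -
      obtain k where k: "x $ r = real k / real N" using x unfolding grid_def by blast
      obtain m where m: "p $ r = of_int m" using p unfolding Zlat_def by (auto elim: Ints_cases)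
      define j where "j = int k + m"
      have "x $ r + p $ r / N = of_int j / real N" by (simp add: k m j_def add_divide_distrib)
      also have "\<dots> = of_int (j div int N) + of_int (j mod int N) / real N"
      proof -
        have "of_int j = real N * of_int (j div int N) + of_int (j mod int N)"
          by (metis div_mult_mod_eq mult.commute of_int_add of_int_mult of_int_of_nat_eq)
        then show ?thesis using N by (simp add: field_simps)
      qed
      finally have e: "x $ r + p $ r / N = of_int (j div int N) + of_int (j mod int N) / real N" .
      define k' where "k' = nat (j mod int N)"
      have k': "int k' = j mod int N" "k' < N" using N by (auto simp: k'_def nat_less_iff)
      have "frac (x $ r + p $ r / N) = real k' / real N"
      proof -
        have "real_of_int (j mod int N) = real k'" by (metis k'(1) of_int_of_nat_eq)
        then show ?thesis unfolding frac_unique_iff e using k'(2) N by simp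
      qed
      then show ?thesis using k'(2) by blast
    qed
    then show "s x \<in> grid N" by (simp add: grid_def s_def)
  qed
  have inj: "inj_on s (grid N)"
  proof (rule inj_onI)
    fix x y assume x: "x \<in> grid N" and y: "y \<in> grid N" and e: "s x = s y"
    have "x $ r = y $ r" for r
    proof -
      have "frac (x $ r + p $ r / N) = frac (y $ r + p $ r / N)"
        using e by (simp add: s_def vec_eq_iff)
      then have "x $ r - y $ r = of_int (\<lfloor>x $ r + p $ r / N\<rfloor> - \<lfloor>y $ r + p $ r / N\<rfloor>)"
        by (simp add: frac_def)
      then obtain m where "x $ r - y $ r = of_int m" by blast
      moreover have "\<bar>x $ r - y $ r\<bar> < 1" using grid_bounds[OF x, of r] grid_bounds[OF y, of r] by linarith
      ultimately have "\<bar>real_of_int m\<bar> < 1" by simp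
      then have "m = 0" by linarith
      then show ?thesis using \<open>x $ r - y $ r = of_int m\<close> by simp
    qed
    then show "x = y" by (simp add: vec_eq_iff)
  qed
  have "s ` grid N = grid N" by (rule endo_inj_surj[OF fin sg inj])
  then have "(\<Sum>x\<in>grid N. \<theta> x) = (\<Sum>x\<in>grid N. \<theta> (s x))" using sum.reindex[OF inj, of \<theta>] by simp
  also have "\<dots> = (\<Sum>x\<in>grid N. \<theta> (x + (1 / N) *\<^sub>R p))"
  proof (rule sum.cong)
    fix x :: "real^'g"
    define v :: "real^'g" where "v = (\<chi> r. of_int \<lfloor>x $ r + p $ r / N\<rfloor>)"
    have "x + (1 / N) *\<^sub>R p = s x + v" by (simp add: vec_eq_iff s_def v_def frac_def)
    moreover have "v \<in> Zlat" by (simp add: v_def Zlat_def)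
    ultimately show "\<theta> (s x) = \<theta> (x + (1 / N) *\<^sub>R p)" using per by simp
  qed simp
  finally show ?thesis by simp
qed

lemma qf_sum_diff:
  fixes Q :: "real^'g^'g::finite"
  assumes sym: "transpose Q = Q"
  shows "qf Q (x + w) + qf Q (x - w) - 2 * qf Q x = 2 * qf Q w"
  using qf_diff[OF sym, of x w] qf_diff[OF sym, of x "- w"] by (simp add: qf_minus)

context dicing_form begin

text \<open>The interpolation is Q plus a periodic function. The periodic part cancels by invariance
  of the grid sum, and the second difference of Q is constant in x.\<close>

lemma sum_sdiff:
  assumes N: "N > 0" and p: "p \<in> Zlat"
  shows "(\<Sum>x\<in>grid N. sdiff ((1 / N) *\<^sub>R p) x) = real (N ^ CARD('g)) * (2 * qf Q p / (real N)\<^sup>2)"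
proof -
  let ?w = "(1 / real N) *\<^sub>R p"
  define \<theta> where "\<theta> x = pl x - qf Q x" for x
  have per: "\<theta> (x + v) = \<theta> x" if "v \<in> Zlat" for x v using pl_periodic[OF that] by (simp add: \<theta>_def)
  have s1: "(\<Sum>x\<in>grid N. \<theta> (x + ?w)) = (\<Sum>x\<in>grid N. \<theta> x)" by (rule grid_sum_shift[OF N p per])
  have s2: "(\<Sum>x\<in>grid N. \<theta> (x - ?w)) = (\<Sum>x\<in>grid N. \<theta> x)"
    using grid_sum_shift[OF N Zlat_minus[OF p] per] by simp
  have "sdiff ?w x = (\<theta> (x + ?w) + \<theta> (x - ?w) - 2 * \<theta> x) + 2 * qf Q ?w" for x
    using qf_sum_diff[OF sym, of x ?w] by (simp add: sdiff_def \<theta>_def)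
  then have "(\<Sum>x\<in>grid N. sdiff ?w x) = (\<Sum>x\<in>grid N. \<theta> (x + ?w)) + (\<Sum>x\<in>grid N. \<theta> (x - ?w))
      - 2 * (\<Sum>x\<in>grid N. \<theta> x) + (\<Sum>x\<in>(grid N :: (real^'g) set). 2 * qf Q ?w)"
    by (simp add: sum.distrib sum_subtractf sum_distrib_left)
  also have "\<dots> = real (N ^ CARD('g)) * (2 * qf Q ?w)" unfolding s1 s2 by (simp add: grid_card[OF N])
  also have "qf Q ?w = qf Q p / (real N)\<^sup>2"
    by (simp add: qf_def matrix_vector_mult_scaleR power2_eq_square)
  finally show ?thesis by simp
qed

lemma abs_form_grid:
  assumes i: "i < n" and x: "x \<in> grid N"
  shows "\<bar>a i \<bullet> x\<bar> \<le> CARD('g)"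
proof -
  have "\<bar>a i \<bullet> x\<bar> \<le> (\<Sum>r\<in>UNIV. \<bar>a i $ r * x $ r\<bar>)" unfolding inner_vec_def by (simp add: sum_abs)
  also have "\<dots> \<le> (\<Sum>r\<in>(UNIV::'g set). 1)"
  proof (rule sum_mono)
    fix r
    have "\<bar>a i $ r\<bar> \<le> 1" by (rule tu_entry_abs[OF tu i])
    moreover have "\<bar>x $ r\<bar> \<le> 1" using grid_bounds[OF x, of r] by linarith
    ultimately show "\<bar>a i $ r * x $ r\<bar> \<le> 1" by (simp add: abs_mult mult_le_one)
  qed
  finally show ?thesis by simp
qed

text \<open>Grid points and their neighbours meet only finitely many faces, the same ones for all N,
  so the slopes are bounded and the second difference is at most linear in the step.\<close>

lemma sdiff_bound:
  "\<exists>C\<ge>0. \<forall>N>0. \<forall>x\<in>grid N. \<forall>p. short p \<and> norm p \<le> 2 \<longrightarrow> sdiff ((1 / real N) *\<^sub>R p) x \<le> C / N"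
proof -
  \<comment> \<open>On the unit cube a form with entries in {-1, 0, 1} is at most g in absolute
    value, and the step adds at most 1.\<close>
  define K where "K = int CARD('g) + 1"
  define P where "P = (\<Pi>\<^sub>E i\<in>{..<n}. {- K .. K})"
  define \<F> where "\<F> = (\<lambda>(lo, hi). dface n a lo hi) ` (P \<times> P)"
  have finP: "finite P" unfolding P_def by (intro finite_PiE) auto
  then have finF: "finite \<F>" by (simp add: \<F>_def)
  define \<Gamma> where "\<Gamma> = (\<Sum>F\<in>\<F>. norm (slope F))"
  have G0: "\<Gamma> \<ge> 0" by (simp add: \<Gamma>_def sum_nonneg)
  have G: "norm (slope F) \<le> \<Gamma>" if "F \<in> \<F>" for F
    unfolding \<Gamma>_def using that finF by (intro member_le_sum) auto
  have hF: "hull_face y \<in> \<F>" if y: "\<And>i. i < n \<Longrightarrow> \<bar>a i \<bullet> y\<bar> \<le> CARD('g) + 1" for y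
  proof -
    let ?lo = "\<lambda>i\<in>{..<n}. \<lfloor>a i \<bullet> y\<rfloor>" and ?hi = "\<lambda>i\<in>{..<n}. \<lceil>a i \<bullet> y\<rceil>"
    have "- K \<le> \<lfloor>a i \<bullet> y\<rfloor> \<and> \<lfloor>a i \<bullet> y\<rfloor> \<le> K \<and> - K \<le> \<lceil>a i \<bullet> y\<rceil> \<and> \<lceil>a i \<bullet> y\<rceil> \<le> K" if "i < n" for i
    proof -
      have b: "of_int (- K) \<le> a i \<bullet> y" "a i \<bullet> y \<le> of_int K" using y[OF that] by (auto simp: K_def abs_le_iff)
      then have "- K \<le> \<lfloor>a i \<bullet> y\<rfloor>" "\<lceil>a i \<bullet> y\<rceil> \<le> K" by (simp_all only: le_floor_iff ceiling_le_iff)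
      then show ?thesis using floor_le_ceiling[of "a i \<bullet> y"] by linarith
    qed
    then have "?lo \<in> P" "?hi \<in> P" by (auto simp: P_def)
    moreover have "hull_face y = dface n a ?lo ?hi" unfolding hull_face_def dface_def by simp
    ultimately show ?thesis unfolding \<F>_def by force
  qed
  have "sdiff ((1 / real N) *\<^sub>R p) x \<le> (4 * \<Gamma>) / N"
    if N: "N > 0" and x: "x \<in> grid N" and p: "short p" "norm p \<le> 2" for N x p
  proof -
    let ?w = "(1 / real N) *\<^sub>R p"
    have aw: "\<bar>a i \<bullet> ?w\<bar> \<le> 1" if "i < n" for i
    proof -
      have "\<bar>a i \<bullet> p\<bar> \<le> real N" using p(1) that N by (auto simp: short_def intro: order_trans[of _ 1])
      then show ?thesis using N by (simp add: abs_mult divide_le_eq)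
    qed
    have "\<bar>a i \<bullet> (x + ?w)\<bar> \<le> CARD('g) + 1 \<and> \<bar>a i \<bullet> (x - ?w)\<bar> \<le> CARD('g) + 1" if i: "i < n" for i
      using aw[OF i] abs_form_grid[OF i x] unfolding inner_add_right inner_diff_right of_nat_add of_nat_1
      by linarith
    then have "hull_face (x + ?w) \<in> \<F>" "hull_face (x - ?w) \<in> \<F>" using hF by blast+
    then have g: "norm (slope (hull_face (x + ?w)) - slope (hull_face (x - ?w))) \<le> 2 * \<Gamma>"
      using G by (smt (verit) norm_triangle_ineq4)
    have nw: "norm ?w \<le> 2 / N" using p(2) N by (simp add: divide_right_mono)
    have "sdiff ?w x \<le> (slope (hull_face (x + ?w)) - slope (hull_face (x - ?w))) \<bullet> ?w" by (rule sdiff_le)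
    also have "\<dots> \<le> norm (slope (hull_face (x + ?w)) - slope (hull_face (x - ?w))) * norm ?w" by (rule norm_cauchy_schwarz)
    also have "\<dots> \<le> (2 * \<Gamma>) * (2 / N)" using g nw G0 by (intro mult_mono) auto
    finally show ?thesis by simp
  qed
  then show ?thesis using G0 by (intro exI[of _ "4 * \<Gamma>"]) auto
qed

text \<open>Two independent columns have a nonzero 2 by 2 minor, in rows r and s. A point is then
  recovered from the two integral values, with \<open>2 * CARD('g) + 1\<close> possibilities each,
  and its coordinates other than r and s.\<close>

lemma card_codim2:
  assumes ij: "i < n" "j < n" "i \<noteq> j" and N: "N > 0"
  shows "card {x \<in> grid N. a i \<bullet> x \<in> \<int> \<and> a j \<bullet> x \<in> \<int>} \<le> (2 * CARD('g) + 1)\<^sup>2 * N ^ (CARD('g) - 2)"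
proof -
  let ?B = "{x \<in> grid N. a i \<bullet> x \<in> \<int> \<and> a j \<bullet> x \<in> \<int>}"
  obtain r where r: "a i $ r \<noteq> 0" using nz[OF ij(1)] by (metis vec_eq_iff zero_index)
  obtain s where s: "a i $ r * a j $ s \<noteq> a i $ s * a j $ r"
  proof (rule ccontr)
    assume "\<not> thesis"
    then have "a i $ r * a j $ s = a i $ s * a j $ r" for s using that by blast
    then have "(- a j $ r) *\<^sub>R a i + (a i $ r) *\<^sub>R a j = 0" by (simp add: vec_eq_iff mult.commute)
    then show False using pair[OF ij] r by blast
  qed
  have rs: "r \<noteq> s" using s by auto
  define Z where "Z = (of_int ` {- int CARD('g) .. int CARD('g)} :: real set)"
  have cZ: "card Z = 2 * CARD('g) + 1" unfolding Z_def by (subst card_image) (auto simp: inj_on_def)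
  define U where "U = UNIV - {r, s}"
  have cU: "card U = CARD('g) - 2" unfolding U_def using rs by (simp add: card_Diff_subset)
  define T where "T = (\<lambda>k. real k / real N) ` {..<N}"
  have cT: "card T = N" unfolding T_def using N by (subst card_image) (auto simp: inj_on_def)
  let ?\<phi> = "\<lambda>x. (a i \<bullet> x, a j \<bullet> x, \<lambda>q\<in>U. x $ q)"
  have fZ: "finite Z" and fT: "finite T" and fU: "finite U" by (auto simp: Z_def T_def)
  have img: "?\<phi> ` ?B \<subseteq> Z \<times> Z \<times> (U \<rightarrow>\<^sub>E T)"
  proof (rule image_subsetI)
    fix x assume "x \<in> ?B"
    then have x: "x \<in> grid N" "a i \<bullet> x \<in> \<int>" "a j \<bullet> x \<in> \<int>" by auto
    have zz: "a m \<bullet> x \<in> Z" if m: "m < n" "a m \<bullet> x \<in> \<int>" for m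
    proof -
      obtain k where k: "a m \<bullet> x = of_int k" using m(2) by (auto elim: Ints_cases)
      have "\<bar>a m \<bullet> x\<bar> \<le> CARD('g)" by (rule abs_form_grid[OF m(1) x(1)])
      then have "\<bar>k\<bar> \<le> int CARD('g)" unfolding k by linarith
      then show ?thesis unfolding k Z_def by (intro imageI) auto
    qed
    have "x $ q \<in> T" for q using x(1) unfolding grid_def T_def by auto
    then show "?\<phi> x \<in> Z \<times> Z \<times> (U \<rightarrow>\<^sub>E T)"
      using zz ij x by auto
  qed
  have inj: "inj_on ?\<phi> ?B"
  proof (rule inj_onI)
    fix x y assume "x \<in> ?B" "y \<in> ?B" and e: "?\<phi> x = ?\<phi> y"
    define d where "d = x - y"
    have dU: "d $ q = 0" if "q \<in> U" for q using e that by (auto simp: d_def fun_eq_iff restrict_def split: if_splits)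
    have exp: "b \<bullet> d = b $ r * d $ r + b $ s * d $ s" for b :: "real^'g"
    proof -
      have "b \<bullet> d = (\<Sum>q\<in>{r, s}. b $ q * d $ q)"
        unfolding inner_vec_def inner_real_def
        by (rule sum.mono_neutral_right) (auto simp: dU U_def)
      then show ?thesis using rs by simp
    qed
    have "a i \<bullet> d = 0" "a j \<bullet> d = 0" using e by (auto simp: d_def inner_diff_right)
    then have E: "a i $ r * d $ r + a i $ s * d $ s = 0" "a j $ r * d $ r + a j $ s * d $ s = 0" unfolding exp .
    have "(a i $ r * a j $ s - a i $ s * a j $ r) * d $ s
        = a i $ r * (a j $ r * d $ r + a j $ s * d $ s) - a j $ r * (a i $ r * d $ r + a i $ s * d $ s)"
      by (simp add: algebra_simps)
    then have ds: "d $ s = 0" using E s by simp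
    then have dr: "d $ r = 0" using E(1) r by simp
    have "d $ q = 0" for q using ds dr dU[of q] by (cases "q \<in> U") (auto simp: U_def)
    then have "d = 0" by (simp add: vec_eq_iff)
    then show "x = y" by (simp add: d_def)
  qed
  have "card ?B \<le> card (Z \<times> Z \<times> (U \<rightarrow>\<^sub>E T))"
    by (rule card_inj_on_le[OF inj img]) (intro finite_cartesian_product fZ finite_PiE fU fT)
  also have "\<dots> = (2 * CARD('g) + 1)\<^sup>2 * N ^ (CARD('g) - 2)"
    by (simp add: card_cartesian_product card_funcsetE[OF fU] cZ cT cU power2_eq_square algebra_simps)
  finally show ?thesis .
qed

text \<open>A grid point on exactly one wall contributes \<open>(a i \<bullet> p)\<^sup>2\<close>
  with a coefficient independent of p, and one on no wall contributes 0. The points on several walls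
  number \<open>O(N ^ (CARD('g) - 2))\<close> and contribute \<open>O(1 / N)\<close> each, so after
  normalisation their total is an error of order 1/N.\<close>

lemma approx_form:
  assumes g2: "CARD('g) \<ge> 2"
  shows "\<exists>C\<ge>0. \<forall>N>0. \<exists>l. (\<forall>i<n. 0 \<le> l i) \<and>
    (\<forall>p. short p \<and> norm p \<le> 2 \<longrightarrow> \<bar>2 * qf Q p - (\<Sum>i<n. (a i \<bullet> p)\<^sup>2 * l i)\<bar> \<le> C / real N)"
proof -
  obtain C where C: "C \<ge> 0" "\<And>N x p. N > 0 \<Longrightarrow> x \<in> grid N \<Longrightarrow> short p \<Longrightarrow> norm p \<le> 2 \<Longrightarrow> sdiff ((1 / real N) *\<^sub>R p) x \<le> C / N"
    using sdiff_bound by blast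
  define D where "D = real n * real n * (2 * real CARD('g) + 1)\<^sup>2"
  have D0: "D \<ge> 0" by (simp add: D_def)
  have "\<exists>l. (\<forall>i<n. 0 \<le> l i) \<and> (\<forall>p. short p \<and> norm p \<le> 2 \<longrightarrow>
      \<bar>2 * qf Q p - (\<Sum>i<n. (a i \<bullet> p)\<^sup>2 * l i)\<bar> \<le> (D * C) / real N)" if N: "N > 0" for N
  proof -
    let ?X = "grid N :: (real^'g) set"
    define bad where "bad = (\<Union>(i, j)\<in>{(i, j). i < n \<and> j < n \<and> i \<noteq> j}. {x \<in> ?X. a i \<bullet> x \<in> \<int> \<and> a j \<bullet> x \<in> \<int>})"
    have finX: "finite ?X" by (rule grid_card[OF N])
    have badX: "bad \<subseteq> ?X" by (auto simp: bad_def)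
    have NX: "of_nat N * (a i \<bullet> x) \<in> \<int>" if "x \<in> ?X" "i < n" for i x
      by (rule grid_multiple[OF N that(1) aZ[OF that(2)]])
    have "\<exists>\<mu>\<ge>0. \<forall>p. short p \<longrightarrow> sdiff ((1 / N) *\<^sub>R p) x = (a i \<bullet> p)\<^sup>2 * \<mu> / N"
      if "x \<in> ?X - bad" "i < n" "a i \<bullet> x \<in> \<int>" for x i
    proof (rule sdiff_wall[OF N NX that(2,3)])
      show "a j \<bullet> x \<notin> \<int>" if "j < n" "j \<noteq> i" for j
        using that \<open>x \<in> ?X - bad\<close> \<open>i < n\<close> \<open>a i \<bullet> x \<in> \<int>\<close> unfolding bad_def by blast
    qed (use that in auto)
    then obtain \<mu> where mu: "\<And>x i. x \<in> ?X - bad \<Longrightarrow> i < n \<Longrightarrow> a i \<bullet> x \<in> \<int> \<Longrightarrow> \<mu> x i \<ge> 0 \<and>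
        (\<forall>p. short p \<longrightarrow> sdiff ((1 / N) *\<^sub>R p) x = (a i \<bullet> p)\<^sup>2 * \<mu> x i / N)" by metis
    define \<nu> where "\<nu> x i = (if a i \<bullet> x \<in> \<int> then \<mu> x i else 0)" for x i
    have nu0: "\<nu> x i \<ge> 0" if "x \<in> ?X - bad" "i < n" for x i using mu[OF that] by (simp add: \<nu>_def)
    have sd: "sdiff ((1 / N) *\<^sub>R p) x = (\<Sum>i<n. (a i \<bullet> p)\<^sup>2 * \<nu> x i / N)" if x: "x \<in> ?X - bad" and p: "short p" for x p
    proof (cases "\<exists>i<n. a i \<bullet> x \<in> \<int>")
      case True
      then obtain i where i: "i < n" "a i \<bullet> x \<in> \<int>" by blast
      have "a j \<bullet> x \<notin> \<int>" if "j < n" "j \<noteq> i" for j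
        using that x i unfolding bad_def by blast
      then have "(\<Sum>j<n. (a j \<bullet> p)\<^sup>2 * \<nu> x j / N) = (\<Sum>j\<in>{i}. (a j \<bullet> p)\<^sup>2 * \<nu> x j / N)"
        using i(1) by (intro sum.mono_neutral_right) (auto simp: \<nu>_def)
      then show ?thesis using mu[OF x i] p i(2) by (simp add: \<nu>_def)
    next
      case False
      then have "sdiff ((1 / N) *\<^sub>R p) x = 0" using x by (intro sdiff_generic[OF N NX p]) auto
      then show ?thesis using False by (simp add: \<nu>_def)
    qed
    \<comment> \<open>Undoes the factor of \<open>sum_sdiff\<close>, the number of grid points
      divided by the square of N.\<close>
    let ?c = "(real N)\<^sup>2 / real (N ^ CARD('g))"
    have Ng: "real (N ^ CARD('g)) > 0" using N by simp
    define S where "S i = (\<Sum>x\<in>?X - bad. \<nu> x i)" for i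
    define l where "l i = ?c * (S i / N)" for i
    have l0: "\<forall>i<n. 0 \<le> l i"
      unfolding l_def S_def using nu0 by (auto intro!: divide_nonneg_nonneg mult_nonneg_nonneg sum_nonneg)
    have cb: "real (card bad) \<le> D * real (N ^ (CARD('g) - 2))"
    proof -
      let ?I = "{(i, j). i < n \<and> j < n \<and> i \<noteq> j}"
      have I: "?I \<subseteq> {..<n} \<times> {..<n}" by auto
      then have finI: "finite ?I" by (rule finite_subset) simp
      have cI: "card ?I \<le> n * n" using card_mono[OF _ I] by simp
      have "card bad \<le> (\<Sum>(i, j)\<in>?I. card {x \<in> ?X. a i \<bullet> x \<in> \<int> \<and> a j \<bullet> x \<in> \<int>})"
        unfolding bad_def using card_UN_le[OF finI, of "\<lambda>(i, j). {x \<in> ?X. a i \<bullet> x \<in> \<int> \<and> a j \<bullet> x \<in> \<int>}"]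
        by (simp add: case_prod_unfold)
      also have "\<dots> \<le> (\<Sum>(i, j)\<in>?I. (2 * CARD('g) + 1)\<^sup>2 * N ^ (CARD('g) - 2))"
        using card_codim2[OF _ _ _ N] by (intro sum_mono) auto
      also have "\<dots> = card ?I * ((2 * CARD('g) + 1)\<^sup>2 * N ^ (CARD('g) - 2))" by simp
      also have "\<dots> \<le> (n * n) * ((2 * CARD('g) + 1)\<^sup>2 * N ^ (CARD('g) - 2))" using cI by (rule mult_le_mono1)
      finally have "real (card bad) \<le> real ((n * n) * ((2 * CARD('g) + 1)\<^sup>2 * N ^ (CARD('g) - 2)))"
        by (simp only: of_nat_le_iff)
      then show ?thesis by (simp add: D_def mult_ac add.commute)
    qed
    have "\<bar>2 * qf Q p - (\<Sum>i<n. (a i \<bullet> p)\<^sup>2 * l i)\<bar> \<le> (D * C) / real N" if p: "short p" "norm p \<le> 2" for p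
    proof -
      let ?s = "\<lambda>x. sdiff ((1 / N) *\<^sub>R p) x"
      have "real (N ^ CARD('g)) * (2 * qf Q p / (real N)\<^sup>2) = (\<Sum>x\<in>?X. ?s x)"
        using sum_sdiff[OF N] p(1) by (simp add: short_def)
      also have "\<dots> = (\<Sum>x\<in>?X - bad. ?s x) + (\<Sum>x\<in>bad. ?s x)"
        by (rule sum.subset_diff[OF badX finX])
      finally have t: "2 * qf Q p = ?c * ((\<Sum>x\<in>?X - bad. ?s x) + (\<Sum>x\<in>bad. ?s x))"
        using N by (simp add: field_simps)
      have "(\<Sum>x\<in>?X - bad. ?s x) = (\<Sum>x\<in>?X - bad. \<Sum>i<n. (a i \<bullet> p)\<^sup>2 * \<nu> x i / N)"
        using sd p(1) by (intro sum.cong) auto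
      also have "\<dots> = (\<Sum>i<n. \<Sum>x\<in>?X - bad. (a i \<bullet> p)\<^sup>2 * \<nu> x i / N)" by (rule sum.swap)
      also have "\<dots> = (\<Sum>i<n. (a i \<bullet> p)\<^sup>2 * (S i / N))"
        by (simp add: S_def sum_distrib_left sum_divide_distrib)
      finally have "?c * (\<Sum>x\<in>?X - bad. ?s x) = ?c * (\<Sum>i<n. (a i \<bullet> p)\<^sup>2 * (S i / N))" by simp
      also have "\<dots> = (\<Sum>i<n. (a i \<bullet> p)\<^sup>2 * l i)"
        unfolding sum_distrib_left l_def by (simp only: mult.left_commute)
      finally have "?c * (\<Sum>x\<in>?X - bad. ?s x) = (\<Sum>i<n. (a i \<bullet> p)\<^sup>2 * l i)" .
      then have e: "2 * qf Q p - (\<Sum>i<n. (a i \<bullet> p)\<^sup>2 * l i) = ?c * (\<Sum>x\<in>bad. ?s x)"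
        using t by (simp add: distrib_left)
      have "(\<Sum>x\<in>bad. ?s x) \<le> (\<Sum>x\<in>bad. C / N)" using C(2)[OF N] p badX by (intro sum_mono) auto
      also have "\<dots> \<le> D * real (N ^ (CARD('g) - 2)) * (C / N)"
        using cb C(1) by (simp only: sum_constant, intro mult_right_mono) auto
      finally have "?c * (\<Sum>x\<in>bad. ?s x) \<le> ?c * (D * real (N ^ (CARD('g) - 2)) * (C / N))"
        by (rule mult_left_mono) simp
      also have "\<dots> = (D * C) / N"
      proof -
        have "CARD('g) = 2 + (CARD('g) - 2)" using g2 by simp
        then have "real (N ^ CARD('g)) = (real N)\<^sup>2 * real (N ^ (CARD('g) - 2))"
          by (metis of_nat_mult of_nat_power power_add)
        then show ?thesis using N by (simp add: field_simps)
      qed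
      finally have "?c * (\<Sum>x\<in>bad. ?s x) \<le> (D * C) / N" .
      moreover have "0 \<le> ?c * (\<Sum>x\<in>bad. ?s x)"
        using sdiff_nonneg by (intro mult_nonneg_nonneg sum_nonneg) auto
      ultimately show ?thesis unfolding e by simp
    qed
    then show ?thesis using l0 by blast
  qed
  then show ?thesis using C(1) D0 by (intro exI[of _ "D * C"]) auto
qed

end

section \<open>The limit form and the positivity of its coefficients\<close>

lemma generic_vector:
  fixes a :: "nat \<Rightarrow> 'a::real_inner"
  assumes "finite J" and S: "subspace S" and "\<And>j. j \<in> J \<Longrightarrow> \<exists>e\<in>S. a j \<bullet> e \<noteq> 0"
  shows "\<exists>d\<in>S. \<forall>j\<in>J. a j \<bullet> d \<noteq> 0"
  using assms(1,3)
proof (induction J rule: finite_induct)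
  case empty
  then show ?case using subspace_0[OF S] by blast
next
  case (insert j J)
  obtain d where d: "d \<in> S" "\<And>k. k \<in> J \<Longrightarrow> a k \<bullet> d \<noteq> 0" using insert by blast
  obtain e where e: "e \<in> S" "a j \<bullet> e \<noteq> 0" using insert.prems by blast
  \<comment> \<open>T contains the finitely many t at which some form not vanishing on e would
    vanish on \<open>d + t *\<^sub>R e\<close>.\<close>
  define T where "T = insert 0 ((\<lambda>k. - (a k \<bullet> d) / (a k \<bullet> e)) ` insert j J)"
  have "finite T" using insert.hyps(1) by (simp add: T_def)
  then obtain t where t: "t \<notin> T" using ex_new_if_finite[OF infinite_UNIV_char_0] by blast
  have "a k \<bullet> (d + t *\<^sub>R e) \<noteq> 0" if k: "k \<in> insert j J" for k
  proof (cases "a k \<bullet> e = 0")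
    case True
    then have "k \<noteq> j" using e(2) by blast
    then have "k \<in> J" using k by blast
    then show ?thesis using d(2) True by (simp add: inner_add_right)
  next
    case False
    have "t \<noteq> - (a k \<bullet> d) / (a k \<bullet> e)" using t k by (auto simp: T_def)
    then show ?thesis using False by (simp add: inner_add_right field_simps add_eq_0_iff2)
  qed
  moreover have "d + t *\<^sub>R e \<in> S" using d(1) e(1) S by (simp add: subspace_add subspace_scale)
  ultimately show ?case by blast
qed

text \<open>With its converse this identifies the nonnegative combinations with a finitely generated
  convex cone. Such a cone is closed, so a limit of forms stays in it and no convergence of the
  coefficients has to be shown.\<close>

lemma oform_cone:
  fixes a :: "nat \<Rightarrow> real^'g::finite"
  assumes l: "\<And>i. i < n \<Longrightarrow> 0 \<le> l i"
  shows "oform n a l \<in> convex_cone hull ((\<lambda>i. (\<chi> r s. a i $ r * a i $ s)) ` {..<n})"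
proof -
  have "oform m a l \<in> convex_cone hull ((\<lambda>i. (\<chi> r s. a i $ r * a i $ s)) ` {..<n})" if "m \<le> n" for m
    using that
  proof (induction m)
    case 0
    then show ?case by (simp add: oform_def convex_cone_hull_contains_0)
  next
    case (Suc m)
    have "(\<chi> r s. a m $ r * a m $ s) \<in> convex_cone hull ((\<lambda>i. (\<chi> r s. a i $ r * a i $ s)) ` {..<n})"
      using Suc.prems by (intro hull_inc) auto
    moreover have "oform (Suc m) a l = oform m a l + l m *\<^sub>R (\<chi> r s. a m $ r * a m $ s)"
      by (simp add: oform_def)
    ultimately show ?case using Suc l by (auto intro!: convex_cone_hull_add convex_cone_hull_mul)
  qed
  then show ?thesis by simp
qed

lemma cone_oform:
  fixes a :: "nat \<Rightarrow> real^'g::finite"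
  assumes "Q \<in> convex_cone hull ((\<lambda>i. (\<chi> r s. a i $ r * a i $ s)) ` {..<n})"
  obtains l where "\<And>i. i < n \<Longrightarrow> 0 \<le> l i" "Q = oform n a l"
proof -
  let ?C = "{oform n a l | l. \<forall>i<n. 0 \<le> l i}"
  have "(\<lambda>i. (\<chi> r s. a i $ r * a i $ s)) ` {..<n} \<subseteq> ?C"
  proof (rule image_subsetI)
    fix i assume i: "i \<in> {..<n}"
    have "oform n a (\<lambda>j. if j = i then 1 else 0) = (\<Sum>j<n. if j = i then (\<chi> r s. a j $ r * a j $ s) else 0)"
      unfolding oform_def by (intro sum.cong) auto
    also have "\<dots> = (\<chi> r s. a i $ r * a i $ s)" using i by simp
    finally show "(\<chi> r s. a i $ r * a i $ s) \<in> ?C"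
      by (intro CollectI exI[of _ "\<lambda>j. if j = i then 1 else 0"]) simp
  qed
  moreover have "convex_cone ?C"
    unfolding convex_cone_def
  proof (intro conjI)
    show "?C \<noteq> {}" by (auto intro!: exI[of _ "\<lambda>_. 0"])
    have lin: "u *\<^sub>R oform n a k + v *\<^sub>R oform n a l = oform n a (\<lambda>i. u * k i + v * l i)" for u v k l
      by (simp add: oform_def scaleR_sum_right sum.distrib scaleR_add_left)
    show "convex ?C"
      unfolding convex_def
    proof clarify
      fix k l :: "nat \<Rightarrow> real" and u v :: real
      assume "\<forall>i<n. 0 \<le> k i" "\<forall>i<n. 0 \<le> l i" "0 \<le> u" "0 \<le> v"
      then show "\<exists>m. u *\<^sub>R oform n a k + v *\<^sub>R oform n a l = oform n a m \<and> (\<forall>i<n. 0 \<le> m i)"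
        unfolding lin by (intro exI[of _ "\<lambda>i. u * k i + v * l i"]) auto
    qed
    show "conic ?C"
      unfolding conic_def
    proof clarify
      fix k :: "nat \<Rightarrow> real" and c :: real
      assume "\<forall>i<n. 0 \<le> k i" "0 \<le> c"
      then show "\<exists>m. c *\<^sub>R oform n a k = oform n a m \<and> (\<forall>i<n. 0 \<le> m i)"
        using lin[of c k 0 k] by (intro exI[of _ "\<lambda>i. c * k i + 0 * k i"]) auto
    qed
  qed
  ultimately have "convex_cone hull ((\<lambda>i. (\<chi> r s. a i $ r * a i $ s)) ` {..<n}) \<subseteq> ?C" by (rule hull_minimal)
  then show thesis using assms that by blast
qed

lemma qf_axis: "qf Q (axis r 1) = Q $ r $ r" for Q :: "real^'g^'g::finite"
  unfolding qf_def matrix_vector_mult_basis column_def by (simp add: inner_axis')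

lemma qf_axis_pair:
  fixes Q :: "real^'g^'g::finite"
  assumes "transpose Q = Q" "\<sigma>\<^sup>2 = 1"
  shows "qf Q (axis r 1 + \<sigma> *\<^sub>R axis s 1) = Q $ r $ r + Q $ s $ s + 2 * \<sigma> * Q $ r $ s"
proof -
  have "Q $ s $ r = Q $ r $ s" using assms(1) by (metis transpose_def vec_lambda_beta)
  moreover have "\<sigma> * \<sigma> = 1" using assms(2) by (simp add: power2_eq_square)
  then have "\<sigma> * (\<sigma> * x) = x" for x by (metis mult.assoc mult_1)
  ultimately show ?thesis
    unfolding qf_def matrix_vector_right_distrib matrix_vector_mult_scaleR matrix_vector_mult_basis column_def
    by (simp add: inner_add_left inner_add_right inner_axis' distrib_left)
qed

text \<open>The minor with rows (1, 1) and (1, -1) is -2, so two rows cannot agree in sign in one column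
  and disagree in another.\<close>
lemma tu_row_signs:
  fixes a :: "nat \<Rightarrow> real^'g::finite"
  assumes tu: "totally_unimodular n a" and rs: "r \<noteq> s"
  obtains \<sigma> :: real where "\<sigma>\<^sup>2 = 1" "\<And>i. i < n \<Longrightarrow> \<bar>a i $ r + \<sigma> * a i $ s\<bar> \<le> 1"
proof -
  have "\<not> (\<exists>i<n. \<exists>j<n. a i $ r * a i $ s = 1 \<and> a j $ r * a j $ s = -1)"
  proof clarify
    fix i j assume ij: "i < n" "j < n" "a i $ r * a i $ s = 1" "a j $ r * a j $ s = -1"
    then have ne: "i \<noteq> j" by auto
    have 1: "inj_on (\<lambda>p. if p = 0 then r else s) {..<2::nat}" using rs by (auto simp: inj_on_def)
    have 2: "inj_on (\<lambda>q. if q = 0 then i else j) {..<2::nat}" using ne by (auto simp: inj_on_def)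
    have 3: "(\<lambda>q. if q = 0 then i else j) ` {..<2::nat} \<subseteq> {..<n}" using ij(1,2) by auto
    have "det_nat 2 (\<lambda>p q. a (if q = 0 then i else j) $ (if p = 0 then r else s)) \<in> {-1, 0, 1}"
      by (rule tu[unfolded totally_unimodular_def, rule_format, OF 1 2 3])
    moreover have "det_nat 2 (\<lambda>p q. a (if q = 0 then i else j) $ (if p = 0 then r else s))
       = a i $ r * a j $ s - a j $ r * a i $ s"
    proof -
      have e: "{..<2::nat} = {0, 1}" by auto
      have "{p. p permutes {0, 1::nat}} = {id, Transposition.transpose 0 1}"
        using permutes_doubleton_iff[of _ 0 "1::nat"] by auto
      moreover have "Transposition.transpose 0 1 \<noteq> (id :: nat \<Rightarrow> nat)" by (metis id_apply transpose_apply_first zero_neq_one)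
      ultimately show ?thesis
        unfolding det_nat_def e by (simp add: sign_swap_id)
    qed
    ultimately have D: "a i $ r * a j $ s - a j $ r * a i $ s \<in> {-1, 0, 1}" by simp
    have i1: "a i $ r = a i $ s \<and> (a i $ s = 1 \<or> a i $ s = -1)"
      using tu_entry[OF tu ij(1), of r] tu_entry[OF tu ij(1), of s] ij(3) by auto
    have j1: "a j $ r = - a j $ s \<and> (a j $ s = 1 \<or> a j $ s = -1)"
      using tu_entry[OF tu ij(2), of r] tu_entry[OF tu ij(2), of s] ij(4) by auto
    show False using D i1 j1 by (elim conjE disjE) simp_all
  qed
  then consider "\<And>i. i < n \<Longrightarrow> a i $ r * a i $ s \<noteq> 1" | "\<And>j. j < n \<Longrightarrow> a j $ r * a j $ s \<noteq> -1" by blast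
  then show thesis
  proof cases
    case 1
    have "\<bar>a i $ r + 1 * a i $ s\<bar> \<le> 1" if "i < n" for i
      using 1[OF that] tu_entry[OF tu that, of r] tu_entry[OF tu that, of s] by auto
    then show thesis using that[of 1] by simp
  next
    case 2
    have "\<bar>a i $ r + (-1) * a i $ s\<bar> \<le> 1" if "i < n" for i
      using 2[OF that] tu_entry[OF tu that, of r] tu_entry[OF tu that, of s] by auto
    then show thesis using that[of "-1"] by simp
  qed
qed

context dicing_form begin

text \<open>The approximations are known only on short vectors of norm at most 2. Unit vectors give
  the diagonal entries. For rows r and s one of the sum and the difference of the unit vectors is
  short, and polarisation gives the off-diagonal entry. So the approximating matrices converge to
  Q.\<close>

lemma form_in_closed_cone:
  assumes g2: "CARD('g) \<ge> 2"
  obtains l where "\<And>i. i < n \<Longrightarrow> 0 \<le> l i" "Q = oform n a l"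
proof -
  obtain C where C: "C \<ge> 0" "\<And>N. N > 0 \<Longrightarrow> \<exists>l. (\<forall>i<n. 0 \<le> l i) \<and>
    (\<forall>p. short p \<and> norm p \<le> 2 \<longrightarrow> \<bar>2 * qf Q p - (\<Sum>i<n. (a i \<bullet> p)\<^sup>2 * l i)\<bar> \<le> C / real N)"
    using approx_form[OF g2] by blast
  define R where "R N l \<longleftrightarrow> (\<forall>i<n. 0 \<le> l i) \<and>
    (\<forall>p. short p \<and> norm p \<le> 2 \<longrightarrow> \<bar>2 * qf Q p - (\<Sum>i<n. (a i \<bullet> p)\<^sup>2 * l i)\<bar> \<le> C / real (Suc N))" for N l
  have "\<exists>l. R N l" for N unfolding R_def using C(2)[of "Suc N"] by simp
  then obtain l where "\<And>N. R N (l N)" by metis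
  then have l: "(\<forall>i<n. 0 \<le> l N i) \<and> (\<forall>p. short p \<and> norm p \<le> 2 \<longrightarrow>
     \<bar>2 * qf Q p - (\<Sum>i<n. (a i \<bullet> p)\<^sup>2 * l N i)\<bar> \<le> C / real (Suc N))" for N
    unfolding R_def by blast
  \<comment> \<open>The factor 1/2 is there because the averages approximate twice the form.\<close>
  define M where "M N = oform n a (\<lambda>i. l N i / 2)" for N
  have qM: "2 * qf (M N) p = (\<Sum>i<n. (a i \<bullet> p)\<^sup>2 * l N i)" for N p
    unfolding M_def qf_oform sum_distrib_left by (rule sum.cong) simp_all
  have C0: "(\<lambda>N. C / real (Suc N)) \<longlonglongrightarrow> 0"
    using LIMSEQ_Suc[OF lim_const_over_n[of C]] by simp
  have conv: "(\<lambda>N. qf (M N) p) \<longlonglongrightarrow> qf Q p" if p: "short p" "norm p \<le> 2" for p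
  proof -
    have "(\<lambda>N. 2 * qf (M N) p - 2 * qf Q p) \<longlonglongrightarrow> 0"
    proof (rule Lim_null_comparison[OF _ C0])
      show "\<forall>\<^sub>F N in sequentially. norm (2 * qf (M N) p - 2 * qf Q p) \<le> C / real (Suc N)"
      proof (intro always_eventually allI)
        fix N
        have "\<bar>2 * qf Q p - 2 * qf (M N) p\<bar> \<le> C / real (Suc N)" unfolding qM using l[of N] p by blast
        then show "norm (2 * qf (M N) p - 2 * qf Q p) \<le> C / real (Suc N)"
          by (simp only: real_norm_def abs_minus_commute)
      qed
    qed
    then have "(\<lambda>N. (2 * qf (M N) p - 2 * qf Q p) / 2 + qf Q p) \<longlonglongrightarrow> 0 / 2 + qf Q p"
      by (intro tendsto_intros) auto
    then show ?thesis by (simp add: diff_divide_distrib)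
  qed
  have short_axis: "short (axis r 1)" for r
    using tu_entry_abs[OF tu] by (simp add: short_def inner_axis)
  have dia: "(\<lambda>N. M N $ r $ r) \<longlonglongrightarrow> Q $ r $ r" for r
    using conv[OF short_axis[of r]] by (simp add: qf_axis norm_axis_1)
  have "(\<lambda>N. M N $ r $ s) \<longlonglongrightarrow> Q $ r $ s" for r s
  proof (cases "r = s")
    case False
    obtain \<sigma> :: real where \<sigma>: "\<sigma>\<^sup>2 = 1" "\<And>i. i < n \<Longrightarrow> \<bar>a i $ r + \<sigma> * a i $ s\<bar> \<le> 1"
      using tu_row_signs[OF tu False] by blast
    let ?p = "axis r 1 + \<sigma> *\<^sub>R axis s 1 :: real^'g"
    have sg: "\<sigma> = 1 \<or> \<sigma> = -1" using \<sigma>(1) by (simp add: power2_eq_1_iff)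
    have "?p \<in> Zlat" using sg Zlat_add[OF axis_Zlat axis_Zlat] Zlat_diff[OF axis_Zlat axis_Zlat] by auto
    then have "short ?p" using \<sigma>(2) by (simp add: short_def inner_add_right inner_axis)
    moreover have "norm ?p \<le> 2"
      using norm_triangle_ineq[of "axis r 1 :: real^'g" "\<sigma> *\<^sub>R axis s 1"] sg by (auto simp: norm_axis_1)
    ultimately have "(\<lambda>N. qf (M N) ?p) \<longlonglongrightarrow> qf Q ?p" by (rule conv)
    then have "(\<lambda>N. (\<sigma> / 2) * (qf (M N) ?p - M N $ r $ r - M N $ s $ s)) \<longlonglongrightarrow> (\<sigma> / 2) * (qf Q ?p - Q $ r $ r - Q $ s $ s)"
      by (intro tendsto_intros dia)
    moreover have "(\<sigma> / 2) * (qf R ?p - R $ r $ r - R $ s $ s) = R $ r $ s" if "transpose R = R" for R :: "real^'g^'g"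
      unfolding qf_axis_pair[OF that \<sigma>(1)] using sg by auto
    ultimately show ?thesis using sym by (simp add: M_def oform_sym)
  qed (simp add: dia)
  then have "M \<longlonglongrightarrow> Q" by (intro vec_tendstoI)
  moreover have "M N \<in> convex_cone hull ((\<lambda>i. (\<chi> r s. a i $ r * a i $ s)) ` {..<n})" for N
    unfolding M_def using l by (intro oform_cone) auto
  moreover have "closed (convex_cone hull ((\<lambda>i. (\<chi> r s. a i $ r * a i $ s)) ` {..<n}))"
    by (intro closed_convex_cone_hull) simp
  ultimately have "Q \<in> convex_cone hull ((\<lambda>i. (\<chi> r s. a i $ r * a i $ s)) ` {..<n})"
    using closed_sequentially by blast
  then show thesis by (rule cone_oform) (rule that)
qed

text \<open>If a coefficient vanished, the form would be affine across a wall of the dicing.\<close>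
lemma coefficient_pos:
  assumes l: "\<And>i. i < n \<Longrightarrow> 0 \<le> l i" and Q: "Q = oform n a l" and i: "i < n"
  shows "l i > 0"
proof (rule ccontr)
  assume "\<not> l i > 0"
  then have li: "l i = 0" using l[OF i] by simp
  have ai: "a i \<bullet> a i > 0" using nz[OF i] by simp
  have "\<exists>e\<in>{d. a i \<bullet> d = 0}. a j \<bullet> e \<noteq> 0" if j: "j \<in> {..<n} - {i}" for j
  proof -
    define c where "c = (a i \<bullet> a j) / (a i \<bullet> a i)"
    define e where "e = a j - c *\<^sub>R a i"
    have ie: "a i \<bullet> e = 0" using ai by (simp add: e_def c_def inner_diff_right)
    have "e \<noteq> 0"
    proof
      assume "e = 0"
      then have "(- c) *\<^sub>R a i + 1 *\<^sub>R a j = 0" by (simp add: e_def)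
      then show False using pair[of i j "- c" 1] i j by auto
    qed
    moreover have "a j \<bullet> e = e \<bullet> e" using ie by (simp add: e_def inner_diff_left)
    ultimately show ?thesis using ie by auto
  qed
  moreover have "subspace {d. a i \<bullet> d = 0}" by (auto simp: subspace_def inner_add_right)
  \<comment> \<open>A direction in the hyperplane of column i that lies in no other wall: no other
    column is proportional to \<open>a i\<close>, so none vanishes on the whole hyperplane.\<close>
  ultimately obtain d where d: "a i \<bullet> d = 0" "\<And>j. j \<in> {..<n} - {i} \<Longrightarrow> a j \<bullet> d \<noteq> 0"
    using generic_vector[of "{..<n} - {i}" "{d. a i \<bullet> d = 0}" a] by blast
  define \<epsilon> where "\<epsilon> = 1 / (1 + (\<Sum>j<n. \<bar>a j \<bullet> d\<bar>))"
  have pos: "1 + (\<Sum>j<n. \<bar>a j \<bullet> d\<bar>) > 0" by (simp add: add_pos_nonneg sum_nonneg)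
  then have eps: "\<epsilon> > 0" by (simp add: \<epsilon>_def)
  define x where "x = \<epsilon> *\<^sub>R d"
  have xi: "a i \<bullet> x = 0" using d(1) by (simp add: x_def)
  have xj: "a j \<bullet> x \<noteq> 0 \<and> \<bar>a j \<bullet> x\<bar> < 1" if j: "j < n" "j \<noteq> i" for j
  proof -
    have "\<bar>a j \<bullet> d\<bar> < 1 + (\<Sum>j<n. \<bar>a j \<bullet> d\<bar>)"
      using member_le_sum[of j "{..<n}" "\<lambda>j. \<bar>a j \<bullet> d\<bar>"] j(1) by simp
    then have "\<bar>\<epsilon> * (a j \<bullet> d)\<bar> < 1" using pos eps by (simp add: \<epsilon>_def abs_mult)
    then show ?thesis using d(2)[of j] j eps by (simp add: x_def)
  qed
  \<comment> \<open>Since \<open>a i \<bullet> x = 0\<close>, the i-th bounds are -1 and 0 for F2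
    and 0 and 1 for F1: these are the faces below and above the wall through x.\<close>
  let ?f = "\<lambda>j. if 0 < a j \<bullet> x then 0 else - 1 :: int" and ?c = "\<lambda>j. if 0 < a j \<bullet> x then 1 else 0 :: int"
  let ?c1 = "?c(i := 1)" and ?f1 = "?f(i := 0)"
  define F1 where "F1 = dface n a ?f1 ?c1"
  define F2 where "F2 = dface n a ?f ?c"
  have bx: "unit_box n ?f1 ?c1" "unit_box n ?f ?c" by (auto simp: unit_box_def)
  text \<open>a radius within which every form except the i-th stays in its open unit interval\<close>
  define m where "m = Min (insert 1 ((\<lambda>j. min \<bar>a j \<bullet> x\<bar> (1 - \<bar>a j \<bullet> x\<bar>)) ` ({..<n} - {i})))"
  have m: "m > 0" "m \<le> 1" unfolding m_def using xj by (auto simp: )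
  have mj: "m \<le> \<bar>a j \<bullet> x\<bar> \<and> m \<le> 1 - \<bar>a j \<bullet> x\<bar>" if "j < n" "j \<noteq> i" for j
  proof -
    have "m \<le> min \<bar>a j \<bullet> x\<bar> (1 - \<bar>a j \<bullet> x\<bar>)" unfolding m_def using that by (intro Min_le) auto
    then show ?thesis by simp
  qed
  have near: "of_int (?f j) \<le> a j \<bullet> (x + e) \<and> a j \<bullet> (x + e) \<le> of_int (?c j)" if "j < n" "j \<noteq> i" "\<bar>a j \<bullet> e\<bar> \<le> m" for j e
    using mj[OF that(1,2)] that(3) xj[OF that(1,2)] by (auto simp: inner_add_right abs_if split: if_splits)
  define c where "c = (\<Sum>j<n. (l j * of_int (?f j + ?c j)) *\<^sub>R a j)"
  define h where "h = - (\<Sum>j<n. l j * of_int (?f j * ?c j))"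
  have split: "qf Q v = (\<Sum>j<n. l j * ((a j \<bullet> v - of_int (?f j)) * (a j \<bullet> v - of_int (?c j)))) + c \<bullet> v + h" for v
    unfolding Q qf_oform c_def h_def inner_sum_left sum.distrib[symmetric] sum_negf[symmetric]
    by (intro sum.cong refl) (simp add: algebra_simps power2_eq_square)
  \<comment> \<open>With \<open>l i = 0\<close> the i-th penalty disappears, so Q agrees with one
    affine function at the lattice points on both sides of the wall.\<close>
  have zero: "qf Q v = c \<bullet> v + h" if v: "v \<in> Zlat" and b: "\<And>j. j < n \<Longrightarrow> j \<noteq> i \<Longrightarrow> of_int (?f j) \<le> a j \<bullet> v \<and> a j \<bullet> v \<le> of_int (?c j)" for v
  proof -
    have zj: "l j * ((a j \<bullet> v - of_int (?f j)) * (a j \<bullet> v - of_int (?c j))) = 0" if j: "j < n" for j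
    proof (cases "j = i")
      case False
      obtain t where t: "a j \<bullet> v = of_int t" using inner_Zlat[OF aZ[OF j] v] by (auto elim: Ints_cases)
      have "?f j \<le> t \<and> t \<le> ?c j" using b[OF j False] unfolding t by (simp only: of_int_le_iff)
      then have "t = ?f j \<or> t = ?c j" by (auto split: if_splits)
      then show ?thesis using t by auto
    qed (simp add: li)
    have "(\<Sum>j<n. l j * ((a j \<bullet> v - of_int (?f j)) * (a j \<bullet> v - of_int (?c j)))) = 0"
      by (rule sum.neutral) (use zj in blast)
    then show ?thesis unfolding split by simp
  qed
  have F1: "F1 \<in> dicing n a"
    unfolding F1_def
  proof (rule pl_face(1)[OF bx(1)])
    fix j assume "j < n"
    then show "of_int (?f1 j) \<le> a j \<bullet> x \<and> a j \<bullet> x \<le> of_int (?c1 j)"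
      using near[of j 0] m xi by (cases "j = i") auto
  qed
  have t1: "touches F1 (slope F1) (offset F1)" by (rule touches[OF F1])
  define \<psi> where "\<psi> = slope F1 - c"
  have psi0: "\<psi> \<bullet> v + (offset F1 - h) = 0" if "v \<in> F1" for v
  proof -
    have vZ: "v \<in> Zlat" using that by (simp add: F1_def dface_def)
    have "of_int (?f j) \<le> a j \<bullet> v \<and> a j \<bullet> v \<le> of_int (?c j)" if "j < n" "j \<noteq> i" for j
    proof -
      have "of_int (?f1 j) \<le> a j \<bullet> v \<and> a j \<bullet> v \<le> of_int (?c1 j)"
        using \<open>v \<in> F1\<close> \<open>j < n\<close> unfolding F1_def dface_def by blast
      then show ?thesis unfolding fun_upd_other[OF \<open>j \<noteq> i\<close>] .
    qed
    then have "qf Q v = c \<bullet> v + h" by (rule zero[OF vZ])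
    moreover have "slope F1 \<bullet> v + offset F1 = qf Q v" using t1 vZ that unfolding touches_def by blast
    ultimately show ?thesis by (simp add: \<psi>_def inner_diff_left)
  qed
  have psik: "\<psi> \<bullet> z = 0" if "z \<in> kerA" for z
  proof -
    have "slope F1 \<bullet> z = 0" using t1 that by (simp add: touches_def minorant_def)
    moreover have "c \<bullet> z = 0" using that by (simp add: c_def inner_sum_left kerA_def)
    ultimately show ?thesis by (simp add: \<psi>_def inner_diff_left)
  qed
  \<comment> \<open>Rounding with \<psi> and with its negative encloses the value at y between
    values at vertices of F1, where the function vanishes.\<close>
  have psireal: "\<psi> \<bullet> y + (offset F1 - h) = 0" if y: "\<And>j. j < n \<Longrightarrow> of_int (?f1 j) \<le> a j \<bullet> y \<and> a j \<bullet> y \<le> of_int (?c1 j)" for y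
  proof -
    have sub: "hull_face y \<subseteq> F1" unfolding F1_def by (rule hull_face_subset[OF y])
    obtain v where v: "v \<in> hull_face y" "\<psi> \<bullet> v \<le> \<psi> \<bullet> y" using rounding[of \<psi> y] psik by blast
    obtain w where w: "w \<in> hull_face y" "(- \<psi>) \<bullet> w \<le> (- \<psi>) \<bullet> y" using rounding[of "- \<psi>" y] psik by auto
    have "v \<in> F1" "w \<in> F1" using v(1) w(1) sub by blast+
    then show ?thesis using psi0[of v] psi0[of w] v(2) w(2) by simp
  qed
  define \<delta> where "\<delta> = m / (1 + (\<Sum>j<n. \<bar>a j \<bullet> a i\<bar>))"
  have dpos: "1 + (\<Sum>j<n. \<bar>a j \<bullet> a i\<bar>) > 0" by (simp add: add_pos_nonneg sum_nonneg)
  then have del: "\<delta> > 0" using m by (simp add: \<delta>_def)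
  have dai: "\<bar>a j \<bullet> (\<delta> *\<^sub>R a i)\<bar> \<le> m" if "j < n" for j
  proof -
    have "\<bar>a j \<bullet> a i\<bar> \<le> 1 + (\<Sum>j<n. \<bar>a j \<bullet> a i\<bar>)"
      using member_le_sum[of j "{..<n}" "\<lambda>j. \<bar>a j \<bullet> a i\<bar>"] that by simp
    then have "m * \<bar>a j \<bullet> a i\<bar> \<le> m * (1 + (\<Sum>j<n. \<bar>a j \<bullet> a i\<bar>))" using m(1) by (intro mult_left_mono) auto
    then show ?thesis using dpos m(1) by (simp add: \<delta>_def abs_mult pos_divide_le_eq)
  qed
  \<comment> \<open>The box of F1 contains a half ball around x on the upper side of the wall, so an
    affine function vanishing on the box has no linear part.\<close>
  have "\<psi> \<bullet> e = 0" if e: "0 \<le> a i \<bullet> e" for e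
  proof -
    define \<eta> where "\<eta> = m / (1 + (\<Sum>j<n. \<bar>a j \<bullet> e\<bar>))"
    have epos: "1 + (\<Sum>j<n. \<bar>a j \<bullet> e\<bar>) > 0" by (simp add: add_pos_nonneg sum_nonneg)
    then have eta: "\<eta> > 0" using m by (simp add: \<eta>_def)
    have ae: "\<bar>a j \<bullet> (\<eta> *\<^sub>R e)\<bar> \<le> m" if "j < n" for j
    proof -
      have "\<bar>a j \<bullet> e\<bar> \<le> 1 + (\<Sum>j<n. \<bar>a j \<bullet> e\<bar>)"
        using member_le_sum[of j "{..<n}" "\<lambda>j. \<bar>a j \<bullet> e\<bar>"] that by simp
      then have "m * \<bar>a j \<bullet> e\<bar> \<le> m * (1 + (\<Sum>j<n. \<bar>a j \<bullet> e\<bar>))" using m(1) by (intro mult_left_mono) auto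
      then show ?thesis using epos m(1) by (simp add: \<eta>_def abs_mult pos_divide_le_eq)
    qed
    have "\<psi> \<bullet> (x + \<eta> *\<^sub>R e) + (offset F1 - h) = 0"
    proof (rule psireal)
      fix j assume j: "j < n"
      show "of_int (?f1 j) \<le> a j \<bullet> (x + \<eta> *\<^sub>R e) \<and> a j \<bullet> (x + \<eta> *\<^sub>R e) \<le> of_int (?c1 j)"
      proof (cases "j = i")
        case True
        have "0 \<le> a i \<bullet> (\<eta> *\<^sub>R e)" using e eta by simp
        moreover have "a i \<bullet> (\<eta> *\<^sub>R e) \<le> 1" using ae[OF i] m by linarith
        ultimately show ?thesis using True xi unfolding inner_add_right by simp
      next
        case False
        then show ?thesis using near[OF j False ae[OF j]] by simp
      qed
    qed
    moreover have "\<psi> \<bullet> x + (offset F1 - h) = 0"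
    proof (rule psireal)
      fix j assume "j < n"
      then show "of_int (?f1 j) \<le> a j \<bullet> x \<and> a j \<bullet> x \<le> of_int (?c1 j)"
        using near[of j 0] m xi by (cases "j = i") auto
    qed
    ultimately have "\<eta> * (\<psi> \<bullet> e) = 0" unfolding inner_add_right inner_scaleR_right by linarith
    then show ?thesis using eta by simp
  qed
  then have half: "0 \<le> a i \<bullet> e \<Longrightarrow> \<psi> \<bullet> e = 0" for e by blast
  have all0: "\<psi> \<bullet> e = 0" for e
    using half[of e] half[of "- e"] by (cases "0 \<le> a i \<bullet> e") auto
  define y where "y = x - \<delta> *\<^sub>R a i"
  have yi: "a i \<bullet> y < 0" "- 1 \<le> a i \<bullet> y"
    using del ai dai[OF i] m xi unfolding y_def inner_diff_right by auto
  have yb: "of_int (?f j) \<le> a j \<bullet> y \<and> a j \<bullet> y \<le> of_int (?c j)" if j: "j < n" for j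
  proof (cases "j = i")
    case True
    then show ?thesis using yi xi by simp
  next
    case False
    then show ?thesis using near[OF j False, of "- (\<delta> *\<^sub>R a i)"] dai[OF j] by (simp add: y_def)
  qed
  \<comment> \<open>Rounding y without increasing \<open>a i\<close> produces a lattice point
    strictly below the wall, hence outside F1. The support function of F1 would still equal Q
    there.\<close>
  obtain v where v: "v \<in> hull_face y" "a i \<bullet> v \<le> a i \<bullet> y"
    using rounding[of "a i" y] i unfolding kerA_def by blast
  have vF2: "v \<in> F2" using hull_face_subset[OF yb] v(1) unfolding F2_def by blast
  then have vZ: "v \<in> Zlat" by (simp add: F2_def dface_def)
  have "v \<notin> F1"
  proof
    assume "v \<in> F1"
    then have "of_int (?f1 i) \<le> a i \<bullet> v" using i unfolding F1_def dface_def by blast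
    then show False using v(2) yi by simp
  qed
  then have "slope F1 \<bullet> v + offset F1 \<noteq> qf Q v" using t1 vZ unfolding touches_def by metis
  moreover have "qf Q v = c \<bullet> v + h" by (rule zero[OF vZ]) (use vF2 in \<open>unfold F2_def dface_def, blast\<close>)
  moreover have "slope F1 \<bullet> v + offset F1 = c \<bullet> v + h"
  proof -
    obtain u where "u \<in> F1" using F1 by (auto simp: dicing_def)
    then have "offset F1 - h = 0" using psi0[of u] all0[of u] by simp
    moreover have "slope F1 \<bullet> v = c \<bullet> v" using all0[of v] by (simp add: \<psi>_def inner_diff_left)
    ultimately show ?thesis by simp
  qed
  ultimately show False by simp
qed

theorem form_in_sigma0:
  assumes "CARD('g) \<ge> 2"
  shows "Q \<in> sigma0 n a"
proof -
  obtain l where l: "\<And>i. i < n \<Longrightarrow> 0 \<le> l i" "Q = oform n a l" by (rule form_in_closed_cone[OF assms]) (rule that)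
  then have "\<forall>i<n. l i > 0" using coefficient_pos by simp
  then show ?thesis unfolding sigma0_oform l(2) by blast
qed

end

section \<open>Simple column systems and whole Voronoi cells\<close>

lemma col_dependent_singleton: "a i = 0 \<Longrightarrow> col_dependent a {i}"
  unfolding col_dependent_def by (rule exI[of _ "\<lambda>_. 1"]) simp

lemma simple_col_nz:
  assumes s: "simple_col n a" and i: "i < n" shows "a i \<noteq> 0"
proof
  assume "a i = 0"
  then have "{i} \<in> col_circuits n a"
    using i col_dependent_singleton[of a i] by (auto simp: col_circuits_def col_dependent_def)
  then show False using s by (fastforce simp: simple_col_def)
qed

lemma simple_col_pair:
  assumes s: "simple_col n a" and ij: "i < n" "j < n" "i \<noteq> j" and e: "s *\<^sub>R a i + t *\<^sub>R a j = 0"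
  shows "s = 0 \<and> t = (0::real)"
proof (rule ccontr)
  assume "\<not> ?thesis"
  then have dep: "col_dependent a {i, j}"
    unfolding col_dependent_def using ij e by (intro exI[of _ "\<lambda>k. if k = i then s else t"]) auto
  have nd: "\<not> col_dependent a {k}" if "k < n" for k
    using simple_col_nz[OF s that] by (auto simp: col_dependent_def)
  have "\<not> col_dependent a D" if "D \<subset> {i, j}" for D
  proof -
    have "D = {} \<or> D = {i} \<or> D = {j}" using that by auto
    moreover have "\<not> col_dependent a {}" by (simp add: col_dependent_def)
    ultimately show ?thesis using nd[OF ij(1)] nd[OF ij(2)] by blast
  qed
  then have "{i, j} \<in> col_circuits n a" using dep ij by (auto simp: col_circuits_def)
  then show False using s ij by (fastforce simp: simple_col_def)
qed

theorem gl_sat_sigma0: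
  fixes a :: "nat \<Rightarrow> real^'g::finite"
  assumes g2: "CARD('g) \<ge> 2" and tu: "totally_unimodular n a" and s: "simple_col n a"
  shows "\<exists>Q0\<in>Omega_rt. gl_sat (sigma0 n a) = vcell Q0"
proof
  let ?Q0 = "oform n a (\<lambda>_. 1)"
  show Q0: "?Q0 \<in> Omega_rt" by (rule oform_Omega[OF tu]) simp
  have vt0: "vor_type ?Q0 = dicing n a" by (rule vor_type_oform[OF tu]) simp
  show "gl_sat (sigma0 n a) = vcell ?Q0"
  proof (intro set_eqI iffI)
    fix Q assume "Q \<in> gl_sat (sigma0 n a)"
    then obtain h l where h: "h \<in> GLZ" "gl_act h Q = oform n a l" "\<forall>i<n. l i > 0"
      unfolding gl_sat_def sigma0_oform by blast
    have "Q \<in> Omega_rt" using oform_Omega[where a=a and l=l, OF tu] h gl_act_Omega_iff by metis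
    moreover have "vor_type (gl_act h Q) = vor_type ?Q0"
      unfolding h(2) vt0 by (rule vor_type_oform[OF tu]) (use h(3) in blast)
    ultimately show "Q \<in> vcell ?Q0" using h(1) unfolding vcell_def by blast
  next
    fix Q assume "Q \<in> vcell ?Q0"
    then obtain h where h: "h \<in> GLZ" "Q \<in> Omega_rt" "vor_type (gl_act h Q) = dicing n a"
      unfolding vcell_def vt0 by blast
    have "gl_act h Q \<in> Omega_rt" by (rule gl_act_Omega[OF h(1,2)])
    then interpret dicing_form n a "gl_act h Q"
      using tu h(3) simple_col_nz[OF s] simple_col_pair[OF s]
      by unfold_locales (auto simp: Omega_rt_def)
    show "Q \<in> gl_sat (sigma0 n a)" using form_in_sigma0[OF g2] h(1) unfolding gl_sat_def by blast
  qed
qed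

section \<open>Cycles and cuts of a connected graph\<close>

text \<open>Gaussian elimination of one unknown per equation. It serves as the dimension count for
  vectors indexed by finite sets of vertices or edges.\<close>

lemma homogeneous_system:
  fixes c :: "'v \<Rightarrow> 't \<Rightarrow> real"
  assumes "finite T" "finite V" "card T < card V"
  shows "\<exists>l. (\<exists>v\<in>V. l v \<noteq> 0) \<and> (\<forall>t\<in>T. (\<Sum>v\<in>V. l v * c v t) = 0)"
  using assms
proof (induction T arbitrary: V c rule: finite_induct)
  case empty
  then obtain v where "v \<in> V" by (metis card_gt_0_iff all_not_in_conv card.empty)
  then show ?case by (intro exI[of _ "\<lambda>_. 1"]) auto
next
  case (insert t T)
  show ?case
  proof (cases "\<forall>v\<in>V. c v t = 0")
    case True
    obtain l where "\<exists>v\<in>V. l v \<noteq> 0" "\<forall>t\<in>T. (\<Sum>v\<in>V. l v * c v t) = 0"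
      using insert.IH[of V c] insert.prems insert.hyps by auto
    then show ?thesis using True by (intro exI[of _ l]) auto
  next
    case False
    then obtain p where p: "p \<in> V" "c p t \<noteq> 0" by blast
    define c' where "c' v s = c v s - c v t / c p t * c p s" for v s
    have fV: "finite (V - {p})" "card T < card (V - {p})" using insert.prems insert.hyps p(1) by auto
    obtain l where l: "\<exists>v\<in>V - {p}. l v \<noteq> 0" "\<forall>s\<in>T. (\<Sum>v\<in>V - {p}. l v * c' v s) = 0"
      using insert.IH[OF fV, of c'] by blast
    define m where "m v = (if v = p then - (\<Sum>v\<in>V - {p}. l v * c v t) / c p t else l v)" for v
    have sm: "(\<Sum>v\<in>V. m v * c v s) = (\<Sum>v\<in>V - {p}. l v * c' v s)" for s
    proof -
      have "(\<Sum>v\<in>V. m v * c v s) = m p * c p s + (\<Sum>v\<in>V - {p}. m v * c v s)"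
        using p(1) insert.prems(1) by (simp add: sum.remove)
      also have "(\<Sum>v\<in>V - {p}. m v * c v s) = (\<Sum>v\<in>V - {p}. l v * c v s)"
        by (intro sum.cong) (auto simp: m_def)
      also have "m p * c p s = - (\<Sum>v\<in>V - {p}. l v * (c v t / c p t * c p s))"
        by (simp add: m_def sum_distrib_left sum_distrib_right sum_divide_distrib mult_ac)
      finally show ?thesis by (simp add: c'_def right_diff_distrib sum_subtractf)
    qed
    have "(\<Sum>v\<in>V. m v * c v s) = 0" if "s \<in> insert t T" for s
    proof (cases "s = t")
      case True
      have "c' v t = 0" for v using p(2) by (simp add: c'_def)
      then show ?thesis unfolding sm True by simp
    next
      case False
      then show ?thesis unfolding sm using l(2) that by blast
    qed
    moreover have "\<exists>v\<in>V. m v \<noteq> 0" using l(1) by (auto simp: m_def)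
    ultimately show ?thesis by blast
  qed
qed

definition bdry :: "nat set \<Rightarrow> (nat \<Rightarrow> nat \<times> nat) \<Rightarrow> (nat \<Rightarrow> real) \<Rightarrow> nat \<Rightarrow> real" where
  "bdry E ends \<alpha> v = (\<Sum>e\<in>{e\<in>E. snd (ends e) = v}. \<alpha> e) - (\<Sum>e\<in>{e\<in>E. fst (ends e) = v}. \<alpha> e)"

definition H1R :: "nat set \<Rightarrow> nat set \<Rightarrow> (nat \<Rightarrow> nat \<times> nat) \<Rightarrow> (nat \<Rightarrow> real) set" where
  "H1R V E ends = {\<alpha>. (\<forall>e. e \<notin> E \<longrightarrow> \<alpha> e = 0) \<and> (\<forall>v\<in>V. bdry E ends \<alpha> v = 0)}"

lemma H1Z_H1R: "\<alpha> \<in> H1Z V E ends \<longleftrightarrow> (\<lambda>e. of_int (\<alpha> e)) \<in> H1R V E ends"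
proof -
  have "bdry E ends (\<lambda>e. of_int (\<alpha> e)) v = of_int ((\<Sum>e\<in>{e\<in>E. snd (ends e) = v}. \<alpha> e) - (\<Sum>e\<in>{e\<in>E. fst (ends e) = v}. \<alpha> e))" for v
    by (simp add: bdry_def)
  then show ?thesis unfolding H1Z_def H1R_def by (simp only: mem_Collect_eq of_int_eq_0_iff)
qed

lemma bdry_lin: "bdry E ends (\<lambda>e. s * \<alpha> e + t * \<beta> e) v = s * bdry E ends \<alpha> v + t * bdry E ends \<beta> v"
  by (simp add: bdry_def sum.distrib sum_distrib_left right_diff_distrib)

lemma H1R_lin: "\<alpha> \<in> H1R V E ends \<Longrightarrow> \<beta> \<in> H1R V E ends \<Longrightarrow> (\<lambda>e. s * \<alpha> e + t * \<beta> e) \<in> H1R V E ends"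
  by (simp add: H1R_def bdry_lin)

lemma H1R_0: "(\<lambda>_. 0) \<in> H1R V E ends"
  by (simp add: H1R_def bdry_def)

lemma H1R_sum:
  assumes "finite I" "\<And>i. i \<in> I \<Longrightarrow> \<alpha> i \<in> H1R V E ends"
  shows "(\<lambda>e. \<Sum>i\<in>I. x i * \<alpha> i e) \<in> H1R V E ends"
  using assms
proof (induction I rule: finite_induct)
  case empty then show ?case by (simp add: H1R_0)
next
  case (insert i I)
  then show ?case using H1R_lin[of "\<alpha> i" V E ends "\<lambda>e. \<Sum>i\<in>I. x i * \<alpha> i e" "x i" 1] by simp
qed

lemma rtrancl_leaves:
  assumes "(u, v) \<in> r\<^sup>*" "u \<in> S" "v \<notin> S"
  obtains x y where "(x, y) \<in> r" "x \<in> S" "y \<notin> S"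
  using assms by (induction rule: rtrancl_induct) auto

locale conn_graph =
  fixes V E :: "nat set" and ends :: "nat \<Rightarrow> nat \<times> nat"
  assumes fin: "fin_graph V E ends" and conn: "graph_connected V E ends"
begin

lemma finV: "finite V" and finE: "finite E" and neV: "V \<noteq> {}"
  and endsV: "e \<in> E \<Longrightarrow> fst (ends e) \<in> V" "e \<in> E \<Longrightarrow> snd (ends e) \<in> V"
  using fin by (auto simp: fin_graph_def)

text \<open>Summation by parts: taking differences of a potential is adjoint to the boundary, so
  cycles are orthogonal to potential differences.\<close>

lemma bdry_adjoint:
  "(\<Sum>e\<in>E. \<alpha> e * (\<pi> (snd (ends e)) - \<pi> (fst (ends e)))) = (\<Sum>v\<in>V. \<pi> v * bdry E ends \<alpha> v)"
proof -
  have g: "(\<Sum>e\<in>E. \<alpha> e * \<pi> (h e)) = (\<Sum>v\<in>V. \<pi> v * (\<Sum>e\<in>{e\<in>E. h e = v}. \<alpha> e))" if "h ` E \<subseteq> V" for h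
  proof -
    have "(\<Sum>e\<in>E. \<alpha> e * \<pi> (h e)) = (\<Sum>v\<in>V. \<Sum>e\<in>{e\<in>E. h e = v}. \<alpha> e * \<pi> (h e))"
      by (rule sum.group[OF finE finV that, symmetric])
    also have "\<dots> = (\<Sum>v\<in>V. \<pi> v * (\<Sum>e\<in>{e\<in>E. h e = v}. \<alpha> e))"
      unfolding sum_distrib_left by (intro sum.cong refl) auto
    finally show ?thesis .
  qed
  have "(\<Sum>e\<in>E. \<alpha> e * \<pi> (snd (ends e))) = (\<Sum>v\<in>V. \<pi> v * (\<Sum>e\<in>{e\<in>E. snd (ends e) = v}. \<alpha> e))"
    "(\<Sum>e\<in>E. \<alpha> e * \<pi> (fst (ends e))) = (\<Sum>v\<in>V. \<pi> v * (\<Sum>e\<in>{e\<in>E. fst (ends e) = v}. \<alpha> e))"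
    by (intro g; auto simp: endsV)+
  then show ?thesis by (simp add: bdry_def right_diff_distrib sum_subtractf)
qed

lemma H1R_orth: "\<alpha> \<in> H1R V E ends \<Longrightarrow> (\<Sum>e\<in>E. \<alpha> e * (\<pi> (snd (ends e)) - \<pi> (fst (ends e)))) = 0"
  unfolding bdry_adjoint by (simp add: H1R_def)

lemma bdry_unit: "e \<in> E \<Longrightarrow> bdry E ends (\<lambda>x. if x = e then 1 else 0) v = of_bool (snd (ends e) = v) - of_bool (fst (ends e) = v)"
  using finE by (simp add: bdry_def sum.If_cases Int_def)

text \<open>The edges of a walk are added up with signs according to the direction in which they are
  traversed.\<close>

lemma chain_exists:
  assumes T: "T \<subseteq> E" and p: "(u, v) \<in> (graph_adj T ends)\<^sup>*"
  shows "\<exists>\<psi>. (\<forall>e. e \<notin> T \<longrightarrow> \<psi> e = 0) \<and> (\<forall>e. \<psi> e \<in> \<int>) \<and> (\<forall>w. bdry E ends \<psi> w = of_bool (w = v) - of_bool (w = u))"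
  using p
proof (induction rule: rtrancl_induct)
  case base
  show ?case by (intro exI[of _ "\<lambda>_. 0"]) (auto simp: bdry_def)
next
  case (step y z)
  obtain \<psi> where psi: "\<forall>e. e \<notin> T \<longrightarrow> \<psi> e = 0" "\<forall>e. \<psi> e \<in> \<int>"
     "\<forall>w. bdry E ends \<psi> w = of_bool (w = y) - of_bool (w = u)" using step.IH by blast
  obtain e where e: "e \<in> T" "ends e = (y, z) \<or> ends e = (z, y)" using step.hyps(2) by (auto simp: graph_adj_def)
  define s :: real where "s = (if ends e = (y, z) then 1 else -1)"
  have s: "s \<in> \<int>" "s * (of_bool (snd (ends e) = w) - of_bool (fst (ends e) = w)) = of_bool (w = z) - of_bool (w = y)" for w
  proof -
    consider "ends e = (y, z)" | "ends e = (z, y)" "ends e \<noteq> (y, z)" using e(2) by blast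
    then show "s * (of_bool (snd (ends e) = w) - of_bool (fst (ends e) = w)) = of_bool (w = z) - of_bool (w = y)"
      by cases (auto simp: s_def)
  qed (simp add: s_def)
  let ?\<phi> = "\<lambda>x. 1 * \<psi> x + s * (if x = e then 1 else 0)"
  have eE: "e \<in> E" using T e(1) by blast
  have "bdry E ends ?\<phi> w = of_bool (w = z) - of_bool (w = u)" for w
    unfolding bdry_lin bdry_unit[OF eE] s(2) psi(3)[rule_format] by simp
  moreover have "?\<phi> x \<in> \<int>" for x using psi(2) s(1) by (intro Ints_add Ints_mult) auto
  moreover have "?\<phi> x = 0" if "x \<notin> T" for x using psi(1) e(1) that by auto
  ultimately show ?case by (intro exI[of _ ?\<phi>] conjI allI impI)
qed

text \<open>A spanning tree, encoded by connectedness and the number of its edges. Its acyclicity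
  appears as \<open>cycle_in_tree_zero\<close>.\<close>

definition spanning :: "nat set \<Rightarrow> bool" where
  "spanning T \<longleftrightarrow> T \<subseteq> E \<and> card T + 1 = card V \<and> (\<forall>u\<in>V. \<forall>v\<in>V. (u, v) \<in> (graph_adj T ends)\<^sup>*)"

lemma adj_sym: "sym (graph_adj T ends)"
  by (auto simp: sym_def graph_adj_def)

lemma adj_mono: "T \<subseteq> T' \<Longrightarrow> graph_adj T ends \<subseteq> graph_adj T' ends"
  by (auto simp: graph_adj_def)

lemma spanning_tree_exists: "\<exists>T. spanning T"
proof -
  obtain r where r: "r \<in> V" using neV by blast
  have grow: "\<exists>S T. S \<subseteq> V \<and> T \<subseteq> E \<and> r \<in> S \<and> card S = k + 1 \<and> card T = k \<and>
     (\<forall>v\<in>S. (r, v) \<in> (graph_adj T ends)\<^sup>*) \<and> (\<forall>e\<in>T. fst (ends e) \<in> S \<and> snd (ends e) \<in> S)" if "k < card V" for k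
    using that
  proof (induction k)
    case 0
    show ?case by (rule exI[of _ "{r}"], rule exI[of _ "{}"]) (use r in auto)
  next
    case (Suc k)
    then obtain S T where ST: "S \<subseteq> V" "T \<subseteq> E" "r \<in> S" "card S = k + 1" "card T = k"
      "\<forall>v\<in>S. (r, v) \<in> (graph_adj T ends)\<^sup>*" "\<forall>e\<in>T. fst (ends e) \<in> S \<and> snd (ends e) \<in> S" by auto
    have "S \<noteq> V" using ST(4) Suc.prems by auto
    then obtain v where v: "v \<in> V" "v \<notin> S" using ST(1) by blast
    have "(r, v) \<in> (graph_adj E ends)\<^sup>*" using conn r v(1) by (simp add: graph_connected_def)
    then obtain x y where xy: "(x, y) \<in> graph_adj E ends" "x \<in> S" "y \<notin> S" using rtrancl_leaves ST(3) v(2) by metis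
    then obtain e where e: "e \<in> E" "ends e = (x, y) \<or> ends e = (y, x)" by (auto simp: graph_adj_def)
    have yV: "y \<in> V" using e endsV by fastforce
    have eT: "e \<notin> T" using ST(7) e(2) xy(3) by auto
    let ?S = "insert y S" and ?T = "insert e T"
    have finS: "finite S" "finite T" using ST finV finE finite_subset by blast+
    have mono: "(graph_adj T ends)\<^sup>* \<subseteq> (graph_adj ?T ends)\<^sup>*" by (intro rtrancl_mono adj_mono) auto
    have "(x, y) \<in> graph_adj ?T ends" using e(2) by (auto simp: graph_adj_def)
    moreover have "(r, x) \<in> (graph_adj ?T ends)\<^sup>*" using ST(6) xy(2) mono by blast
    ultimately have "(r, y) \<in> (graph_adj ?T ends)\<^sup>*" by (meson rtrancl.rtrancl_into_rtrancl)
    then have "\<forall>v\<in>?S. (r, v) \<in> (graph_adj ?T ends)\<^sup>*" using ST(6) mono by blast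
    moreover have "\<forall>e\<in>?T. fst (ends e) \<in> ?S \<and> snd (ends e) \<in> ?S" using ST(7) e(2) xy(2) by auto
    moreover have "card ?S = Suc k + 1" "card ?T = Suc k" using finS ST(4,5) xy(3) eT by auto
    ultimately show ?case using ST(1-3) yV e(1) by (intro exI[of _ ?S] exI[of _ ?T]) auto
  qed
  have cV: "card V > 0" using finV neV by (simp add: card_gt_0_iff)
  then have lt: "card V - 1 < card V" by simp
  obtain S T where ST: "S \<subseteq> V" "T \<subseteq> E" "card S = card V - 1 + 1" "card T = card V - 1"
     "\<forall>v\<in>S. (r, v) \<in> (graph_adj T ends)\<^sup>*" using grow[OF lt] by blast
  have "S = V" using ST(1,3) finV cV by (simp add: card_subset_eq)
  then have rv: "(r, v) \<in> (graph_adj T ends)\<^sup>*" if "v \<in> V" for v using ST(5) that by blast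
  have "(u, v) \<in> (graph_adj T ends)\<^sup>*" if "u \<in> V" "v \<in> V" for u v
    using rv[OF that(1)] rv[OF that(2)] sym_rtrancl[OF adj_sym] by (meson rtrancl_trans symD)
  then show ?thesis using ST(2,4) cV unfolding spanning_def by (intro exI[of _ T]) auto
qed

lemma potential_const:
  assumes "\<And>e. e \<in> T \<Longrightarrow> \<pi> (snd (ends e)) = \<pi> (fst (ends e))" "(u, v) \<in> (graph_adj T ends)\<^sup>*"
  shows "\<pi> u = \<pi> v"
  using assms(2) by (induction rule: rtrancl_induct) (use assms(1) in \<open>force simp: graph_adj_def\<close>)+

text \<open>Existence of the potential by counting unknowns of a homogeneous linear system.\<close>
lemma tree_potential:
  assumes T: "spanning T"
  obtains \<pi> :: "nat \<Rightarrow> real" where "\<And>e. e \<in> T \<Longrightarrow> \<pi> (snd (ends e)) - \<pi> (fst (ends e)) = \<alpha> e"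
proof -
  obtain r where r: "r \<in> V" using neV by blast
  have fT: "finite T" using T finE finite_subset by (auto simp: spanning_def)
  \<comment> \<open>The unknowns are the potentials \<open>Some v\<close> and a scale
    \<open>None\<close> for the prescribed differences; the equations are one per tree edge and the
    normalisation at r. There is one equation fewer than there are unknowns.\<close>
  define c :: "nat option \<Rightarrow> nat option \<Rightarrow> real" where
    "c v t = (case t of None \<Rightarrow> of_bool (v = Some r)
       | Some e \<Rightarrow> (case v of None \<Rightarrow> - \<alpha> e | Some v \<Rightarrow> of_bool (snd (ends e) = v) - of_bool (fst (ends e) = v)))" for v t
  have "card (insert None (Some ` T)) < card (insert None (Some ` V))"
    using T fT finV by (simp add: spanning_def card_insert_if card_image)
  then obtain l where l: "\<exists>v\<in>insert None (Some ` V). l v \<noteq> 0"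
     "\<forall>t\<in>insert None (Some ` T). (\<Sum>v\<in>insert None (Some ` V). l v * c v t) = 0"
    using homogeneous_system[OF finite.insertI[OF finite_imageI[OF fT]] finite.insertI[OF finite_imageI[OF finV]],
      of None Some None Some c] by blast
  have s: "(\<Sum>v\<in>insert None (Some ` V). l v * c v t) = l None * c None t + (\<Sum>v\<in>V. l (Some v) * c (Some v) t)" for t
    using finV by (simp add: sum.reindex)
  have r0: "l (Some r) = 0"
  proof -
    have "0 = l None * c None None + (\<Sum>v\<in>V. l (Some v) * c (Some v) None)" using l(2) s[of None] by auto
    also have "\<dots> = (\<Sum>v\<in>V. if v = r then l (Some v) else 0)" by (auto simp: c_def intro!: sum.cong)
    also have "\<dots> = l (Some r)" using r finV by simp
    finally show ?thesis by simp
  qed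
  have eT: "l (Some (snd (ends e))) - l (Some (fst (ends e))) = l None * \<alpha> e" if e: "e \<in> T" for e
  proof -
    have eE: "e \<in> E" using e T by (auto simp: spanning_def)
    have pick: "(\<Sum>v\<in>V. l (Some v) * of_bool (w = v)) = l (Some w)" if "w \<in> V" for w
    proof -
      have "(\<Sum>v\<in>V. l (Some v) * of_bool (w = v)) = (\<Sum>v\<in>V. if v = w then l (Some v) else 0)" by (intro sum.cong) auto
      then show ?thesis using that finV by simp
    qed
    have "0 = l None * c None (Some e) + (\<Sum>v\<in>V. l (Some v) * c (Some v) (Some e))" using l(2) s[of "Some e"] e by auto
    then show ?thesis using pick endsV[OF eE] by (simp add: c_def right_diff_distrib sum_subtractf)
  qed
  \<comment> \<open>With scale 0 the potential would be constant on the tree and 0 at r, so the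
    solution would be trivial.\<close>
  have "l None \<noteq> 0"
  proof
    assume 0: "l None = 0"
    have "l (Some v) = 0" if "v \<in> V" for v
    proof -
      have "(\<lambda>v. l (Some v)) r = (\<lambda>v. l (Some v)) v"
        by (rule potential_const[of T]) (use eT 0 T r that in \<open>auto simp: spanning_def\<close>)
      then show ?thesis using r0 by simp
    qed
    then show False using l(1) 0 by auto
  qed
  then show thesis using eT by (intro that[of "\<lambda>v. l (Some v) / l None"]) (simp add: diff_divide_distrib[symmetric])
qed

text \<open>On a tree every labelling is a potential difference, so a cycle supported there is
  orthogonal to itself.\<close>

lemma cycle_in_tree_zero:
  assumes T: "spanning T" and a: "\<alpha> \<in> H1R V E ends" and s: "\<And>e. e \<in> E - T \<Longrightarrow> \<alpha> e = 0"
  shows "\<alpha> e = 0"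
proof -
  obtain \<pi> where pi: "\<And>e. e \<in> T \<Longrightarrow> \<pi> (snd (ends e)) - \<pi> (fst (ends e)) = \<alpha> e" using tree_potential[OF T] by metis
  have "\<alpha> e * (\<pi> (snd (ends e)) - \<pi> (fst (ends e))) = (\<alpha> e)\<^sup>2" if "e \<in> E" for e
    using pi[of e] s[of e] that by (cases "e \<in> T") (auto simp: power2_eq_square)
  then have "(\<Sum>e\<in>E. (\<alpha> e)\<^sup>2) = 0" using H1R_orth[OF a, of \<pi>] by simp
  then have "e \<in> E \<Longrightarrow> \<alpha> e = 0" using finE by (simp add: sum_nonneg_eq_0_iff)
  then show ?thesis using a by (auto simp: H1R_def)
qed

lemma fundamental_cycle:
  assumes T: "spanning T" and e: "e \<in> E - T"
  obtains \<phi> where "\<phi> \<in> H1R V E ends" "\<And>x. \<phi> x \<in> \<int>" "\<And>x. x \<in> E - T \<Longrightarrow> \<phi> x = of_bool (x = e)"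
proof -
  have TE: "T \<subseteq> E" using T by (simp add: spanning_def)
  have "(snd (ends e), fst (ends e)) \<in> (graph_adj T ends)\<^sup>*" using T e endsV by (auto simp: spanning_def)
  then obtain \<psi> where psi: "\<forall>e. e \<notin> T \<longrightarrow> \<psi> e = 0" "\<forall>e. \<psi> e \<in> \<int>"
     "\<forall>w. bdry E ends \<psi> w = of_bool (w = fst (ends e)) - of_bool (w = snd (ends e))" using chain_exists[OF TE] by blast
  let ?\<phi> = "\<lambda>x. 1 * \<psi> x + 1 * (if x = e then 1 else 0)"
  have "bdry E ends ?\<phi> w = 0" for w
    unfolding bdry_lin using psi(3) bdry_unit[of e w] e by (auto simp: eq_commute)
  then have "?\<phi> \<in> H1R V E ends" using psi(1) TE e by (auto simp: H1R_def)
  moreover have "?\<phi> x \<in> \<int>" for x using psi(2) by auto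
  ultimately show thesis using psi(1) by (intro that[of ?\<phi>]) auto
qed

text \<open>A vertex cannot carry exactly one non-integral edge of a cycle, so the non-integral edges
  are at least as many as the vertices they touch.\<close>
lemma nonintegral_support_cycle:
  assumes a: "\<alpha> \<in> H1R V E ends" and e0: "e0 \<in> E" "\<alpha> e0 \<notin> \<int>"
  obtains \<beta> where "\<beta> \<in> H1R V E ends" "\<exists>e. \<beta> e \<noteq> 0" "\<And>e. \<alpha> e \<in> \<int> \<Longrightarrow> \<beta> e = 0"
proof -
  define N where "N = {e\<in>E. \<alpha> e \<notin> \<int>}"
  have finN: "finite N" using finE by (simp add: N_def)
  define U where "U = (\<lambda>e. fst (ends e)) ` N \<union> (\<lambda>e. snd (ends e)) ` N"
  have finU: "finite U" using finN by (simp add: U_def)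
  have UV: "U \<subseteq> V" using endsV by (auto simp: U_def N_def)
  define u0 where "u0 = fst (ends e0)"
  have u0: "u0 \<in> U" using e0 by (auto simp: U_def N_def u0_def)
  let ?H = "\<lambda>v. {e\<in>N. snd (ends e) = v}" and ?L = "\<lambda>v. {e\<in>N. fst (ends e) = v}"
  have deg: "2 \<le> card (?H v) + card (?L v)" if v: "v \<in> U" for v
  proof (rule ccontr)
    assume "\<not> ?thesis"
    moreover have "card (?H v) + card (?L v) \<noteq> 0" using v finN by (auto simp: U_def)
    ultimately have one: "card (?H v) + card (?L v) = 1" by linarith
    have split: "(\<Sum>e\<in>{e\<in>E. h e = v}. \<alpha> e) - (\<Sum>e\<in>{e\<in>N. h e = v}. \<alpha> e) \<in> \<int>" for h
    proof -
      have "(\<Sum>e\<in>{e\<in>E. h e = v}. \<alpha> e) = (\<Sum>e\<in>{e\<in>E. h e = v} - {e\<in>N. h e = v}. \<alpha> e) + (\<Sum>e\<in>{e\<in>N. h e = v}. \<alpha> e)"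
        by (rule sum.subset_diff) (auto simp: N_def finE)
      moreover have "(\<Sum>e\<in>{e\<in>E. h e = v} - {e\<in>N. h e = v}. \<alpha> e) \<in> \<int>" by (intro Ints_sum) (auto simp: N_def)
      ultimately show ?thesis by simp
    qed
    have "bdry E ends \<alpha> v = 0" using a v UV by (auto simp: H1R_def)
    then have "(\<Sum>e\<in>?H v. \<alpha> e) - (\<Sum>e\<in>?L v. \<alpha> e) =
       ((\<Sum>e\<in>{e\<in>E. fst (ends e) = v}. \<alpha> e) - (\<Sum>e\<in>?L v. \<alpha> e)) - ((\<Sum>e\<in>{e\<in>E. snd (ends e) = v}. \<alpha> e) - (\<Sum>e\<in>?H v. \<alpha> e))"
      by (simp add: bdry_def)
    also have "\<dots> \<in> \<int>" by (intro Ints_diff split)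
    finally have int: "(\<Sum>e\<in>?H v. \<alpha> e) - (\<Sum>e\<in>?L v. \<alpha> e) \<in> \<int>" .
    consider "card (?H v) = 1" "card (?L v) = 0" | "card (?H v) = 0" "card (?L v) = 1" using one by linarith
    then show False
    proof cases
      case 1
      then obtain e where H: "?H v = {e}" by (metis card_1_singletonE)
      have L: "?L v = {}" using 1 finN by simp
      have "\<alpha> e \<in> \<int>" using int unfolding H L by simp
      moreover have "e \<in> N" using H by blast
      ultimately      show False by (simp add: N_def)
    next
      case 2
      then obtain e where L: "?L v = {e}" by (metis card_1_singletonE)
      have H: "?H v = {}" using 2 finN by simp
      have "\<alpha> e \<in> \<int>" using int unfolding H L by (simp add: minus_in_Ints_iff)
      moreover have "e \<in> N" using L by blast
      ultimately      show False by (simp add: N_def)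
    qed
  qed
  have cnt: "card N = (\<Sum>v\<in>U. card {e\<in>N. h e = v})" if "h ` N \<subseteq> U" for h
    using sum.group[OF finN finU that, of "\<lambda>_. 1::nat"] by simp
  have "2 * card U = (\<Sum>v\<in>U. 2)" by simp
  also have "\<dots> \<le> (\<Sum>v\<in>U. card (?H v) + card (?L v))" by (intro sum_mono deg)
  also have "\<dots> = 2 * card N"
    using cnt[of "\<lambda>e. snd (ends e)"] cnt[of "\<lambda>e. fst (ends e)"] by (simp add: sum.distrib U_def)
  finally have "card U \<le> card N" by simp
  \<comment> \<open>The equation at \<open>u0\<close> is dropped to have fewer equations than edges;
    it holds anyway, because the boundary values of a chain add up to 0.\<close>
  then have lt: "card (U - {u0}) < card N" using card_Diff1_less[OF finU u0] by linarith
  define c :: "nat \<Rightarrow> nat \<Rightarrow> real" where "c e v = of_bool (snd (ends e) = v) - of_bool (fst (ends e) = v)" for e v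
  obtain l where l: "\<exists>e\<in>N. l e \<noteq> 0" "\<forall>v\<in>U - {u0}. (\<Sum>e\<in>N. l e * c e v) = 0"
    using homogeneous_system[OF finite_Diff[OF finU] finN lt, of c] by blast
  define \<beta> where "\<beta> e = (if e \<in> N then l e else 0)" for e
  have NE: "N \<subseteq> E" by (auto simp: N_def)
  have half: "(\<Sum>e\<in>{e\<in>E. h e = v}. \<beta> e) = (\<Sum>e\<in>N. l e * of_bool (h e = v))" for h :: "nat \<Rightarrow> nat" and v
  proof -
    have "(\<Sum>e\<in>{e\<in>E. h e = v}. \<beta> e) = (\<Sum>e\<in>{e\<in>N. h e = v}. \<beta> e)"
      using NE finE by (intro sum.mono_neutral_right) (auto simp: \<beta>_def)
    also have "\<dots> = (\<Sum>e\<in>N. if h e = v then \<beta> e else 0)" using finN by (simp add: sum.If_cases Int_def)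
    also have "\<dots> = (\<Sum>e\<in>N. l e * of_bool (h e = v))" by (intro sum.cong) (auto simp: \<beta>_def)
    finally show ?thesis .
  qed
  have bd: "bdry E ends \<beta> v = (\<Sum>e\<in>N. l e * c e v)" for v
    unfolding bdry_def half c_def by (simp add: right_diff_distrib sum_subtractf)
  have b1: "bdry E ends \<beta> v = 0" if "v \<noteq> u0" for v
  proof (cases "v \<in> U")
    case True then show ?thesis unfolding bd using l(2) that by blast
  next
    case False
    then show ?thesis unfolding bd by (intro sum.neutral) (auto simp: U_def c_def)
  qed
  have u0V: "u0 \<in> V" using u0 UV by blast
  have "(\<Sum>v\<in>V. 1 * bdry E ends \<beta> v) = (\<Sum>e\<in>E. \<beta> e * (1 - 1))" unfolding bdry_adjoint[of \<beta> "\<lambda>_. 1", symmetric] by simp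
  then have "(\<Sum>v\<in>V. bdry E ends \<beta> v) = 0" by simp
  moreover have "(\<Sum>v\<in>V. bdry E ends \<beta> v) = (\<Sum>v\<in>{u0}. bdry E ends \<beta> v)"
    using u0V finV b1 by (intro sum.mono_neutral_right) auto
  ultimately have "bdry E ends \<beta> u0 = 0" by simp
  then have "bdry E ends \<beta> v = 0" for v using b1 by (cases "v = u0") auto
  then have "\<beta> \<in> H1R V E ends" using NE by (auto simp: H1R_def \<beta>_def)
  moreover have "\<exists>e. \<beta> e \<noteq> 0" using l(1) by (auto simp: \<beta>_def)
  ultimately show thesis by (rule that) (auto simp: \<beta>_def N_def)
qed

text \<open>The potential at v pairs c with a chain from r to v. An edge together with the chains to
  its two ends forms an integral cycle, on which c vanishes by hypothesis.\<close>

lemma orth_potential: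
  assumes c: "\<And>\<alpha>. \<alpha> \<in> H1R V E ends \<Longrightarrow> (\<And>e. \<alpha> e \<in> \<int>) \<Longrightarrow> (\<Sum>e\<in>E. c e * \<alpha> e) = 0"
  obtains \<pi> :: "nat \<Rightarrow> real" where "\<And>e. e \<in> E \<Longrightarrow> c e = \<pi> (snd (ends e)) - \<pi> (fst (ends e))"
proof -
  obtain r where r: "r \<in> V" using neV by blast
  have "\<exists>\<psi>. (\<forall>e. e \<notin> E \<longrightarrow> \<psi> e = 0) \<and> (\<forall>e. \<psi> e \<in> \<int>) \<and> (\<forall>w. bdry E ends \<psi> w = of_bool (w = v) - of_bool (w = r))" if "v \<in> V" for v
    using chain_exists[of E r v] conn r that by (simp add: graph_connected_def)
  then obtain \<psi> where psi: "\<And>v. v \<in> V \<Longrightarrow> (\<forall>e. e \<notin> E \<longrightarrow> \<psi> v e = 0) \<and> (\<forall>e. \<psi> v e \<in> \<int>) \<and> (\<forall>w. bdry E ends (\<psi> v) w = of_bool (w = v) - of_bool (w = r))"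
    by metis
  define \<pi> where "\<pi> v = (\<Sum>e\<in>E. c e * \<psi> v e)" for v
  have "c e = \<pi> (snd (ends e)) - \<pi> (fst (ends e))" if e: "e \<in> E" for e
  proof -
    let ?u = "fst (ends e)" and ?v = "snd (ends e)"
    let ?\<phi> = "\<lambda>x. 1 * (1 * \<psi> ?u x + (-1) * \<psi> ?v x) + 1 * (if x = e then 1 else 0)"
    have uv: "?u \<in> V" "?v \<in> V" using endsV[OF e] by auto
    have bp: "bdry E ends (\<psi> v) w = of_bool (w = v) - of_bool (w = r)" if "v \<in> V" for v w
      using psi[OF that] by blast
    have "bdry E ends ?\<phi> w = 0" for w
      unfolding bdry_lin bdry_unit[OF e] bp[OF uv(1)] bp[OF uv(2)] by (simp add: of_bool_def)
    moreover have "\<psi> v x = 0" if "v \<in> V" "x \<notin> E" for v x using psi[OF that(1)] that(2) by blast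
    then have "?\<phi> x = 0" if "x \<notin> E" for x using uv that e by auto
    ultimately have "?\<phi> \<in> H1R V E ends" by (simp only: H1R_def mem_Collect_eq, blast)
    moreover have "\<psi> v x \<in> \<int>" if "v \<in> V" for v x using psi[OF that] by blast
    then have "?\<phi> x \<in> \<int>" for x using uv by (intro Ints_add Ints_mult) auto
    ultimately have "(\<Sum>x\<in>E. c x * ?\<phi> x) = 0" by (rule c)
    moreover have "(\<Sum>x\<in>E. c x * ?\<phi> x) = \<pi> ?u - \<pi> ?v + (\<Sum>x\<in>E. if x = e then c x else 0)"
      unfolding \<pi>_def sum_subtractf[symmetric] sum.distrib[symmetric] by (intro sum.cong) (auto simp: algebra_simps)
    ultimately show ?thesis using e finE by simp
  qed
  then show thesis by (rule that)
qed

text \<open>A sublevel set of the potential, taken at the lower end of \<open>e0\<close>: every edge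
  leaving it has a strictly larger potential at its outer end.\<close>

lemma potential_cut:
  assumes c: "\<And>e. e \<in> E \<Longrightarrow> c e = \<pi> (snd (ends e)) - \<pi> (fst (ends e))" and nz: "e0 \<in> E" "c e0 \<noteq> (0::real)"
  obtains S where "S \<subseteq> V" "graph_cut E ends S \<noteq> {}" "\<And>e. e \<in> graph_cut E ends S \<Longrightarrow> c e \<noteq> 0"
proof -
  define t where "t = min (\<pi> (snd (ends e0))) (\<pi> (fst (ends e0)))"
  define S where "S = {v\<in>V. \<pi> v \<le> t}"
  have "e0 \<in> graph_cut E ends S" using nz c[OF nz(1)] endsV[OF nz(1)] by (auto simp: graph_cut_def S_def t_def)
  moreover have "c e \<noteq> 0" if "e \<in> graph_cut E ends S" for e
    using that c[of e] endsV[of e] by (auto simp: graph_cut_def S_def)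
  ultimately show thesis by (intro that[of S]) (auto simp: S_def)
qed

lemma cut_potential:
  "e \<in> E \<Longrightarrow> (of_bool (snd (ends e) \<in> S) - of_bool (fst (ends e) \<in> S) \<noteq> (0::real)) \<longleftrightarrow> e \<in> graph_cut E ends S"
  by (auto simp: graph_cut_def)

lemma cut_meets_tree:
  assumes T: "spanning T" and S: "graph_cut E ends S \<noteq> {}" "S \<subseteq> V"
  shows "graph_cut E ends S \<inter> T \<noteq> {}"
proof -
  obtain e where e: "e \<in> E" "(fst (ends e) \<in> S) \<noteq> (snd (ends e) \<in> S)" using S(1) by (auto simp: graph_cut_def)
  obtain u v where uv: "u \<in> V" "v \<in> V" "u \<in> S" "v \<notin> S" using e endsV[OF e(1)] by blast
  then have "(u, v) \<in> (graph_adj T ends)\<^sup>*" using T by (simp add: spanning_def)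
  then obtain x y where xy: "(x, y) \<in> graph_adj T ends" "x \<in> S" "y \<notin> S" using uv rtrancl_leaves by metis
  then obtain d where "d \<in> T" "ends d = (x, y) \<or> ends d = (y, x)" by (auto simp: graph_adj_def)
  then show ?thesis using xy T by (auto simp: graph_cut_def spanning_def)
qed

lemma card_cotree: "spanning T \<Longrightarrow> card (E - T) = betti1 V E"
  using finE by (auto simp: spanning_def betti1_def card_Diff_subset finite_subset)

end

section \<open>Gram matrices of the length form and change of lattice basis\<close>

definition edge_form :: "nat set \<Rightarrow> (nat \<Rightarrow> real) \<Rightarrow> (nat \<Rightarrow> real^'g) \<Rightarrow> real^'g^'g" where
  "edge_form E l a = (\<Sum>e\<in>E. l e *\<^sub>R (\<chi> r s. a e $ r * a e $ s))"

lemma edge_form_nth: "edge_form E l a $ r $ s = (\<Sum>e\<in>E. l e * (a e $ r * a e $ s))"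
  by (simp add: edge_form_def)

lemma gl_act_outer: "gl_act M (\<chi> r s. u $ r * u $ s) = (\<chi> r s. (M *v u) $ r * (M *v u) $ s)"
  for u :: "real^'g::finite"
proof -
  have "(\<Sum>j\<in>UNIV. M $ i $ j * (u $ j * u $ k)) = (M *v u) $ i * u $ k" for i k
    by (simp add: matrix_vector_mult_def sum_distrib_right mult.assoc)
  then have "gl_act M (\<chi> r s. u $ r * u $ s) $ i $ l = (\<Sum>k\<in>UNIV. ((M *v u) $ i * u $ k) * M $ l $ k)" for i l
    by (simp add: gl_act_def matrix_matrix_mult_def transpose_def)
  also have "(\<Sum>k\<in>UNIV. ((M *v u) $ i * u $ k) * M $ l $ k) = (M *v u) $ i * (M *v u) $ l" for i l
    by (simp add: matrix_vector_mult_def[of M u] sum_distrib_left mult_ac)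
  finally show ?thesis by (simp add: vec_eq_iff)
qed

lemma gl_act_lin: "gl_act M (A + c *\<^sub>R B) = gl_act M A + c *\<^sub>R gl_act M B" for M :: "real^'g^'g::finite"
  by (simp add: gl_act_def matrix_add_ldistrib matrix_scalar_ac scalar_matrix_assoc vec_eq_iff
      matrix_matrix_mult_def sum.distrib sum_distrib_left sum_distrib_right distrib_left distrib_right mult_ac)

lemma gl_act_edge_form:
  fixes M :: "real^'g^'g::finite"
  assumes "finite E"
  shows "gl_act M (edge_form E l a) = edge_form E l (\<lambda>e. M *v a e)"
  using assms
proof (induction E rule: finite_induct)
  case empty
  then show ?case by (simp add: edge_form_def gl_act_def vec_eq_iff matrix_matrix_mult_def)
next
  case (insert e E)
  have step: "edge_form (insert e E) l b = edge_form E l b + l e *\<^sub>R (\<chi> r s. b e $ r * b e $ s)" for b :: "nat \<Rightarrow> real^'g"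
    using insert.hyps by (simp add: edge_form_def add.commute)
  show ?case unfolding step gl_act_lin gl_act_outer insert.IH ..
qed

definition lc :: "('g::finite \<Rightarrow> int) \<Rightarrow> ('g \<Rightarrow> nat \<Rightarrow> int) \<Rightarrow> nat \<Rightarrow> int" where
  "lc x c = (\<lambda>e. \<Sum>i\<in>UNIV. x i * c i e)"

lemma lc_unit: "lc (\<lambda>j. if j = i then 1 else 0) c = c i"
proof
  fix e
  have "lc (\<lambda>j. if j = i then 1 else 0) c e = (\<Sum>j\<in>UNIV. if j = i then c j e else 0)"
    unfolding lc_def by (rule sum.cong) auto
  then show "lc (\<lambda>j. if j = i then 1 else 0) c e = c i e" by simp
qed

lemma lc_lc: "lc (\<lambda>k. \<Sum>j\<in>UNIV. x j * m j k) c = lc x (\<lambda>j. lc (m j) c)"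
  unfolding lc_def sum_distrib_left sum_distrib_right by (subst sum.swap) (simp add: mult.assoc)

definition ivec :: "('g::finite \<Rightarrow> int) \<Rightarrow> real^'g" where
  "ivec x = (\<chi> i. of_int (x i))"

lemma ivec_Zlat: "ivec x \<in> Zlat"
  by (simp add: ivec_def Zlat_def)

lemma ivec_inj: "ivec x = ivec y \<Longrightarrow> x = y"
  by (auto simp: ivec_def vec_eq_iff fun_eq_iff)

lemma Zlat_ivec: assumes "v \<in> Zlat" obtains x where "v = ivec x"
proof -
  have "v = ivec (\<lambda>i. \<lfloor>v $ i\<rfloor>)" using assms by (simp add: ivec_def vec_eq_iff Zlat_def)
  then show thesis by (rule that)
qed

lemma H1Z_lc:
  assumes "\<And>i. \<gamma> i \<in> H1Z V E ends" shows "lc x \<gamma> \<in> H1Z V E ends"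
proof -
  have "(\<lambda>e. \<Sum>i\<in>UNIV. of_int (x i) * of_int (\<gamma> i e)) \<in> H1R V E ends"
    by (rule H1R_sum[where \<alpha> = "\<lambda>i e. of_int (\<gamma> i e)"]) (use assms in \<open>simp_all add: H1Z_H1R\<close>)
  then show ?thesis unfolding H1Z_H1R lc_def by simp
qed

lemma jac_rep_lc:
  fixes Q :: "real^'g^'g::finite"
  shows "jac_rep V E ends w l Q \<longleftrightarrow> (\<exists>\<gamma> \<delta>.
    bij_betw (\<lambda>x::'g \<Rightarrow> int. (lc x \<gamma>, lc x \<delta>)) UNIV (H1Z V E ends \<times> {f. \<forall>k. k \<ge> (\<Sum>v\<in>V. w v) \<longrightarrow> f k = 0})
    \<and> (\<forall>i j. Q $ i $ j = (\<Sum>e\<in>E. l e * of_int (\<gamma> i e) * of_int (\<gamma> j e))))"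
  unfolding jac_rep_def lc_def ..

text \<open>Two bases of the same lattice differ by an integral unimodular matrix.\<close>
lemma torelli_cell_orbit:
  fixes \<gamma>0 \<delta>0 :: "'g::finite \<Rightarrow> nat \<Rightarrow> int"
  assumes finE: "finite E"
    and bij0: "bij_betw (\<lambda>x. (lc x \<gamma>0, lc x \<delta>0)) UNIV (H1Z V E ends \<times> {f. \<forall>k. k \<ge> (\<Sum>v\<in>V. w v) \<longrightarrow> f k = 0})"
    and a: "\<And>e i. a e $ i = of_int (\<gamma>0 i e)"
  shows "torelli_cell V E ends w = gl_sat {edge_form E l a | l. \<forall>e\<in>E. l e > 0}"
proof (intro set_eqI iffI)
  let ?T = "H1Z V E ends \<times> {f. \<forall>k. k \<ge> (\<Sum>v\<in>V. w v) \<longrightarrow> f k = (0::int)}"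
  fix Q :: "real^'g^'g" assume "Q \<in> torelli_cell V E ends w"
  then obtain l where l: "\<forall>e\<in>E. l e > 0" and jac: "jac_rep V E ends w l Q"
    unfolding torelli_cell_def by blast
  obtain \<gamma> \<delta> where bij: "bij_betw (\<lambda>x. (lc x \<gamma>, lc x \<delta>)) UNIV ?T"
    and Q: "\<forall>i j. Q $ i $ j = (\<Sum>e\<in>E. l e * of_int (\<gamma> i e) * of_int (\<gamma> j e))"
    using jac unfolding jac_rep_lc by (elim exE conjE)
  have ex: "\<exists>m. \<forall>i. (lc (m i) \<gamma>1, lc (m i) \<delta>1) = (\<gamma>2 i, \<delta>2 i)"
    if b1: "bij_betw (\<lambda>x. (lc x \<gamma>1, lc x \<delta>1)) UNIV ?T" and b2: "bij_betw (\<lambda>x. (lc x \<gamma>2, lc x \<delta>2)) UNIV ?T" for \<gamma>1 \<delta>1 \<gamma>2 \<delta>2 :: "'g \<Rightarrow> nat \<Rightarrow> int"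
  proof (rule choice, rule allI)
    fix i
    have "(\<gamma>2 i, \<delta>2 i) \<in> ?T"
      using bij_betwE[OF b2, rule_format, of "\<lambda>j. if j = i then 1 else 0"] unfolding lc_unit by simp
    then have "(\<gamma>2 i, \<delta>2 i) \<in> range (\<lambda>x. (lc x \<gamma>1, lc x \<delta>1))"
      unfolding bij_betw_imp_surj_on[OF b1] .
    then obtain m where "(\<gamma>2 i, \<delta>2 i) = (lc m \<gamma>1, lc m \<delta>1)" by (rule imageE)
    then show "\<exists>m. (lc m \<gamma>1, lc m \<delta>1) = (\<gamma>2 i, \<delta>2 i)" by (intro exI[of _ m]) (rule sym)
  qed
  obtain m where m: "\<And>i. lc (m i) \<gamma>0 = \<gamma> i \<and> lc (m i) \<delta>0 = \<delta> i" using ex[OF bij0 bij] by auto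
  obtain m' where m': "\<And>i. lc (m' i) \<gamma> = \<gamma>0 i \<and> lc (m' i) \<delta> = \<delta>0 i" using ex[OF bij bij0] by auto
  \<comment> \<open>Expanding one basis in the other and back is the identity by uniqueness of
    coordinates. The weight components are carried along because the cycle components alone need not
    be independent.\<close>
  have prod: "(\<lambda>k. \<Sum>j\<in>UNIV. m' i j * m j k) = (\<lambda>k. if k = i then 1 else 0)" for i
  proof (rule injD[OF bij_betw_imp_inj_on[OF bij0]])
    show "(lc (\<lambda>k. \<Sum>j\<in>UNIV. m' i j * m j k) \<gamma>0, lc (\<lambda>k. \<Sum>j\<in>UNIV. m' i j * m j k) \<delta>0)
        = (lc (\<lambda>k. if k = i then 1 else 0) \<gamma>0, lc (\<lambda>k. if k = i then 1 else 0) \<delta>0)"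
      unfolding lc_lc lc_unit using m m' by simp
  qed
  define M :: "real^'g^'g" where "M = (\<chi> i j. of_int (m i j))"
  define M' :: "real^'g^'g" where "M' = (\<chi> i j. of_int (m' i j))"
  have MM: "M' ** M = mat 1"
  proof -
    have "(M' ** M) $ i $ k = (mat 1 :: real^'g^'g) $ i $ k" for i k
    proof -
      have "(M' ** M) $ i $ k = of_int (\<Sum>j\<in>UNIV. m' i j * m j k)"
        by (simp add: M_def M'_def matrix_matrix_mult_def)
      also have "\<dots> = of_int (if k = i then 1 else 0)" using fun_cong[OF prod[of i], of k] by simp
      finally show ?thesis by (simp add: mat_def eq_commute)
    qed
    then show ?thesis by (simp add: vec_eq_iff)
  qed
  have MG: "M \<in> GLZ"
  proof (rule GLZ_I)
    show "M $ i $ j \<in> \<int>" for i j by (simp add: M_def)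
    show "x \<in> Zlat" if "M *v x \<in> Zlat" for x
    proof -
      have "M' *v (M *v x) \<in> Zlat" by (rule Zlat_mult[OF _ that]) (simp add: M'_def)
      then show ?thesis unfolding matrix_vector_mul_assoc MM matrix_vector_mul_lid .
    qed
  qed
  have Ma: "(M *v a e) $ i = of_int (\<gamma> i e)" for e i
  proof -
    have "(M *v a e) $ i = of_int (lc (m i) \<gamma>0 e)" by (simp add: matrix_vector_mult_def M_def a lc_def)
    then show ?thesis using m by simp
  qed
  have "Q = gl_act M (edge_form E l a)"
    unfolding gl_act_edge_form[OF finE] by (simp add: vec_eq_iff edge_form_nth Ma Q mult.assoc)
  then have "gl_act (matrix_inv M) Q = edge_form E l a"
    by (simp only: gl_act_gl_act GLZ_inv_mult[OF MG] gl_act_id)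
  then show "Q \<in> gl_sat {edge_form E l a | l. \<forall>e\<in>E. l e > 0}"
    using l GLZ_inv[OF MG] unfolding gl_sat_def by blast
next
  fix Q assume "Q \<in> gl_sat {edge_form E l a | l. \<forall>e\<in>E. l e > 0}"
  then obtain h l where h: "h \<in> GLZ" "gl_act h Q = edge_form E l a" "\<forall>e\<in>E. l e > 0"
    unfolding gl_sat_def by blast
  define k where "k = matrix_inv h"
  have kG: "k \<in> GLZ" unfolding k_def by (rule GLZ_inv[OF h(1)])
  have tG: "transpose k \<in> GLZ" by (rule GLZ_transpose[OF kG])
  have "gl_act k (gl_act h Q) = Q" by (simp only: k_def gl_act_gl_act GLZ_inv_mult[OF h(1)] gl_act_id)
  then have Q: "Q = edge_form E l (\<lambda>e. k *v a e)" using h(2) gl_act_edge_form[OF finE] by metis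
  define K where "K i j = \<lfloor>k $ i $ j\<rfloor>" for i j
  have K: "of_int (K i j) = k $ i $ j" for i j using GLZ_entry[OF kG, of i j] by (simp add: K_def)
  \<comment> \<open>The basis changes by k, so coordinate vectors change by its transpose.\<close>
  define y where "y x = (\<lambda>j. \<Sum>i\<in>UNIV. x i * K i j)" for x :: "'g \<Rightarrow> int"
  have y: "ivec (y x) = transpose k *v ivec x" for x
    by (simp add: vec_eq_iff ivec_def y_def matrix_vector_mult_def transpose_def K mult.commute)
  have bijy: "bij y"
  proof (rule bijI)
    show "inj y"
    proof (rule injI)
      fix x x' assume "y x = y x'"
      then have "transpose k *v ivec x = transpose k *v ivec x'" using y by metis
      then show "x = x'" using GLZ_cancel[OF tG] ivec_inj by blast
    qed
    show "surj y"
    proof -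
      have "\<exists>x. y x = z" for z
      proof -
      obtain v where v: "transpose k *v v = ivec z" using GLZ_surj[OF tG] by blast
      then have "v \<in> Zlat" using GLZ_solve[OF tG] ivec_Zlat by metis
      then obtain x where "v = ivec x" by (rule Zlat_ivec)
      then have "ivec (y x) = ivec z" using v y by simp
      then show ?thesis using ivec_inj by blast
      qed
      then show ?thesis unfolding surj_def by metis
    qed
  qed
  define \<gamma> where "\<gamma> i = lc (K i) \<gamma>0" for i
  define \<delta> where "\<delta> i = lc (K i) \<delta>0" for i
  have "(\<lambda>x. (lc x \<gamma>0, lc x \<delta>0)) \<circ> y = (\<lambda>x. (lc x \<gamma>, lc x \<delta>))"
    by (rule ext) (simp add: y_def lc_lc \<gamma>_def[abs_def] \<delta>_def[abs_def])
  then have "bij_betw (\<lambda>x. (lc x \<gamma>, lc x \<delta>)) UNIV (H1Z V E ends \<times> {f. \<forall>k. k \<ge> (\<Sum>v\<in>V. w v) \<longrightarrow> f k = 0})"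
    using bij_betw_trans[OF bijy bij0] by simp
  moreover have "(k *v a e) $ i = of_int (\<gamma> i e)" for e i
    by (simp add: \<gamma>_def lc_def matrix_vector_mult_def K a)
  then have "\<forall>i j. Q $ i $ j = (\<Sum>e\<in>E. l e * of_int (\<gamma> i e) * of_int (\<gamma> j e))"
    by (simp add: Q edge_form_nth mult.assoc)
  ultimately have "jac_rep V E ends w l Q" unfolding jac_rep_lc by blast
  then show "Q \<in> torelli_cell V E ends w" using h(3) unfolding torelli_cell_def by blast
qed

context conn_graph begin

text \<open>The coordinates outside the chosen rows provide the lattice summand from the vertex
  weights.\<close>
lemma jacobian_basis:
  fixes b :: "nat \<Rightarrow> real^'g::finite"
  assumes T: "spanning T" and rho: "bij_betw \<rho> R (E - T)" and G: "rowmix R (\<lambda>j. b (\<rho> j)) \<in> GLZ"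
    and gam: "\<And>i e. of_int (\<gamma> i e) = \<epsilon> e * b e $ i" and eps: "\<And>e. \<epsilon> e = 1 \<or> \<epsilon> e = (-1::real)"
    and H: "\<And>i. \<gamma> i \<in> H1Z V E ends" and W: "card (- R) = W"
  shows "\<exists>\<delta>. bij_betw (\<lambda>x::'g \<Rightarrow> int. (lc x \<gamma>, lc x \<delta>)) UNIV (H1Z V E ends \<times> {f. \<forall>k. k \<ge> W \<longrightarrow> f k = 0})"
proof -
  let ?B = "rowmix R (\<lambda>j. b (\<rho> j))"
  have "finite (- R)" by simp
  then obtain idx where idx: "bij_betw idx (- R) {..<W}"
    using ex_bij_betw_finite_nat[of "- R"] W by (auto simp: atLeast0LessThan)
  define \<delta> where "\<delta> i k = (if i \<notin> R \<and> idx i = k then 1 else 0 :: int)" for i k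
  have d1: "lc x \<delta> (idx i) = x i" if i: "i \<notin> R" for x i
  proof -
    have "lc x \<delta> (idx i) = (\<Sum>j\<in>UNIV. if j = i then x j else 0)"
      unfolding lc_def using i inj_onD[OF bij_betw_imp_inj_on[OF idx]] by (intro sum.cong) (auto simp: \<delta>_def)
    then show ?thesis by simp
  qed
  have d2: "lc x \<delta> k = 0" if "k \<ge> W" for x k
  proof -
    have "idx i < W" if "i \<notin> R" for i using bij_betwE[OF idx] that by blast
    then have "\<delta> i k = 0" for i using that by (fastforce simp: \<delta>_def)
    then show ?thesis by (simp add: lc_def)
  qed
  have g1: "of_int (lc x \<gamma> e) = \<epsilon> e * (b e \<bullet> ivec x)" for x e
    by (simp add: lc_def gam inner_vec_def ivec_def sum_distrib_left mult_ac)
  \<comment> \<open>The unimodular matrix reads off, up to signs, the values of the cycle on the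
    cotree edges together with the weight coordinates.\<close>
  have Bx: "(?B *v ivec x) $ j = (if j \<in> R then \<epsilon> (\<rho> j) * of_int (lc x \<gamma> (\<rho> j)) else of_int (lc x \<delta> (idx j)))" for x j
    using eps[of "\<rho> j"] by (auto simp: rowmix_mult g1 d1 ivec_def)
  have "bij_betw (\<lambda>x::'g \<Rightarrow> int. (lc x \<gamma>, lc x \<delta>)) UNIV (H1Z V E ends \<times> {f. \<forall>k. k \<ge> W \<longrightarrow> f k = 0})"
  proof (rule bij_betw_imageI)
    show "inj (\<lambda>x::'g \<Rightarrow> int. (lc x \<gamma>, lc x \<delta>))"
    proof (rule injI)
      fix x y assume "(lc x \<gamma>, lc x \<delta>) = (lc y \<gamma>, lc y \<delta>)"
      then have "?B *v ivec x = ?B *v ivec y" by (simp add: vec_eq_iff Bx)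
      then show "x = y" using GLZ_cancel[OF G] ivec_inj by blast
    qed
    show "range (\<lambda>x::'g \<Rightarrow> int. (lc x \<gamma>, lc x \<delta>)) = H1Z V E ends \<times> {f. \<forall>k. k \<ge> W \<longrightarrow> f k = 0}"
    proof (intro set_eqI iffI)
      fix p assume "p \<in> range (\<lambda>x::'g \<Rightarrow> int. (lc x \<gamma>, lc x \<delta>))"
      then show "p \<in> H1Z V E ends \<times> {f. \<forall>k. k \<ge> W \<longrightarrow> f k = 0}" using H1Z_lc[OF H] d2 by auto
    next
      fix p assume "p \<in> H1Z V E ends \<times> {f. \<forall>k. k \<ge> W \<longrightarrow> f k = (0::int)}"
      then obtain \<beta> f where p: "p = (\<beta>, f)" "\<beta> \<in> H1Z V E ends" "\<And>k. k \<ge> W \<Longrightarrow> f k = 0" by auto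
      obtain v where v: "?B *v v = (\<chi> j. if j \<in> R then \<epsilon> (\<rho> j) * of_int (\<beta> (\<rho> j)) else of_int (f (idx j)))"
        using GLZ_surj[OF G] by blast
      have "\<epsilon> e \<in> \<int>" for e using eps[of e] by auto
      then have "(\<chi> j. if j \<in> R then \<epsilon> (\<rho> j) * of_int (\<beta> (\<rho> j)) else of_int (f (idx j))) \<in> Zlat"
        by (auto simp: Zlat_def intro: Ints_mult)
      then have "v \<in> Zlat" using GLZ_solve[OF G] v by metis
      then obtain x where x: "v = ivec x" by (rule Zlat_ivec)
      have Bj: "(?B *v ivec x) $ j = (if j \<in> R then \<epsilon> (\<rho> j) * of_int (\<beta> (\<rho> j)) else of_int (f (idx j)))" for j
        using v x by simp
      have "lc x \<delta> k = f k" for k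
      proof (cases "k < W")
        case True
        then obtain j where j: "j \<notin> R" "k = idx j" using bij_betw_imp_surj_on[OF idx] by (metis ComplD imageE lessThan_iff)
        then show ?thesis using Bj[of j] Bx[of x j] by simp
      next
        case False
        then show ?thesis using d2 p(3) by simp
      qed
      then have ld: "lc x \<delta> = f" by blast
      \<comment> \<open>A cycle is determined by its values on the cotree, and x was chosen to match
        \<beta> there.\<close>
      define \<alpha> where "\<alpha> e = (1::real) * of_int (lc x \<gamma> e) + (-1) * of_int (\<beta> e)" for e
      have aH: "\<alpha> \<in> H1R V E ends"
        unfolding \<alpha>_def using H1Z_lc[OF H, of x] p(2) unfolding H1Z_H1R by (rule H1R_lin)
      have a0: "\<alpha> e = 0" if "e \<in> E - T" for e
      proof -
        have "e \<in> \<rho> ` R" using that unfolding bij_betw_imp_surj_on[OF rho] .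
        then obtain j where j: "j \<in> R" "e = \<rho> j" by blast
        have "\<epsilon> e * of_int (lc x \<gamma> e) = \<epsilon> e * of_int (\<beta> e)" using Bj[of j] Bx[of x j] j by simp
        then show ?thesis using eps[of e] by (auto simp: \<alpha>_def)
      qed
      have "\<alpha> e = 0" for e by (rule cycle_in_tree_zero[OF T aH a0])
      then have "lc x \<gamma> e = \<beta> e" for e by (simp add: \<alpha>_def)
      then have "lc x \<gamma> = \<beta>" by blast
      then show "p \<in> range (\<lambda>x::'g \<Rightarrow> int. (lc x \<gamma>, lc x \<delta>))" using p(1) ld by blast
    qed
  qed
  then show ?thesis by blast
qed

end

section \<open>From combinatorial types to cographic systems\<close>

text \<open>Circuits and bonds are the minimal members of two families of sets, so it suffices to
  compare dependence with containing a nonempty cut.\<close>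

lemma circuits_eq_bonds:
  assumes f: "bij_betw f {..<n} E"
    and dep: "\<And>C. C \<subseteq> {..<n} \<Longrightarrow> col_dependent a C \<longleftrightarrow> (\<exists>B. B \<noteq> {} \<and> is_cut V E ends B \<and> B \<subseteq> f ` C)"
  shows "(`) f ` col_circuits n a = bonds V E ends"
proof (intro set_eqI iffI)
  have inj: "inj_on f {..<n}" and im: "f ` {..<n} = E" using f by (auto simp: bij_betw_def)
  fix B assume "B \<in> (`) f ` col_circuits n a"
  then obtain C where C: "B = f ` C" "C \<subseteq> {..<n}" "C \<noteq> {}" "col_dependent a C" "\<And>D. D \<subset> C \<Longrightarrow> \<not> col_dependent a D"
    unfolding col_circuits_def by auto
  have min: "B' = B" if B': "B' \<noteq> {}" "is_cut V E ends B'" "B' \<subseteq> B" for B'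
  proof -
    define D where "D = {i\<in>C. f i \<in> B'}"
    have fD: "f ` D = B'" using B'(3) C(1) by (auto simp: D_def)
    have "col_dependent a D" using dep[of D] B' fD C(2) by (auto simp: D_def)
    then have "D = C" using C(5)[of D] by (auto simp: D_def)
    then show ?thesis using fD C(1) by simp
  qed
  obtain B' where "B' \<noteq> {}" "is_cut V E ends B'" "B' \<subseteq> B" using dep[OF C(2)] C(1,4) by auto
  then have "is_cut V E ends B" using min by metis
  moreover have "B \<noteq> {}" using C(1,3) by blast
  moreover have "\<not> B' \<subset> B" if "B' \<noteq> {} \<and> is_cut V E ends B'" for B' using min[of B'] that by blast
  ultimately show "B \<in> bonds V E ends"
    unfolding bonds_def mem_Collect_eq by (intro conjI allI impI) assumption+
next
  have inj: "inj_on f {..<n}" and im: "f ` {..<n} = E" using f by (auto simp: bij_betw_def)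
  fix B assume "B \<in> bonds V E ends"
  then have B: "B \<noteq> {}" "is_cut V E ends B" "\<And>B'. B' \<noteq> {} \<Longrightarrow> is_cut V E ends B' \<Longrightarrow> \<not> B' \<subset> B" by (auto simp: bonds_def)
  have BE: "B \<subseteq> E" using B(2) by (auto simp: is_cut_def graph_cut_def)
  define C where "C = {i\<in>{..<n}. f i \<in> B}"
  have fC: "f ` C = B" using BE im by (auto simp: C_def)
  have CE: "C \<subseteq> {..<n}" by (auto simp: C_def)
  have "col_dependent a C" unfolding dep[OF CE] fC using B(1,2) by blast
  moreover have "\<not> col_dependent a D" if D: "D \<subset> C" for D
  proof
    assume "col_dependent a D"
    moreover have "D \<subseteq> {..<n}" using D CE by blast
    ultimately obtain B' where B': "B' \<noteq> {}" "is_cut V E ends B'" "B' \<subseteq> f ` D" using dep[of D] by blast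
    have "f ` D \<noteq> f ` C" using inj_on_image_eq_iff[OF inj, of D C] D CE by blast
    then have "f ` D \<subset> f ` C" using D by blast
    then show False using B(3)[OF B'(1,2)] B'(3) fC by blast
  qed
  ultimately have "C \<in> col_circuits n a" using CE B(1) fC by (auto simp: col_circuits_def)
  then show "B \<in> (`) f ` col_circuits n a" using fC by blast
qed

lemma is_cut_finite: "fin_graph V E ends \<Longrightarrow> is_cut V E ends B \<Longrightarrow> finite B"
  unfolding fin_graph_def is_cut_def graph_cut_def by auto

lemma bond_in_cut:
  assumes "finite B" "B \<noteq> {}" "is_cut V E ends B"
  shows "\<exists>B'\<in>bonds V E ends. B' \<subseteq> B"
  using assms
proof (induction B rule: finite_psubset_induct)
  case (psubset B)
  show ?case
  proof (cases "B \<in> bonds V E ends")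
    case False
    then obtain B' where "B' \<noteq> {}" "is_cut V E ends B'" "B' \<subset> B" using psubset.prems by (auto simp: bonds_def)
    then show ?thesis using psubset.IH[of B'] by blast
  qed blast
qed

lemma bonds_eq_cut_eq:
  assumes "\<And>B. is_cut V E ends B \<longleftrightarrow> is_cut V' E' ends' B"
  shows "bonds V E ends = bonds V' E' ends'"
  using assms by (simp add: bonds_def)

text \<open>The new vertices are the components of the graph on the contracted edges.\<close>
lemma contraction:
  assumes fin: "fin_graph V E ends" and E': "E' \<subseteq> E"
  obtains V' ends' where "fin_graph V' E' ends'"
    "\<And>B. is_cut V' E' ends' B \<longleftrightarrow> is_cut V E ends B \<and> B \<subseteq> E'"
proof -
  define r where "r = (graph_adj (E - E') ends)\<^sup>*"
  have symr: "sym r" unfolding r_def by (intro sym_rtrancl) (auto simp: sym_def graph_adj_def)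
  have transr: "trans r" unfolding r_def by (rule trans_rtrancl)
  define q where "q v = (LEAST u. (v, u) \<in> r)" for v
  have vq: "(v, q v) \<in> r" for v
    unfolding q_def by (rule LeastI[of _ v]) (simp add: r_def)
  have q_eq: "q u = q v \<longleftrightarrow> (u, v) \<in> r" for u v
  proof
    assume "q u = q v"
    then show "(u, v) \<in> r" using vq[of u] vq[of v] symr transr by (metis symD transD)
  next
    assume "(u, v) \<in> r"
    then have "(u, w) \<in> r \<longleftrightarrow> (v, w) \<in> r" for w using symr transr by (meson symD transD)
    then show "q u = q v" by (simp add: q_def)
  qed
  define ends' where "ends' e = (q (fst (ends e)), q (snd (ends e)))" for e
  have V: "fst (ends e) \<in> V" "snd (ends e) \<in> V" if "e \<in> E" for e using fin that by (auto simp: fin_graph_def)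
  have "fin_graph (q ` V) E' ends'"
    using fin E' V finite_subset[OF E'] by (auto simp: fin_graph_def ends'_def)
  moreover have "is_cut (q ` V) E' ends' B \<longleftrightarrow> is_cut V E ends B \<and> B \<subseteq> E'" for B
  proof
    assume "is_cut (q ` V) E' ends' B"
    then obtain S' where S': "B = graph_cut E' ends' S'" by (auto simp: is_cut_def)
    define S where "S = {v\<in>V. q v \<in> S'}"
    have "graph_cut E ends S = B"
    proof (intro set_eqI iffI)
      fix e assume "e \<in> graph_cut E ends S"
      then have e: "e \<in> E" "(q (fst (ends e)) \<in> S') \<noteq> (q (snd (ends e)) \<in> S')"
        using V by (auto simp: graph_cut_def S_def)
      have "e \<in> E'"
      proof (rule ccontr)
        assume "e \<notin> E'"
        then have "(fst (ends e), snd (ends e)) \<in> graph_adj (E - E') ends" using e(1) by (force simp: graph_adj_def)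
        then have "q (fst (ends e)) = q (snd (ends e))" unfolding q_eq r_def by blast
        then show False using e(2) by simp
      qed
      then show "e \<in> B" using e(2) by (simp add: S' graph_cut_def ends'_def)
    next
      fix e assume "e \<in> B"
      then have "e \<in> E'" "(q (fst (ends e)) \<in> S') \<noteq> (q (snd (ends e)) \<in> S')" by (auto simp: S' graph_cut_def ends'_def)
      then show "e \<in> graph_cut E ends S" using E' V by (auto simp: graph_cut_def S_def)
    qed
    moreover have "S \<subseteq> V" by (auto simp: S_def)
    moreover have "B \<subseteq> E'" by (auto simp: S' graph_cut_def)
    ultimately show "is_cut V E ends B \<and> B \<subseteq> E'" unfolding is_cut_def by blast
  next
    assume "is_cut V E ends B \<and> B \<subseteq> E'"
    then obtain S where S: "S \<subseteq> V" "B = graph_cut E ends S" "B \<subseteq> E'" by (auto simp: is_cut_def)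
    \<comment> \<open>A contracted edge leaving S would belong to B and hence to \<open>E'\<close>;
      so S is a union of classes.\<close>
    have qS: "q v \<in> q ` S \<longleftrightarrow> v \<in> S" for v
    proof
      assume "q v \<in> q ` S"
      then obtain u where u: "u \<in> S" "q u = q v" by force
      then have uv: "(u, v) \<in> (graph_adj (E - E') ends)\<^sup>*" unfolding q_eq r_def by blast
      show "v \<in> S"
      proof (rule ccontr)
        assume "v \<notin> S"
        then obtain x y where xy: "(x, y) \<in> graph_adj (E - E') ends" "x \<in> S" "y \<notin> S"
          using rtrancl_leaves[OF uv u(1)] by blast
        then obtain e where "e \<in> E - E'" "ends e = (x, y) \<or> ends e = (y, x)" by (auto simp: graph_adj_def)
        then have "e \<in> B" using xy S(2) by (auto simp: graph_cut_def)
        then show False using S(3) \<open>e \<in> E - E'\<close> by blast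
      qed
    qed blast
    have "B = graph_cut E' ends' (q ` S)"
      using S(2,3) E' by (auto simp: graph_cut_def ends'_def qS)
    moreover have "q ` S \<subseteq> q ` V" using S(1) by blast
    ultimately show "is_cut (q ` V) E' ends' B" unfolding is_cut_def by blast
  qed
  ultimately show thesis by (rule that)
qed

text \<open>The row of an index j in R is the fundamental cycle of the cotree edge
  \<open>\<rho> j\<close>. The rows outside R are zero and leave room for the vertex
  weights.\<close>

locale cycle_columns = conn_graph V E ends for V E ends +
  fixes a :: "nat \<Rightarrow> real^'g::finite" and R :: "'g set" and \<rho> :: "'g \<Rightarrow> nat" and T :: "nat set" and \<gamma> :: "'g \<Rightarrow> nat \<Rightarrow> int"
  assumes T: "spanning T" and rho: "bij_betw \<rho> R (E - T)"
    and gam: "\<And>e i. a e $ i = of_int (\<gamma> i e)" and H: "\<And>i. \<gamma> i \<in> H1Z V E ends"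
    and gR: "\<And>i. i \<notin> R \<Longrightarrow> \<gamma> i = (\<lambda>_. 0)"
    and unit: "\<And>j. j \<in> R \<Longrightarrow> a (\<rho> j) = axis j 1"
begin

lemma row_H1R: "(\<lambda>e. a e $ i) \<in> H1R V E ends"
  using H[of i] by (simp add: gam H1Z_H1R)

lemma combination_H1R: "(\<lambda>e. a e \<bullet> x) \<in> H1R V E ends"
proof -
  have "(\<lambda>e. \<Sum>i\<in>UNIV. x $ i * a e $ i) \<in> H1R V E ends"
    by (rule H1R_sum[where \<alpha> = "\<lambda>i e. a e $ i"]) (simp_all add: row_H1R)
  then show ?thesis by (simp add: inner_vec_def mult.commute)
qed

text \<open>Both sides are cycles and agree on the cotree edges, where the columns are unit
  vectors.\<close>

lemma cycle_combination:
  assumes al: "\<alpha> \<in> H1R V E ends"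
  shows "\<alpha> e = a e \<bullet> (\<chi> i. if i \<in> R then \<alpha> (\<rho> i) else 0)"
proof -
  let ?x = "\<chi> i. if i \<in> R then \<alpha> (\<rho> i) else 0"
  define \<beta> where "\<beta> e = 1 * \<alpha> e + (-1) * (a e \<bullet> ?x)" for e
  have "\<beta> \<in> H1R V E ends" unfolding \<beta>_def by (rule H1R_lin[OF al combination_H1R])
  moreover have "\<beta> d = 0" if "d \<in> E - T" for d
  proof -
    have "d \<in> \<rho> ` R" using that unfolding bij_betw_imp_surj_on[OF rho] .
    then obtain j where j: "j \<in> R" "d = \<rho> j" by blast
    then show ?thesis using unit[OF j(1)] by (simp add: \<beta>_def inner_axis')
  qed
  ultimately have "\<beta> e = 0" by (rule cycle_in_tree_zero[OF T])
  then show ?thesis by (simp add: \<beta>_def)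
qed

lemma a_outside: "e \<notin> E \<Longrightarrow> a e = 0"
  using H by (auto simp: vec_eq_iff gam H1Z_def)

text \<open>A nonsingular padded minor B is unimodular once it maps only lattice vectors into the
  lattice. Suppose B v is integral while some \<open>a e \<bullet> v\<close> is not. The values
  \<open>a e \<bullet> v\<close> form a cycle, and some nonzero cycle is supported on its
  non-integral edges. The latter is given by a vector u that vanishes on all selected columns, so B
  u = 0, a contradiction.\<close>

lemma minors:
  fixes r :: "nat \<Rightarrow> 'g"
  assumes r: "inj_on r {..<k}" and c: "c ` {..<k} \<subseteq> E"
  shows "det_nat k (\<lambda>i j. a (c j) $ r i) \<in> {-1, 0, 1}"
proof -
  let ?I = "r ` {..<k}"
  let ?f = "\<lambda>i. a (c (inv_into {..<k} r i))"
  let ?B = "rowmix ?I ?f"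
  have det: "det ?B = det_nat k (\<lambda>i j. a (c j) $ r i)"
    by (rule det_rowmix[OF r]) (simp add: inv_into_f_f[OF r])
  show ?thesis
  proof (cases "det ?B = 0")
    case True then show ?thesis using det by simp
  next
    case False
    have inj: "x = 0" if "?B *v x = 0" for x
    proof -
      have "invertible ?B" using False invertible_det_nz by blast
      then show ?thesis using that matrix_left_invertible_ker invertible_left_inverse by blast
    qed
    \<comment> \<open>Coordinates outside R vanish on every column, so a nonsingular minor avoids
      them.\<close>
    have IR: "i \<notin> ?I" if "i \<notin> R" for i
    proof
      assume i: "i \<in> ?I"
      have "(?B *v axis i 1) $ j = 0" for j
      proof (cases "j \<in> ?I")
        case True
        then show ?thesis unfolding rowmix_mult using gR[OF that] by (simp add: inner_axis gam)
      next
        case False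
        then show ?thesis using i by (auto simp: rowmix_mult axis_def)
      qed
      then have "?B *v axis i 1 = 0" by (simp add: vec_eq_iff)
      then have "axis i 1 = (0 :: real^'g)" by (rule inj)
      then show False by (metis axis_eq_0_iff zero_neq_one)
    qed
    have "?B \<in> GLZ"
    proof (rule GLZ_I)
      show "?B $ i $ j \<in> \<int>" for i j by (auto simp: rowmix_def gam axis_def)
      fix v assume Bv: "?B *v v \<in> Zlat"
      have BZ: "(if j \<in> ?I then ?f j \<bullet> v else v $ j) \<in> \<int>" for j
        using Bv unfolding Zlat_def mem_Collect_eq rowmix_mult by blast
      have all: "a e \<bullet> v \<in> \<int>" for e
      proof (rule ccontr)
        assume e: "a e \<bullet> v \<notin> \<int>"
        then have eE: "e \<in> E" using a_outside by fastforce
        obtain \<beta> where b: "\<beta> \<in> H1R V E ends" "\<exists>e. \<beta> e \<noteq> 0" "\<And>e. a e \<bullet> v \<in> \<int> \<Longrightarrow> \<beta> e = 0"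
          using nonintegral_support_cycle[OF combination_H1R eE e] by blast
        define u where "u = (\<chi> i. if i \<in> R then \<beta> (\<rho> i) else 0)"
        have bu: "\<beta> e = a e \<bullet> u" for e unfolding u_def by (rule cycle_combination[OF b(1)])
        have "(?B *v u) $ j = 0" for j
        proof (cases "j \<in> ?I")
          case True
          then have "?f j \<bullet> v \<in> \<int>" using BZ[of j] by simp
          then have "?f j \<bullet> u = 0" using b(3) bu by metis
          then show ?thesis using True by (simp add: rowmix_mult)
        next
          case jI: False
          have "u $ j = 0"
          proof (cases "j \<in> R")
            case True
            then have "a (\<rho> j) \<bullet> v \<in> \<int>" using BZ[of j] jI unit[OF True] by (simp add: inner_axis')
            then show ?thesis using b(3) True by (simp add: u_def)
          qed (simp add: u_def)
          then show ?thesis using jI by (simp add: rowmix_mult)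
        qed
        then have "?B *v u = 0" by (simp add: vec_eq_iff)
        then have "u = 0" by (rule inj)
        then show False using b(2) bu by simp
      qed
      have "v $ j \<in> \<int>" for j
      proof (cases "j \<in> R")
        case True
        then show ?thesis using all[of "\<rho> j"] unit[OF True] by (simp add: inner_axis')
      next
        case False
        then show ?thesis using BZ[of j] IR[OF False] by simp
      qed
      then show "v \<in> Zlat" by (simp add: Zlat_def)
    qed
    then have "\<bar>det ?B\<bar> = 1" unfolding GLZ_def by (elim CollectE conjE)
    then have "\<bar>det_nat k (\<lambda>i j. a (c j) $ r i)\<bar> = 1" unfolding det .
    then show ?thesis unfolding abs_if by (simp split: if_splits)
  qed
qed

text \<open>A relation among the columns is a labelling orthogonal to all cycles, hence a potential
  difference, and its support contains a cut. Conversely the potential differences of an indicator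
  function form a relation supported on a cut.\<close>

lemma dependent_iff_cut:
  assumes C: "C \<subseteq> E"
  shows "col_dependent a C \<longleftrightarrow> (\<exists>B. B \<noteq> {} \<and> is_cut V E ends B \<and> B \<subseteq> C)"
proof
  assume "col_dependent a C"
  then obtain c i where c: "i \<in> C" "c i \<noteq> 0" "(\<Sum>i\<in>C. c i *\<^sub>R a i) = 0" by (auto simp: col_dependent_def)
  define d where "d e = (if e \<in> C then c e else 0)" for e
  have "(\<Sum>e\<in>E. d e * \<alpha> e) = 0" if al: "\<alpha> \<in> H1R V E ends" for \<alpha>
  proof -
    let ?x = "\<chi> i. if i \<in> R then \<alpha> (\<rho> i) else 0"
    have "(\<Sum>e\<in>E. d e * \<alpha> e) = (\<Sum>e\<in>C. d e * \<alpha> e)"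
      using C finE by (intro sum.mono_neutral_right) (auto simp: d_def)
    also have "\<dots> = (\<Sum>e\<in>C. c e * (a e \<bullet> ?x))"
      by (rule sum.cong) (auto simp: d_def cycle_combination[OF al, symmetric])
    also have "\<dots> = (\<Sum>e\<in>C. c e *\<^sub>R a e) \<bullet> ?x" by (simp add: inner_sum_left)
    finally show ?thesis using c(3) by simp
  qed
  then obtain \<pi> where pi: "\<And>e. e \<in> E \<Longrightarrow> d e = \<pi> (snd (ends e)) - \<pi> (fst (ends e))" using orth_potential[of d] by metis
  have "d i \<noteq> 0" "i \<in> E" using c C by (auto simp: d_def)
  then obtain S where S: "S \<subseteq> V" "graph_cut E ends S \<noteq> {}" "\<And>e. e \<in> graph_cut E ends S \<Longrightarrow> d e \<noteq> 0"
    using potential_cut[of d \<pi> i] pi by metis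
  have "graph_cut E ends S \<subseteq> C"
  proof
    fix e assume "e \<in> graph_cut E ends S"
    then have "d e \<noteq> 0" by (rule S(3))
    then show "e \<in> C" by (simp add: d_def split: if_splits)
  qed
  then show "\<exists>B. B \<noteq> {} \<and> is_cut V E ends B \<and> B \<subseteq> C" using S unfolding is_cut_def by blast
next
  assume "\<exists>B. B \<noteq> {} \<and> is_cut V E ends B \<and> B \<subseteq> C"
  then obtain S where S: "S \<subseteq> V" "graph_cut E ends S \<noteq> {}" "graph_cut E ends S \<subseteq> C" by (auto simp: is_cut_def)
  define c :: "nat \<Rightarrow> real" where "c e = of_bool (snd (ends e) \<in> S) - of_bool (fst (ends e) \<in> S)" for e
  have cz: "c e \<noteq> 0 \<longleftrightarrow> e \<in> graph_cut E ends S" if "e \<in> E" for e unfolding c_def by (rule cut_potential[OF that])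
  have "(\<Sum>e\<in>C. c e *\<^sub>R a e) $ i = 0" for i
  proof -
    have "(\<Sum>e\<in>C. c e *\<^sub>R a e) $ i = (\<Sum>e\<in>C. c e * a e $ i)" by (simp add: sum_component)
    also have "\<dots> = (\<Sum>e\<in>E. c e * a e $ i)"
      using C finE cz S(3) by (intro sum.mono_neutral_left) auto
    also have "\<dots> = (\<Sum>e\<in>E. a e $ i * (of_bool (snd (ends e) \<in> S) - of_bool (fst (ends e) \<in> S)))"
      by (simp add: c_def mult.commute)
    also have "\<dots> = 0" using H1R_orth[OF row_H1R, of i "\<lambda>v. of_bool (v \<in> S)"] by simp
    finally show ?thesis .
  qed
  then have "(\<Sum>e\<in>C. c e *\<^sub>R a e) = 0" by (simp add: vec_eq_iff)
  moreover obtain e where "e \<in> graph_cut E ends S" using S(2) by blast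
  then have "e \<in> C" "c e \<noteq> 0" using S(3) C cz by auto
  ultimately show "col_dependent a C" unfolding col_dependent_def by blast
qed

lemma entries: "a e $ i \<in> {-1, 0, 1}"
proof (cases "e \<in> E")
  case True
  have "det_nat 1 (\<lambda>i' j. a e $ i) \<in> {-1, 0, 1}"
    using minors[of "\<lambda>_. i" 1 "\<lambda>_. e"] True by (auto simp: inj_on_def)
  moreover have "{p. p permutes {..<1::nat}} = {id}"
    by (auto simp: lessThan_Suc permutes_sing)
  ultimately show ?thesis by (simp add: det_nat_def)
qed (simp add: a_outside)

text \<open>Bridges give zero columns and edges in a common two-edge cut give columns equal up to sign;
  one representative of each class of equal nonzero squares is kept.\<close>
lemma simplification:
  "\<exists>n a'. totally_unimodular n a' \<and> cographic_col n a' \<and> simple_col n a' \<and>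
     sigma0 n a' = {edge_form E l a | l. \<forall>e\<in>E. l e > 0}"
proof -
  \<comment> \<open>The outer square determines a column up to sign and is all that enters the
    form.\<close>
  define sq :: "nat \<Rightarrow> real^'g^'g" where "sq e = (\<chi> r s. a e $ r * a e $ s)" for e
  have sq0: "sq e = 0 \<longleftrightarrow> a e = 0" for e
    by (auto simp: sq_def vec_eq_iff)
  define E' where "E' = inv_into E sq ` (sq ` E - {0})"
  have E'E: "E' \<subseteq> E" unfolding E'_def by (rule image_subsetI) (auto intro: inv_into_into)
  have E'z: "sq e \<noteq> 0 \<and> e = inv_into E sq (sq e)" if "e \<in> E'" for e
  proof -
    from that have "e \<in> inv_into E sq ` (sq ` E - {0})" by (simp only: E'_def)
    then obtain z where z: "e = inv_into E sq z" "z \<in> sq ` E - {0}" by (rule imageE)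
    have "z \<in> sq ` E" "z \<noteq> 0" using z(2) by (simp_all only: Diff_iff singleton_iff not_False_eq_True)
    moreover have "sq e = z" unfolding z(1) by (rule f_inv_into_f[OF \<open>z \<in> sq ` E\<close>])
    ultimately show ?thesis using z(1) by (simp only: not_False_eq_True simp_thms)
  qed
  then have sqE': "sq e \<noteq> 0" if "e \<in> E'" for e using that by blast
  have injE': "inj_on sq E'"
  proof (rule inj_onI)
    fix d e assume "d \<in> E'" "e \<in> E'" "sq d = sq e"
    then show "d = e" using E'z[of d] E'z[of e] by metis
  qed
  define rep where "rep e = inv_into E sq (sq e)" for e
  have rep: "rep e \<in> E'" "sq (rep e) = sq e" if "e \<in> E" "sq e \<noteq> 0" for e
  proof -
    have "sq e \<in> sq ` E - {0}" using that by blast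
    then show "rep e \<in> E'" unfolding rep_def E'_def by (rule imageI)
    show "sq (rep e) = sq e" unfolding rep_def using that(1) by (intro f_inv_into_f imageI)
  qed
  have repE': "rep e = e" if "e \<in> E'" for e
    unfolding rep_def using E'z[OF that] by simp
  have finE': "finite E'" using E'E finE finite_subset by blast
  define n where "n = card E'"
  obtain en where en: "bij_betw en {..<n} E'"
    using ex_bij_betw_nat_finite[OF finE'] by (auto simp: n_def atLeast0LessThan)
  define a' where "a' = a \<circ> en"
  have ein: "inj_on en {..<n}" and eim: "en ` {..<n} = E'" using en by (auto simp: bij_betw_def)
  have enE: "en i \<in> E'" if "i < n" for i using eim that by blast
  have tu: "totally_unimodular n a'"
    unfolding totally_unimodular_def
  proof (intro allI impI)
    fix k and r :: "nat \<Rightarrow> 'g" and c :: "nat \<Rightarrow> nat"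
    assume *: "inj_on r {..<k}" "inj_on c {..<k}" "c ` {..<k} \<subseteq> {..<n}"
    have "(en \<circ> c) ` {..<k} \<subseteq> E" using *(3) eim E'E by auto
    from minors[OF *(1) this] show "det_nat k (\<lambda>i j. a' (c j) $ r i) \<in> {-1, 0, 1}" by (simp add: a'_def)
  qed
  have dep': "col_dependent a' C \<longleftrightarrow> col_dependent a (en ` C)" if C: "C \<subseteq> {..<n}" for C
  proof -
    have ic: "inj_on en C" using ein C inj_on_subset by blast
    have s: "(\<Sum>e\<in>en ` C. c e *\<^sub>R a e) = (\<Sum>i\<in>C. c (en i) *\<^sub>R a' i)" for c
      by (simp add: sum.reindex[OF ic] a'_def)
    show ?thesis
    proof
      assume "col_dependent a' C"
      then obtain c i where c: "i \<in> C" "c i \<noteq> 0" "(\<Sum>i\<in>C. c i *\<^sub>R a' i) = 0" by (auto simp: col_dependent_def)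
      let ?d = "c \<circ> inv_into C en"
      have "(\<Sum>e\<in>en ` C. ?d e *\<^sub>R a e) = (\<Sum>i\<in>C. c i *\<^sub>R a' i)"
        unfolding s by (rule sum.cong) (simp_all add: inv_into_f_f[OF ic])
      moreover have "?d (en i) \<noteq> 0" using c by (simp add: inv_into_f_f[OF ic])
      moreover have "en i \<in> en ` C" using c(1) by (rule imageI)
      ultimately show "col_dependent a (en ` C)"
        unfolding col_dependent_def using c(3) by (intro exI[of _ ?d] conjI bexI[of _ "en i"]) simp_all
    next
      assume "col_dependent a (en ` C)"
      then obtain c where c: "\<exists>e\<in>en ` C. c e \<noteq> 0" "(\<Sum>e\<in>en ` C. c e *\<^sub>R a e) = 0" unfolding col_dependent_def by blast
      then have "\<exists>i\<in>C. c (en i) \<noteq> 0" by blast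
      then show "col_dependent a' C" unfolding col_dependent_def using c(2) unfolding s by (intro exI[of _ "\<lambda>i. c (en i)"] conjI)
    qed
  qed
  have "cographic_col n a'"
  proof -
    obtain V' ends' where G: "fin_graph V' E' ends'" and cut: "\<And>B. is_cut V' E' ends' B \<longleftrightarrow> is_cut V E ends B \<and> B \<subseteq> E'"
      using contraction[OF fin E'E] by metis
    have "(`) en ` col_circuits n a' = bonds V' E' ends'"
    proof (rule circuits_eq_bonds[OF en])
      fix C assume C: "C \<subseteq> {..<n}"
      have eC: "en ` C \<subseteq> E'" using C eim by blast
      then have eE: "en ` C \<subseteq> E" using E'E by (rule order_trans)
      show "col_dependent a' C \<longleftrightarrow> (\<exists>B. B \<noteq> {} \<and> is_cut V' E' ends' B \<and> B \<subseteq> en ` C)"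
        unfolding dep'[OF C] dependent_iff_cut[OF eE]
      proof (intro iff_exI iffI)
        fix B assume B: "B \<noteq> {} \<and> is_cut V E ends B \<and> B \<subseteq> en ` C"
        then have "B \<subseteq> E'" using eC order_trans by metis
        then show "B \<noteq> {} \<and> is_cut V' E' ends' B \<and> B \<subseteq> en ` C" using B unfolding cut by (elim conjE, intro conjI)
      next
        fix B assume "B \<noteq> {} \<and> is_cut V' E' ends' B \<and> B \<subseteq> en ` C"
        then show "B \<noteq> {} \<and> is_cut V E ends B \<and> B \<subseteq> en ` C" unfolding cut by (elim conjE, intro conjI)
      qed
    qed
    then show ?thesis unfolding cographic_col_def using G en
      by (intro exI[of _ V'] exI[of _ E'] exI[of _ ends'] exI[of _ en] conjI)
  qed
  moreover have "simple_col n a'"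
    unfolding simple_col_def
  proof
    fix C assume "C \<in> col_circuits n a'"
    then have C: "C \<subseteq> {..<n}" "C \<noteq> {}" "col_dependent a' C" by (auto simp: col_circuits_def)
    have nz: "a' i \<noteq> 0" if "i < n" for i using sqE'[OF enE[OF that]] sq0 by (simp add: a'_def)
    have finC: "finite C" using C(1) finite_subset by blast
    show "card C \<ge> 3"
    proof (rule ccontr)
      assume "\<not> card C \<ge> 3"
      moreover have "card C \<noteq> 0" using C(2) finC by simp
      ultimately consider "card C = 1" | "card C = 2" by linarith
      then show False
      proof cases
        case 1
        then obtain i where "C = {i}" by (metis card_1_singletonE)
        then show False using C nz[of i] by (auto simp: col_dependent_def)
      next
        case 2
        then obtain i j where ij: "C = {i, j}" "i \<noteq> j" by (metis card_2_iff)
        obtain c where c: "\<exists>k\<in>C. c k \<noteq> 0" "(\<Sum>k\<in>C. c k *\<^sub>R a' k) = 0" using C(3) by (auto simp: col_dependent_def)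
        have n: "i < n" "j < n" using C(1) ij by auto
        have e: "c i *\<^sub>R a' i + c j *\<^sub>R a' j = 0" using c(2) ij by simp
        have "c i \<noteq> 0" using c(1) ij e nz[OF n(2)] by auto
        \<comment> \<open>Proportional nonzero columns with entries in {-1, 0, 1} agree up to sign,
          so they have equal squares and cannot both have been kept.\<close>
        define t where "t = - c j / c i"
        have ee: "c i *\<^sub>R a' i = - (c j *\<^sub>R a' j)" using e by (rule eq_neg_iff_add_eq_0[THEN iffD2])
        have "a' i = (1 / c i) *\<^sub>R (c i *\<^sub>R a' i)" using \<open>c i \<noteq> 0\<close> by simp
        then have it: "a' i = t *\<^sub>R a' j" unfolding ee by (simp add: t_def)
        obtain s where s: "a' i $ s \<noteq> 0" using nz[OF n(1)] by (metis vec_eq_iff zero_index)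
        have "a' i $ s = t * a' j $ s" using it by simp
        moreover have "a' i $ s \<in> {-1, 0, 1}" "a' j $ s \<in> {-1, 0, 1}" using entries by (simp_all add: a'_def)
        ultimately have "t = 1 \<or> t = -1" using s by auto
        then have "sq (en i) = sq (en j)" using it by (auto simp: sq_def a'_def vec_eq_iff)
        then have "en i = en j" using inj_onD[OF injE'] enE n by blast
        then show False using inj_onD[OF ein] n ij(2) by auto
      qed
    qed
  qed
  moreover have "sigma0 n a' = {edge_form E l a | l. \<forall>e\<in>E. l e > 0}"
  proof -
    have ef: "edge_form E l a = (\<Sum>d\<in>E'. (\<Sum>e\<in>{e\<in>E. sq e \<noteq> 0 \<and> rep e = d}. l e) *\<^sub>R sq d)" for l
    proof -
      have "edge_form E l a = (\<Sum>e\<in>{e\<in>E. sq e \<noteq> 0}. l e *\<^sub>R sq e)"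
        unfolding edge_form_def sq_def[symmetric] using finE by (intro sum.mono_neutral_right) auto
      also have "\<dots> = (\<Sum>d\<in>E'. \<Sum>e\<in>{e\<in>{e\<in>E. sq e \<noteq> 0}. rep e = d}. l e *\<^sub>R sq e)"
        using rep(1) finE finE' by (intro sum.group[symmetric]) auto
      also have "\<dots> = (\<Sum>d\<in>E'. (\<Sum>e\<in>{e\<in>E. sq e \<noteq> 0 \<and> rep e = d}. l e) *\<^sub>R sq d)"
        unfolding scaleR_sum_left using rep(2) by (intro sum.cong refl) auto
      finally show ?thesis .
    qed
    have of: "oform n a' m = (\<Sum>d\<in>E'. m (inv_into {..<n} en d) *\<^sub>R sq d)" for m
      unfolding eim[symmetric] sum.reindex[OF ein] by (simp add: oform_def a'_def sq_def inv_into_f_f[OF ein])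
    have fib: "d \<in> {e\<in>E. sq e \<noteq> 0 \<and> rep e = d}" if "d \<in> E'" for d using that E'E sqE' repE' by auto
    show ?thesis
    proof (intro set_eqI iffI)
      fix Q assume "Q \<in> sigma0 n a'"
      then obtain m where m: "\<And>i. i < n \<Longrightarrow> m i > 0" "Q = oform n a' m" unfolding sigma0_oform by blast
      define c where "c d = real (card {e\<in>E. sq e \<noteq> 0 \<and> rep e = d})" for d
      have cpos: "c d > 0" if "d \<in> E'" for d using fib[OF that] finE by (auto simp: c_def card_gt_0_iff)
      have mpos: "m (inv_into {..<n} en d) > 0" if "d \<in> E'" for d
        using m(1) inv_into_into[of d en "{..<n}"] that eim by blast
      \<comment> \<open>A prescribed coefficient is split evenly among the edges of its class. An
        edge with zero column contributes nothing and gets length 1.\<close>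
      define l where "l e = (if sq e = 0 then 1 else m (inv_into {..<n} en (rep e)) / c (rep e))" for e
      have lpos: "\<forall>e\<in>E. l e > 0" using rep(1) cpos mpos by (auto simp: l_def)
      have "(\<Sum>e\<in>{e\<in>E. sq e \<noteq> 0 \<and> rep e = d}. l e) = m (inv_into {..<n} en d)" if "d \<in> E'" for d
      proof -
        have "(\<Sum>e\<in>{e\<in>E. sq e \<noteq> 0 \<and> rep e = d}. l e) = (\<Sum>e\<in>{e\<in>E. sq e \<noteq> 0 \<and> rep e = d}. m (inv_into {..<n} en d) / c d)"
          by (rule sum.cong) (auto simp: l_def)
        also have "\<dots> = c d * (m (inv_into {..<n} en d) / c d)" by (simp add: c_def)
        finally show ?thesis using cpos[OF that] by simp
      qed
      then have "edge_form E l a = Q" unfolding ef m(2) of by (intro sum.cong) auto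
      then show "Q \<in> {edge_form E l a | l. \<forall>e\<in>E. l e > 0}" using lpos by blast
    next
      fix Q assume "Q \<in> {edge_form E l a | l. \<forall>e\<in>E. l e > 0}"
      then obtain l where l: "\<And>e. e \<in> E \<Longrightarrow> l e > 0" "Q = edge_form E l a" by blast
      define m where "m i = (\<Sum>e\<in>{e\<in>E. sq e \<noteq> 0 \<and> rep e = en i}. l e)" for i
      have "m i > 0" if "i < n" for i
        unfolding m_def using l(1) fib[OF enE[OF that]] finE by (intro sum_pos) auto
      moreover have "Q = oform n a' m"
        unfolding l(2) ef of m_def by (rule sum.cong) (simp_all add: f_inv_into_f eim)
      ultimately show "Q \<in> sigma0 n a'" unfolding sigma0_oform by blast
    qed
  qed
  ultimately show ?thesis using tu by blast
qed

end

context conn_graph begin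

lemma cycle_columns_exist:
  assumes g: "betti1 V E \<le> CARD('g::finite)"
  shows "\<exists>(a :: nat \<Rightarrow> real^'g) R \<rho> T \<gamma>. cycle_columns V E ends a R \<rho> T \<gamma> \<and> card R = betti1 V E"
proof -
  obtain T where T: "spanning T" using spanning_tree_exists by blast
  obtain R :: "'g set" where R: "card R = card (E - T)"
    using g card_cotree[OF T] obtain_subset_with_card_n[of "betti1 V E" "UNIV :: 'g set"] by metis
  obtain \<rho> where rho: "bij_betw \<rho> R (E - T)"
    using finite_same_card_bij[of R "E - T"] R finE by auto
  have "\<exists>\<phi>. \<phi> \<in> H1R V E ends \<and> (\<forall>x. \<phi> x \<in> \<int>) \<and> (\<forall>x\<in>E - T. \<phi> x = of_bool (x = e))" if "e \<in> E - T" for e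
    using fundamental_cycle[OF T that] by metis
  then obtain \<phi> where phi: "\<And>e. e \<in> E - T \<Longrightarrow> \<phi> e \<in> H1R V E ends \<and> (\<forall>x. \<phi> e x \<in> \<int>) \<and> (\<forall>x\<in>E - T. \<phi> e x = of_bool (x = e))"
    by metis
  define \<gamma> where "\<gamma> i e = (if i \<in> R then \<lfloor>\<phi> (\<rho> i) e\<rfloor> else 0)" for i e
  define a :: "nat \<Rightarrow> real^'g" where "a e = (\<chi> i. of_int (\<gamma> i e))" for e
  have rR: "\<rho> i \<in> E - T" if "i \<in> R" for i using bij_betwE[OF rho] that by blast
  have gi: "of_int (\<gamma> i e) = \<phi> (\<rho> i) e" if "i \<in> R" for i e
    using phi[OF rR[OF that]] that by (simp add: \<gamma>_def)
  have "cycle_columns V E ends a R \<rho> T \<gamma>"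
  proof
    show "\<gamma> i \<in> H1Z V E ends" for i
    proof (cases "i \<in> R")
      case True
      have "(\<lambda>e. of_int (\<gamma> i e)) = \<phi> (\<rho> i)" using gi[OF True] by blast
      then show ?thesis unfolding H1Z_H1R using phi[OF rR[OF True]] by simp
    next
      case False
      then have "\<gamma> i = (\<lambda>_. 0)" by (simp add: \<gamma>_def fun_eq_iff)
      then show ?thesis unfolding H1Z_H1R by (simp add: H1R_0)
    qed
    show "a (\<rho> j) = axis j 1" if j: "j \<in> R" for j
    proof -
      have "a (\<rho> j) $ i = axis j 1 $ i" for i
      proof (cases "i \<in> R")
        case True
        have "\<rho> j = \<rho> i \<longleftrightarrow> i = j" using inj_onD[OF bij_betw_imp_inj_on[OF rho]] True j by blast
        then show ?thesis using phi[OF rR[OF True]] rR[OF j] gi[OF True] by (simp add: a_def axis_def)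
      next
        case False
        then show ?thesis using j by (auto simp: a_def \<gamma>_def axis_def)
      qed
      then show ?thesis by (simp add: vec_eq_iff)
    qed
  qed (use T rho in \<open>auto simp: a_def \<gamma>_def fun_eq_iff\<close>)
  then show ?thesis using R card_cotree[OF T] by metis
qed

end

theorem stable_type_cogr_cell:
  assumes st: "stable_type CARD('g::finite) V E ends w"
  shows "\<exists>n (a :: nat \<Rightarrow> real^'g). totally_unimodular n a \<and> cographic_col n a \<and> simple_col n a \<and>
     torelli_cell V E ends w = gl_sat (sigma0 n a)"
proof -
  interpret conn_graph V E ends using st by unfold_locales (auto simp: stable_type_def)
  have g: "betti1 V E + (\<Sum>v\<in>V. w v) = CARD('g)" using st by (simp add: stable_type_def)
  then have le: "betti1 V E \<le> CARD('g)" by simp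
  obtain a :: "nat \<Rightarrow> real^'g" and R \<rho> T \<gamma> where cc: "cycle_columns V E ends a R \<rho> T \<gamma>" and R: "card R = betti1 V E"
    using cycle_columns_exist[OF le] by blast
  interpret cycle_columns V E ends a R \<rho> T \<gamma> by (rule cc)
  have "rowmix R (\<lambda>j. a (\<rho> j)) = mat 1"
    using unit by (simp add: rowmix_def vec_eq_iff mat_def axis_def)
  moreover have "(mat 1 :: real^'g^'g) \<in> GLZ"
    unfolding GLZ_def mem_Collect_eq det_I by (simp add: mat_def)
  ultimately have G: "rowmix R (\<lambda>j. a (\<rho> j)) \<in> GLZ" by simp
  have W: "card (- R) = (\<Sum>v\<in>V. w v)" using g R by (simp add: Compl_eq_Diff_UNIV card_Diff_subset)
  obtain \<delta> where "bij_betw (\<lambda>x::'g \<Rightarrow> int. (lc x \<gamma>, lc x \<delta>)) UNIV (H1Z V E ends \<times> {f. \<forall>k. k \<ge> (\<Sum>v\<in>V. w v) \<longrightarrow> f k = 0})"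
    using jacobian_basis[OF T rho G, of \<gamma> "\<lambda>_. 1", OF _ _ H W] gam by auto
  then have tc: "torelli_cell V E ends w = gl_sat {edge_form E l a | l. \<forall>e\<in>E. l e > 0}"
    by (rule torelli_cell_orbit[OF finE]) (rule gam)
  show ?thesis using simplification unfolding tc by metis
qed

section \<open>From cographic systems to combinatorial types\<close>

text \<open>Gluing one root from each component preserves the cuts, since complementing a vertex set
  on a component does not change its cut.\<close>
lemma connecting:
  assumes fin: "fin_graph V E ends"
  obtains V' ends' where "fin_graph V' E ends'" "graph_connected V' E ends'"
    "\<And>B. is_cut V' E ends' B \<longleftrightarrow> is_cut V E ends B"
proof -
  define r where "r = (graph_adj E ends)\<^sup>*"
  have symr: "sym r" unfolding r_def by (intro sym_rtrancl) (auto simp: sym_def graph_adj_def)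
  have transr: "trans r" unfolding r_def by (rule trans_rtrancl)
  define rt where "rt v = (LEAST u. (v, u) \<in> r)" for v
  have vrt: "(v, rt v) \<in> r" for v
    unfolding rt_def by (rule LeastI[of _ v]) (simp add: r_def)
  have rt_eq: "rt u = rt v" if "(u, v) \<in> r" for u v
  proof -
    have "(u, w) \<in> r \<longleftrightarrow> (v, w) \<in> r" for w using that symr transr by (meson symD transD)
    then show ?thesis by (simp add: rt_def)
  qed
  have rtrt: "rt (rt v) = rt v" for v using rt_eq[OF vrt] by simp
  have V: "fst (ends e) \<in> V" "snd (ends e) \<in> V" if "e \<in> E" for e using fin that by (auto simp: fin_graph_def)
  have edge_rt: "rt (fst (ends e)) = rt (snd (ends e))" if "e \<in> E" for e
  proof (rule rt_eq)
    have "(fst (ends e), snd (ends e)) \<in> graph_adj E ends" using that by (force simp: graph_adj_def)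
    then show "(fst (ends e), snd (ends e)) \<in> r" unfolding r_def by blast
  qed
  obtain v1 where v1: "v1 \<in> V" using fin by (auto simp: fin_graph_def)
  define v0 where "v0 = rt v1"
  have rv0: "rt v0 = v0" by (simp add: v0_def rtrt)
  \<comment> \<open>Each component has its least vertex as root; only the roots are identified, all
    of them with \<open>v0\<close>.\<close>
  define q where "q v = (if rt v = v then v0 else v)" for v
  define ends' where "ends' e = (q (fst (ends e)), q (snd (ends e)))" for e
  have "fin_graph (q ` V) E ends'" using fin V by (auto simp: fin_graph_def ends'_def)
  moreover have "graph_connected (q ` V) E ends'"
  proof -
    let ?r' = "(graph_adj E ends')\<^sup>*"
    have step: "(q x, q y) \<in> graph_adj E ends'" if "(x, y) \<in> graph_adj E ends" for x y
    proof -
      obtain e where e: "e \<in> E" "ends e = (x, y) \<or> ends e = (y, x)"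
        using \<open>(x, y) \<in> graph_adj E ends\<close> by (auto simp: graph_adj_def)
      then have "ends' e = (q x, q y) \<or> ends' e = (q y, q x)" by (auto simp: ends'_def)
      then show ?thesis using e(1) by (auto simp: graph_adj_def)
    qed
    have path: "(q x, q y) \<in> ?r'" if "(x, y) \<in> r" for x y
      using that unfolding r_def
      by (induction rule: rtrancl_induct) (auto intro: step rtrancl_into_rtrancl)
    have "(q v, v0) \<in> ?r'" for v
    proof -
      have "q (rt v) = v0" by (simp add: q_def rtrt)
      then show ?thesis using path[OF vrt, of v] by simp
    qed
    moreover have "sym ?r'" by (intro sym_rtrancl) (auto simp: sym_def graph_adj_def)
    ultimately have "(q u, q v) \<in> ?r'" for u v by (meson symD rtrancl_trans)
    then show ?thesis by (auto simp: graph_connected_def)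
  qed
  moreover have "is_cut (q ` V) E ends' B \<longleftrightarrow> is_cut V E ends B" for B
  proof
    assume "is_cut (q ` V) E ends' B"
    then obtain S' where S': "B = graph_cut E ends' S'" unfolding is_cut_def by blast
    have "(fst (ends' e) \<in> S') \<noteq> (snd (ends' e) \<in> S') \<longleftrightarrow>
        (fst (ends e) \<in> {v\<in>V. q v \<in> S'}) \<noteq> (snd (ends e) \<in> {v\<in>V. q v \<in> S'})" if "e \<in> E" for e
      using V[OF that] by (simp add: ends'_def)
    then have "B = graph_cut E ends {v\<in>V. q v \<in> S'}"
      unfolding S' graph_cut_def by (intro Collect_cong conj_cong refl)
    moreover have "{v\<in>V. q v \<in> S'} \<subseteq> V" by blast
    ultimately show "is_cut V E ends B" unfolding is_cut_def by (intro exI[of _ "{v\<in>V. q v \<in> S'}"] conjI)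
  next
    assume "is_cut V E ends B"
    then obtain S where S: "S \<subseteq> V" "B = graph_cut E ends S" by (auto simp: is_cut_def)
    \<comment> \<open>S is complemented on every component whose root lies in S. The cut stays the
      same, and the new set contains no root, so it is compatible with the identification of the
      roots.\<close>
    define S' where "S' = {v\<in>V. (v \<in> S) \<noteq> (rt v \<in> S)}"
    have root: "rt v \<noteq> v" if "v \<in> S'" for v using that by (auto simp: S'_def)
    have qS: "q v \<in> S' \<longleftrightarrow> v \<in> S'" for v
    proof (cases "rt v = v")
      case True
      then have "q v = v0" "v \<notin> S'" using root by (auto simp: q_def)
      then show ?thesis using root[of v0] rv0 by auto
    qed (simp add: q_def)
    have "S' \<subseteq> q ` V"
    proof
      fix v assume v: "v \<in> S'"
      then have "q v = v" using root by (simp add: q_def)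
      then show "v \<in> q ` V" using v by (metis (no_types, lifting) S'_def imageI mem_Collect_eq)
    qed
    moreover have "graph_cut E ends' S' = B"
    proof (intro set_eqI iffI)
      fix e assume "e \<in> graph_cut E ends' S'"
      then have "e \<in> E" "(fst (ends e) \<in> S') \<noteq> (snd (ends e) \<in> S')" by (auto simp: graph_cut_def ends'_def qS)
      then show "e \<in> B" using V[of e] edge_rt[of e] by (auto simp: S'_def S(2) graph_cut_def)
    next
      fix e assume "e \<in> B"
      then have "e \<in> E" "(fst (ends e) \<in> S) \<noteq> (snd (ends e) \<in> S)" by (auto simp: S(2) graph_cut_def)
      then show "e \<in> graph_cut E ends' S'" using V[of e] edge_rt[of e] by (auto simp: graph_cut_def ends'_def qS) (auto simp: S'_def)
    qed
    ultimately show "is_cut (q ` V) E ends' B" unfolding is_cut_def by blast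
  qed
  ultimately show thesis by (rule that)
qed

lemma independent_columns:
  fixes a :: "nat \<Rightarrow> real^'g::finite"
  assumes J: "finite J" and nd: "\<not> col_dependent a J"
  shows "inj_on a J" "independent (a ` J)"
proof -
  show inj: "inj_on a J"
  proof (rule inj_onI, rule ccontr)
    fix i j assume ij: "i \<in> J" "j \<in> J" "a i = a j" "i \<noteq> j"
    let ?c = "\<lambda>k. if k = i then 1 else if k = j then -1 else 0 :: real"
    have "(\<Sum>k\<in>J. ?c k *\<^sub>R a k) = (\<Sum>k\<in>{i, j}. ?c k *\<^sub>R a k)"
      using ij J by (intro sum.mono_neutral_right) auto
    also have "\<dots> = 0" using ij by simp
    finally have "col_dependent a J" unfolding col_dependent_def using ij(1) by (intro exI[of _ ?c]) auto
    then show False using nd by blast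
  qed
  show "independent (a ` J)"
  proof
    assume "dependent (a ` J)"
    then obtain u where u: "\<exists>v\<in>a ` J. u v \<noteq> 0" "(\<Sum>v\<in>a ` J. u v *\<^sub>R v) = 0"
      using dependent_finite[OF finite_imageI[OF J]] by blast
    have "(\<Sum>i\<in>J. u (a i) *\<^sub>R a i) = 0" using u(2) by (simp add: sum.reindex[OF inj])
    then have "col_dependent a J" unfolding col_dependent_def using u(1) by (intro exI[of _ "\<lambda>i. u (a i)"]) auto
    then show False using nd by blast
  qed
qed

lemma dependent_contains_circuit:
  assumes "finite D" "D \<subseteq> {..<n}" "col_dependent a D"
  shows "\<exists>C\<in>col_circuits n a. C \<subseteq> D"
  using assms
proof (induction D rule: finite_psubset_induct)
  case (psubset D)
  show ?case
  proof (cases "\<exists>D'\<subset>D. col_dependent a D'")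
    case True
    then obtain D' where D': "D' \<subset> D" "col_dependent a D'" by blast
    then have "D' \<subseteq> {..<n}" using psubset.prems(1) by blast
    then show ?thesis using psubset.IH[OF D'(1) _ D'(2)] D'(1) by blast
  next
    case False
    moreover have "D \<noteq> {}" using psubset.prems(2) by (auto simp: col_dependent_def)
    ultimately have "D \<in> col_circuits n a" using psubset.prems by (auto simp: col_circuits_def)
    then show ?thesis by blast
  qed
qed

text \<open>By minimality all coefficients of a relation on a circuit are nonzero. Solving for one
  column through a unimodular completion of the others shows that every ratio of coefficients is an
  integer. The inverse ratios are integers too, so all ratios are 1 or -1.\<close>

lemma circuit_signs:
  fixes a :: "nat \<Rightarrow> real^'g::finite"
  assumes tu: "totally_unimodular n a" and C: "C \<in> col_circuits n a"
  obtains c where "\<And>i. i \<in> C \<Longrightarrow> c i = 1 \<or> c i = (-1::real)" "(\<Sum>i\<in>C. c i *\<^sub>R a i) = 0"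
proof -
  have Cn: "C \<subseteq> {..<n}" "C \<noteq> {}" and dep: "col_dependent a C" and min: "\<And>D. D \<subset> C \<Longrightarrow> \<not> col_dependent a D"
    using C by (auto simp: col_circuits_def)
  have finC: "finite C" using Cn(1) finite_subset by blast
  obtain c i0 where c: "i0 \<in> C" "c i0 \<noteq> 0" "(\<Sum>i\<in>C. c i *\<^sub>R a i) = 0" using dep by (auto simp: col_dependent_def)
  have cnz: "c i \<noteq> 0" if i: "i \<in> C" for i
  proof
    assume 0: "c i = 0"
    have "(\<Sum>j\<in>C - {i}. c j *\<^sub>R a j) = 0" using c(3) i finC 0 by (simp add: sum.remove[of C i])
    moreover have "i0 \<in> C - {i}" using c(1,2) 0 by auto
    ultimately have "col_dependent a (C - {i})" unfolding col_dependent_def using c(2) by blast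
    moreover have "C - {i} \<subset> C" using i by blast
    ultimately show False using min by blast
  qed
  have int: "c j / c e \<in> \<int>" if e: "e \<in> C" and j: "j \<in> C" for e j
  proof (cases "j = e")
    case True then show ?thesis using cnz[OF e] by simp
  next
    case False
    let ?J = "C - {e}"
    have nd: "\<not> col_dependent a ?J" using min[of ?J] e by blast
    have finJ: "finite ?J" using finC by simp
    obtain R \<rho> where rho: "bij_betw \<rho> R ?J" and G: "rowmix R (\<lambda>j. a (\<rho> j)) \<in> GLZ"
      using tu_rowmix[OF tu _ independent_columns[OF finJ nd]] Cn(1) by (metis Diff_subset order_trans)
    let ?B = "rowmix R (\<lambda>j. a (\<rho> j))"
    define x where "x = (\<chi> r. if r \<in> R then - c (\<rho> r) / c e else 0)"
    have "transpose ?B *v x = a e"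
    proof -
      have "(transpose ?B *v x) $ s = a e $ s" for s
      proof -
        have "(transpose ?B *v x) $ s = (\<Sum>r\<in>UNIV. ?B $ r $ s * x $ r)"
          by (simp add: matrix_vector_mult_def transpose_def)
        also have "\<dots> = (\<Sum>r\<in>R. ?B $ r $ s * x $ r)"
          by (rule sum.mono_neutral_right) (auto simp: x_def)
        also have "\<dots> = (\<Sum>r\<in>R. (\<lambda>k. - c k / c e * a k $ s) (\<rho> r))"
          by (rule sum.cong) (auto simp: x_def rowmix_def)
        also have "\<dots> = (\<Sum>k\<in>?J. - c k / c e * a k $ s)" by (rule sum.reindex_bij_betw[OF rho])
        also have "\<dots> = - (\<Sum>k\<in>?J. c k * a k $ s) / c e"
          by (simp add: sum_negf sum_divide_distrib)
        also have "(\<Sum>k\<in>?J. c k * a k $ s) = - (c e * a e $ s)"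
        proof -
          have "(\<Sum>k\<in>C. c k *\<^sub>R a k) $ s = 0" using c(3) by simp
          then have "(\<Sum>k\<in>C. c k * a k $ s) = 0" by simp
          then show ?thesis using sum.remove[OF finC e, of "\<lambda>k. c k * a k $ s"] by simp
        qed
        finally show ?thesis using cnz[OF e] by simp
      qed
      then show ?thesis by (simp add: vec_eq_iff)
    qed
    moreover have "a e \<in> Zlat" using tu_Zlat[OF tu] e Cn(1) by blast
    ultimately have "x \<in> Zlat" using GLZ_solve[OF GLZ_transpose[OF G]] by metis
    moreover have "j \<in> \<rho> ` R" using j False unfolding bij_betw_imp_surj_on[OF rho] by simp
    then obtain r where r: "r \<in> R" "j = \<rho> r" by blast
    ultimately have "x $ r \<in> \<int>" unfolding Zlat_def by blast
    then have "- (c j / c e) \<in> \<int>" using r by (simp add: x_def)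
    then show ?thesis by (simp add: minus_in_Ints_iff)
  qed
  have "c i / c i0 = 1 \<or> c i / c i0 = -1" if i: "i \<in> C" for i
  proof -
    have "(c i / c i0) * (c i0 / c i) = 1" using cnz[OF i] c(2) by simp
    then have "\<bar>c i / c i0\<bar> = 1" by (rule Ints_mult_eq_1[OF int[OF c(1) i] int[OF i c(1)]])
    then show ?thesis by linarith
  qed
  moreover have "(\<Sum>i\<in>C. (c i / c i0) *\<^sub>R a i) = (1 / c i0) *\<^sub>R (\<Sum>i\<in>C. c i *\<^sub>R a i)"
    by (simp add: scaleR_sum_right)
  then have "(\<Sum>i\<in>C. (c i / c i0) *\<^sub>R a i) = 0" using c(3) by simp
  ultimately show thesis by (rule that)
qed

locale cographic_system = conn_graph V E ends for V E ends +
  fixes n :: nat and a :: "nat \<Rightarrow> real^'g::finite" and f :: "nat \<Rightarrow> nat"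
  assumes tu: "totally_unimodular n a" and f: "bij_betw f {..<n} E"
    and circ: "(`) f ` col_circuits n a = bonds V E ends"
begin

definition b :: "nat \<Rightarrow> real^'g" where
  "b e = (if e \<in> E then a (inv_into {..<n} f e) else 0)"

lemma b_f: "i < n \<Longrightarrow> b (f i) = a i"
  using f by (auto simp: b_def bij_betw_def inv_into_f_f)

lemma sum_f: "(\<Sum>i<n. h (f i)) = (\<Sum>e\<in>E. h e)"
  by (rule sum.reindex_bij_betw[OF f])

lemma bond_signs:
  assumes B: "B \<in> bonds V E ends"
  shows "\<exists>c. (\<forall>e\<in>B. c e = 1 \<or> c e = (-1::real)) \<and> (\<forall>e. e \<notin> B \<longrightarrow> c e = 0) \<and> (\<Sum>e\<in>E. c e *\<^sub>R b e) = 0"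
proof -
  obtain C where C: "C \<in> col_circuits n a" "f ` C = B" using B circ by (metis imageE)
  obtain c where c: "\<And>i. i \<in> C \<Longrightarrow> c i = 1 \<or> c i = (-1::real)" "(\<Sum>i\<in>C. c i *\<^sub>R a i) = 0"
    using circuit_signs[OF tu C(1)] by blast
  have Cn: "C \<subseteq> {..<n}" using C(1) by (simp add: col_circuits_def)
  have inj: "inj_on f {..<n}" using f by (simp add: bij_betw_def)
  define d where "d e = (if e \<in> B then c (inv_into {..<n} f e) else 0)" for e
  have mem: "f i \<in> B \<longleftrightarrow> i \<in> C" if "i < n" for i
    using C(2) inj_on_image_mem_iff[OF inj _ Cn] that by blast
  have df: "d (f i) = (if i \<in> C then c i else 0)" if "i < n" for i
    using mem[OF that] that by (simp add: d_def inv_into_f_f[OF inj])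
  have "(\<Sum>e\<in>E. d e *\<^sub>R b e) = (\<Sum>i<n. d (f i) *\<^sub>R b (f i))" by (rule sum_f[symmetric])
  also have "\<dots> = (\<Sum>i<n. (if i \<in> C then c i else 0) *\<^sub>R a i)" by (rule sum.cong) (auto simp: df b_f)
  also have "\<dots> = (\<Sum>i\<in>C. (if i \<in> C then c i else 0) *\<^sub>R a i)" using Cn by (intro sum.mono_neutral_right) auto
  also have "\<dots> = 0" using c(2) by (simp cong: sum.cong)
  finally have "(\<Sum>e\<in>E. d e *\<^sub>R b e) = 0" .
  moreover have "d e = 1 \<or> d e = -1" if "e \<in> B" for e
  proof -
    obtain i where i: "i \<in> C" "e = f i" using \<open>e \<in> B\<close> C(2) by blast
    then have "i < n" using Cn by blast
    then show ?thesis using df[of i] c(1)[OF i(1)] i by simp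
  qed
  ultimately show ?thesis by (intro exI[of _ d]) (simp add: d_def)
qed

text \<open>Removing a bond from a cut leaves a cut, namely that of the symmetric difference of the
  vertex sets. Relations with disjoint supports can be added without changing their signs.\<close>

lemma cut_signs:
  assumes "is_cut V E ends B"
  shows "\<exists>c. (\<forall>e\<in>B. c e = 1 \<or> c e = (-1::real)) \<and> (\<forall>e. e \<notin> B \<longrightarrow> c e = 0) \<and> (\<Sum>e\<in>E. c e *\<^sub>R b e) = 0"
proof -
  have "finite B" using is_cut_finite[OF fin assms] .
  then show ?thesis using assms
  proof (induction B rule: finite_psubset_induct)
    case (psubset B)
    show ?case
    proof (cases "B = {}")
      case True then show ?thesis by (intro exI[of _ "\<lambda>_. 0"]) simp
    next
      case False
      obtain D where D: "D \<in> bonds V E ends" "D \<subseteq> B" using bond_in_cut[OF psubset.hyps(1) False psubset.prems] by blast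
      obtain S S1 where S: "S \<subseteq> V" "B = graph_cut E ends S" and S1: "S1 \<subseteq> V" "D = graph_cut E ends S1"
        using psubset.prems D(1) by (auto simp: is_cut_def bonds_def)
      have "graph_cut E ends ((S - S1) \<union> (S1 - S)) = (B - D) \<union> (D - B)" by (auto simp: S(2) S1(2) graph_cut_def)
      then have "graph_cut E ends ((S - S1) \<union> (S1 - S)) = B - D" using D(2) by blast
      moreover have "(S - S1) \<union> (S1 - S) \<subseteq> V" using S(1) S1(1) by blast
      ultimately have BD: "is_cut V E ends (B - D)" unfolding is_cut_def by metis
      have ps: "B - D \<subset> B" using D by (auto simp: bonds_def)
      obtain c where c: "\<forall>e\<in>B - D. c e = 1 \<or> c e = (-1::real)" "\<forall>e. e \<notin> B - D \<longrightarrow> c e = 0" "(\<Sum>e\<in>E. c e *\<^sub>R b e) = 0"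
        using psubset.IH[OF ps BD] by blast
      obtain d where d: "\<forall>e\<in>D. d e = 1 \<or> d e = (-1::real)" "\<forall>e. e \<notin> D \<longrightarrow> d e = 0" "(\<Sum>e\<in>E. d e *\<^sub>R b e) = 0"
        using bond_signs[OF D(1)] by blast
      have 1: "c e + d e = 1 \<or> c e + d e = -1" if "e \<in> B" for e
        using c(1,2) d(1,2) that by (cases "e \<in> D") auto
      have 2: "c e + d e = 0" if "e \<notin> B" for e using c(2) d(2) that D(2) by auto
      have 3: "(\<Sum>e\<in>E. (c e + d e) *\<^sub>R b e) = 0" using c(3) d(3) by (simp add: scaleR_add_left sum.distrib)
      show ?thesis by (intro exI[of _ "\<lambda>e. c e + d e"] conjI ballI allI impI 1 2 3)
    qed
  qed
qed

text \<open>A circuit among the cotree columns would be a bond avoiding the tree, but every nonempty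
  cut meets it.\<close>

lemma cotree_independent:
  assumes T: "spanning T"
  shows "\<not> col_dependent a {i\<in>{..<n}. f i \<in> E - T}"
proof
  let ?J = "{i\<in>{..<n}. f i \<in> E - T}"
  assume "col_dependent a ?J"
  then obtain C where C: "C \<in> col_circuits n a" "C \<subseteq> ?J" using dependent_contains_circuit[of ?J n a] by auto
  then have "f ` C \<in> bonds V E ends" using circ by blast
  then have "f ` C \<noteq> {}" "is_cut V E ends (f ` C)" unfolding bonds_def by blast+
  then obtain S where "S \<subseteq> V" "f ` C = graph_cut E ends S" "f ` C \<noteq> {}" unfolding is_cut_def by blast
  then have "f ` C \<inter> T \<noteq> {}" using cut_meets_tree[OF T, of S] by simp
  then show False using C(2) by auto
qed

lemma bdry_alt: "bdry E ends \<alpha> v = (\<Sum>e\<in>E. (of_bool (snd (ends e) = v) - of_bool (fst (ends e) = v)) * \<alpha> e)"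
proof -
  have "(\<Sum>e\<in>{e\<in>E. h e = v}. \<alpha> e) = (\<Sum>e\<in>E. of_bool (h e = v) * \<alpha> e)" for h :: "nat \<Rightarrow> nat"
  proof -
    have "(\<Sum>e\<in>{e\<in>E. h e = v}. \<alpha> e) = (\<Sum>e\<in>E. if h e = v then \<alpha> e else 0)"
      using finE by (simp add: sum.If_cases Int_def)
    also have "\<dots> = (\<Sum>e\<in>E. of_bool (h e = v) * \<alpha> e)" by (rule sum.cong) auto
    finally show ?thesis .
  qed
  then show ?thesis by (simp add: bdry_def left_diff_distrib sum_subtractf)
qed

text \<open>Uniqueness of the representation up to signs.  The kernel of the columns contains a vector
  supported on each vertex star and has dimension less than the number of vertices; a relation
  among the star vectors shows how to orient the edges.\<close>
lemma orientation_signs: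
  assumes T: "spanning T"
  shows "\<exists>\<epsilon>. (\<forall>e. \<epsilon> e = 1 \<or> \<epsilon> e = (-1::real)) \<and> (\<forall>i. (\<lambda>e. \<epsilon> e * b e $ i) \<in> H1R V E ends)"
proof -
  have star: "is_cut V E ends (graph_cut E ends {v})" if "v \<in> V" for v using that unfolding is_cut_def by blast
  have "\<forall>v\<in>V. \<exists>c. (\<forall>e\<in>graph_cut E ends {v}. c e = 1 \<or> c e = (-1::real)) \<and> (\<forall>e. e \<notin> graph_cut E ends {v} \<longrightarrow> c e = 0) \<and> (\<Sum>e\<in>E. c e *\<^sub>R b e) = 0"
    using cut_signs[OF star] by blast
  from bchoice[OF this] obtain c where c: "\<And>v. v \<in> V \<Longrightarrow> (\<forall>e\<in>graph_cut E ends {v}. c v e = 1 \<or> c v e = (-1::real)) \<and> (\<forall>e. e \<notin> graph_cut E ends {v} \<longrightarrow> c v e = 0) \<and> (\<Sum>e\<in>E. c v e *\<^sub>R b e) = 0"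
    by blast
  have c1: "c v e = 1 \<or> c v e = -1" if "v \<in> V" "e \<in> graph_cut E ends {v}" for v e using c[OF that(1)] that(2) by blast
  have c0: "c v e = 0" if "v \<in> V" "e \<notin> graph_cut E ends {v}" for v e using c[OF that(1)] that(2) by blast
  have cs: "(\<Sum>e\<in>E. c v e *\<^sub>R b e) = 0" if "v \<in> V" for v using c[OF that] by blast
  have fT: "finite T" using T finE finite_subset by (auto simp: spanning_def)
  have cT: "card T < card V" using T by (simp add: spanning_def)
  \<comment> \<open>There is one star vector per vertex and one tree edge fewer, so a nontrivial
    combination of the star vectors vanishes on the tree.\<close>
  obtain l where l: "\<exists>v\<in>V. l v \<noteq> 0" "\<forall>t\<in>T. (\<Sum>v\<in>V. l v * c v t) = 0"
    using homogeneous_system[OF fT finV cT, of c] by blast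
  define d where "d e = (\<Sum>v\<in>V. l v * c v e)" for e
  have dsum: "(\<Sum>e\<in>E. d e *\<^sub>R b e) = 0"
  proof -
    have "(\<Sum>e\<in>E. d e *\<^sub>R b e) = (\<Sum>e\<in>E. \<Sum>v\<in>V. l v *\<^sub>R (c v e *\<^sub>R b e))" by (simp add: d_def scaleR_sum_left)
    also have "\<dots> = (\<Sum>v\<in>V. \<Sum>e\<in>E. l v *\<^sub>R (c v e *\<^sub>R b e))" by (rule sum.swap)
    also have "\<dots> = (\<Sum>v\<in>V. l v *\<^sub>R (\<Sum>e\<in>E. c v e *\<^sub>R b e))" by (simp only: scaleR_sum_right)
    also have "\<dots> = 0" using cs by (intro sum.neutral) simp
    finally show ?thesis .
  qed
  \<comment> \<open>The combination is a relation among the columns supported on the cotree, whose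
    columns are independent.\<close>
  have d0: "d e = 0" if e: "e \<in> E" for e
  proof (rule ccontr)
    assume de: "d e \<noteq> 0"
    let ?J = "{i\<in>{..<n}. f i \<in> E - T}"
    have "e \<in> f ` {..<n}" using e f by (simp add: bij_betw_def)
    then obtain i where i: "i < n" "e = f i" by blast
    have "e \<notin> T" using de l(2) by (auto simp: d_def)
    then have iJ: "i \<in> ?J" using i e by simp
    have "(\<Sum>i\<in>?J. d (f i) *\<^sub>R a i) = (\<Sum>i<n. d (f i) *\<^sub>R a i)"
    proof (rule sum.mono_neutral_left)
      show "\<forall>i\<in>{..<n} - ?J. d (f i) *\<^sub>R a i = 0"
        using l(2) f by (auto simp: d_def bij_betw_def)
    qed auto
    also have "\<dots> = (\<Sum>i<n. d (f i) *\<^sub>R b (f i))" by (rule sum.cong) (auto simp: b_f)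
    also have "\<dots> = (\<Sum>e\<in>E. d e *\<^sub>R b e)" by (rule sum_f)
    finally have s0: "(\<Sum>i\<in>?J. d (f i) *\<^sub>R a i) = 0" using dsum by simp
    have "d (f i) \<noteq> 0" using de i(2) by simp
    then have "col_dependent a ?J" unfolding col_dependent_def
      by (intro exI[of _ "\<lambda>i. d (f i)"] conjI bexI[of _ i] s0 iJ)
    then show False using cotree_independent[OF T] by blast
  qed
  \<comment> \<open>An edge that is not a loop lies in the stars of its two ends only.\<close>
  have two: "l (fst (ends e)) * c (fst (ends e)) e + l (snd (ends e)) * c (snd (ends e)) e = 0"
    if e: "e \<in> E" "fst (ends e) \<noteq> snd (ends e)" for e
  proof -
    have "d e = (\<Sum>v\<in>{fst (ends e), snd (ends e)}. l v * c v e)"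
      unfolding d_def
    proof (rule sum.mono_neutral_right)
      show "\<forall>v\<in>V - {fst (ends e), snd (ends e)}. l v * c v e = 0"
        using c0 by (auto simp: graph_cut_def)
    qed (use finV endsV[OF e(1)] in auto)
    then show ?thesis using d0[OF e(1)] e(2) by simp
  qed
  have inc: "e \<in> graph_cut E ends {v} \<longleftrightarrow> (fst (ends e) = v) \<noteq> (snd (ends e) = v)" if "e \<in> E" for e v
    using that by (auto simp: graph_cut_def)
  have abs_eq: "\<bar>l (snd (ends e))\<bar> = \<bar>l (fst (ends e))\<bar>" if e: "e \<in> E" for e
  proof (cases "fst (ends e) = snd (ends e)")
    case False
    have "c (fst (ends e)) e = 1 \<or> c (fst (ends e)) e = -1"
      by (rule c1[OF endsV(1)[OF e]]) (simp add: inc[OF e] False False[symmetric])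
    moreover have "c (snd (ends e)) e = 1 \<or> c (snd (ends e)) e = -1"
      by (rule c1[OF endsV(2)[OF e]]) (simp add: inc[OF e] False False[symmetric])
    ultimately show ?thesis using two[OF e False] by auto
  qed simp
  obtain u where u: "u \<in> V" "l u \<noteq> 0" using l(1) by blast
  define L where "L = \<bar>l u\<bar>"
  have L: "L > 0" using u by (simp add: L_def)
  have lL: "\<bar>l v\<bar> = L" if "v \<in> V" for v
  proof -
    have "(u, v) \<in> (graph_adj E ends)\<^sup>*" using conn u(1) that by (simp add: graph_connected_def)
    then have "\<bar>l u\<bar> = \<bar>l v\<bar>" using potential_const[of E "\<lambda>v. \<bar>l v\<bar>" u v] abs_eq by blast
    then show ?thesis by (simp add: L_def)
  qed
  \<comment> \<open>By \<open>two\<close> the products \<open>l v * c v e\<close> at the two ends of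
    e are opposite, and connectedness gives them the common absolute value L. The sign at the second
    end is the correction of the orientation; a loop needs none.\<close>
  define \<epsilon> where "\<epsilon> e = (if e \<in> E \<and> fst (ends e) \<noteq> snd (ends e) then l (snd (ends e)) * c (snd (ends e)) e / L else 1)" for e
  have eps: "\<epsilon> e = 1 \<or> \<epsilon> e = -1" for e
  proof (cases "e \<in> E \<and> fst (ends e) \<noteq> snd (ends e)")
    case True
    then have e: "e \<in> E" "fst (ends e) \<noteq> snd (ends e)" by auto
    have "c (snd (ends e)) e = 1 \<or> c (snd (ends e)) e = -1"
      by (rule c1[OF endsV(2)[OF e(1)]]) (simp add: inc[OF e(1)] e(2) e(2)[symmetric])
    then have "\<bar>\<epsilon> e\<bar> = 1" using lL[OF endsV(2)[OF e(1)]] L True by (auto simp: \<epsilon>_def abs_mult)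
    then show ?thesis by linarith
  next
    case False
    then have "\<epsilon> e = 1" unfolding \<epsilon>_def by (rule if_not_P)
    then show ?thesis ..
  qed
  \<comment> \<open>After the correction the incidence numbers at v are a multiple of the star
    vector of v, so the boundary at v becomes a multiple of a relation among the columns.\<close>
  have loc: "(of_bool (snd (ends e) = v) - of_bool (fst (ends e) = v)) * \<epsilon> e = l v / L * c v e"
    if e: "e \<in> E" and v: "v \<in> V" for e v
  proof (cases "e \<in> graph_cut E ends {v}")
    case False
    then have "of_bool (snd (ends e) = v) = (of_bool (fst (ends e) = v) :: real)" unfolding inc[OF e] by simp
    then show ?thesis using c0[OF v False] by simp
  next
    case True
    then have nl: "fst (ends e) \<noteq> snd (ends e)" unfolding inc[OF e] by metis
    consider "snd (ends e) = v" "fst (ends e) \<noteq> v" | "fst (ends e) = v" "snd (ends e) \<noteq> v" using True unfolding inc[OF e] by blast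
    then show ?thesis
    proof cases
      case 1
      then show ?thesis using e nl by (simp add: \<epsilon>_def)
    next
      case 2
      have "l (snd (ends e)) * c (snd (ends e)) e = - (l v * c v e)" using two[OF e nl] 2(1) by simp
      then show ?thesis using e nl 2 by (simp add: \<epsilon>_def)
    qed
  qed
  have "(\<lambda>e. \<epsilon> e * b e $ i) \<in> H1R V E ends" for i
  proof -
    have "bdry E ends (\<lambda>e. \<epsilon> e * b e $ i) v = 0" if v: "v \<in> V" for v
    proof -
      have "bdry E ends (\<lambda>e. \<epsilon> e * b e $ i) v = (\<Sum>e\<in>E. (l v / L * c v e) * b e $ i)"
        unfolding bdry_alt
      proof (rule sum.cong)
        fix e assume "e \<in> E"
        from loc[OF this v]
        show "(of_bool (snd (ends e) = v) - of_bool (fst (ends e) = v)) * (\<epsilon> e * b e $ i) = (l v / L * c v e) * b e $ i"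
          unfolding mult.assoc[symmetric] by (rule arg_cong)
      qed simp
      also have "\<dots> = (l v / L) * (\<Sum>e\<in>E. c v e *\<^sub>R b e) $ i" by (simp add: sum_distrib_left mult.assoc)
      finally show ?thesis using cs[OF v] by simp
    qed
    then show ?thesis by (simp add: H1R_def b_def)
  qed
  then show ?thesis using eps by blast
qed

text \<open>The cotree columns are independent, which bounds their number by g; the remaining
  coordinates are left for the vertex weights. With the corrected signs the coordinates of the
  columns give the cycle components of a lattice basis, so the given columns already describe the
  Jacobian.\<close>

lemma betti1_le: "betti1 V E \<le> CARD('g)"
  and torelli_cell_exists: "(\<Sum>v\<in>V. w v) = CARD('g) - betti1 V E \<Longrightarrow>
     torelli_cell V E ends w = gl_sat (sigma0 n a)"
proof -
  obtain T where T: "spanning T" using spanning_tree_exists by blast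
  define J where "J = {i\<in>{..<n}. f i \<in> E - T}"
  have finJ: "finite J" by (simp add: J_def)
  have nd: "\<not> col_dependent a J" unfolding J_def by (rule cotree_independent[OF T])
  have Jn: "J \<subseteq> {..<n}" by (auto simp: J_def)
  obtain R \<rho>0 where rho0: "bij_betw \<rho>0 R J" and G0: "rowmix R (\<lambda>j. a (\<rho>0 j)) \<in> GLZ"
    using tu_rowmix[OF tu Jn independent_columns[OF finJ nd]] by blast
  have "bij_betw f J (E - T)"
  proof (rule bij_betw_imageI)
    show "inj_on f J" using f Jn inj_on_subset by (auto simp: bij_betw_def)
    show "f ` J = E - T" using f by (auto simp: J_def bij_betw_def)
  qed
  then have rho: "bij_betw (f \<circ> \<rho>0) R (E - T)" using rho0 bij_betw_trans by blast
  have cR: "card R = betti1 V E" using bij_betw_same_card[OF rho] card_cotree[OF T] by simp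
  then show le: "betti1 V E \<le> CARD('g)" by (metis card_mono finite_UNIV subset_UNIV finite)
  assume w: "(\<Sum>v\<in>V. w v) = CARD('g) - betti1 V E"
  have W: "card (- R) = (\<Sum>v\<in>V. w v)" unfolding w cR[symmetric] by (simp add: Compl_eq_Diff_UNIV card_Diff_subset)
  have bR: "b ((f \<circ> \<rho>0) j) = a (\<rho>0 j)" if "j \<in> R" for j
    using bij_betwE[OF rho0] that Jn b_f by auto
  have "rowmix R (\<lambda>j. b ((f \<circ> \<rho>0) j)) = rowmix R (\<lambda>j. a (\<rho>0 j))"
    using bR by (simp add: rowmix_def vec_eq_iff)
  then have G: "rowmix R (\<lambda>j. b ((f \<circ> \<rho>0) j)) \<in> GLZ" using G0 by simp
  obtain \<epsilon> where eps: "\<And>e. \<epsilon> e = 1 \<or> \<epsilon> e = (-1::real)" and eH: "\<And>i. (\<lambda>e. \<epsilon> e * b e $ i) \<in> H1R V E ends"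
    using orientation_signs[OF T] by blast
  define \<gamma> where "\<gamma> i e = \<lfloor>\<epsilon> e * b e $ i\<rfloor>" for i e
  have gam: "of_int (\<gamma> i e) = \<epsilon> e * b e $ i" for i e
  proof -
    have "b e \<in> Zlat"
    proof (cases "e \<in> E")
      case True
      then have "e \<in> f ` {..<n}" using f by (simp add: bij_betw_def)
      then obtain i where "i < n" "e = f i" by blast
      then show ?thesis using b_f tu_Zlat[OF tu] by simp
    qed (simp add: b_def Zlat_0)
    then have "b e $ i \<in> \<int>" by (simp add: Zlat_def)
    moreover have "\<epsilon> e \<in> \<int>" using eps[of e] by auto
    ultimately have "\<epsilon> e * b e $ i \<in> \<int>" by (rule Ints_mult[rotated])
    then show ?thesis by (simp add: \<gamma>_def)
  qed
  have H: "\<gamma> i \<in> H1Z V E ends" for i unfolding H1Z_H1R gam by (rule eH)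
  obtain \<delta> where bij: "bij_betw (\<lambda>x::'g \<Rightarrow> int. (lc x \<gamma>, lc x \<delta>)) UNIV (H1Z V E ends \<times> {f. \<forall>k. k \<ge> (\<Sum>v\<in>V. w v) \<longrightarrow> f k = 0})"
    using jacobian_basis[OF T rho G gam eps H W] by blast
  let ?a = "\<lambda>e. (\<chi> i. of_int (\<gamma> i e)) :: real^'g"
  have tc: "torelli_cell V E ends w = gl_sat {edge_form E l ?a | l. \<forall>e\<in>E. l e > 0}"
    by (rule torelli_cell_orbit[OF finE bij]) simp
  have ef: "edge_form E l ?a = oform n a (\<lambda>i. l (f i))" for l
  proof -
    \<comment> \<open>The orientation signs cancel in the quadratic form.\<close>
    have ee: "(\<epsilon> e * x) * (\<epsilon> e * y) = x * y" for e x y using eps[of e] by auto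
    have "edge_form E l ?a = (\<Sum>e\<in>E. l e *\<^sub>R (\<chi> r s. b e $ r * b e $ s))"
      unfolding edge_form_def vec_lambda_beta gam ee ..
    also have "\<dots> = (\<Sum>i<n. l (f i) *\<^sub>R (\<chi> r s. b (f i) $ r * b (f i) $ s))"
      by (rule sum_f[symmetric])
    also have "\<dots> = oform n a (\<lambda>i. l (f i))" unfolding oform_def by (rule sum.cong) (simp_all add: b_f)
    finally show ?thesis .
  qed
  have st: "{oform n a (\<lambda>i. l (f i)) | l. \<forall>e\<in>E. l e > 0} = sigma0 n a"
  proof (intro set_eqI iffI)
    fix Q assume "Q \<in> {oform n a (\<lambda>i. l (f i)) | l. \<forall>e\<in>E. l e > 0}"
    then obtain l where l: "Q = oform n a (\<lambda>i. l (f i))" "\<forall>e\<in>E. l e > 0" by blast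
    have "\<forall>i<n. l (f i) > 0" using l(2) bij_betwE[OF f] by blast
    then show "Q \<in> sigma0 n a" unfolding sigma0_oform l(1) by blast
  next
    fix Q assume "Q \<in> sigma0 n a"
    then obtain m where m: "Q = oform n a m" "\<forall>i<n. m i > 0" unfolding sigma0_oform by blast
    let ?l = "\<lambda>e. m (inv_into {..<n} f e)"
    have inj: "inj_on f {..<n}" using f by (simp add: bij_betw_def)
    have "\<forall>e\<in>E. ?l e > 0" using m(2) bij_betwE[OF bij_betw_inv_into[OF f]] by blast
    moreover have "Q = oform n a (\<lambda>i. ?l (f i))"
      unfolding m(1) oform_def by (rule sum.cong) (simp_all add: inv_into_f_f[OF inj])
    ultimately show "Q \<in> {oform n a (\<lambda>i. l (f i)) | l. \<forall>e\<in>E. l e > 0}"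
      by (intro CollectI exI[of _ ?l] conjI)
  qed
  show "torelli_cell V E ends w = gl_sat (sigma0 n a)" unfolding tc ef st ..
qed

text \<open>A vertex of valence at most 2 would give a bond with at most two edges, except on a graph
  with a single vertex and at most one loop, which has genus less than 2 and hence a weight.\<close>
lemma valence_ge_3:
  assumes s: "simple_col n a" and v: "v \<in> V" and g2: "CARD('g) \<ge> 2"
    and single: "V = {v} \<Longrightarrow> betti1 V E = CARD('g)"
  shows "valence E ends v \<ge> 3"
proof (cases "V = {v}")
  case True
  have "card E \<ge> 2" using single[OF True] g2 True by (simp add: betti1_def)
  moreover have "{e\<in>E. fst (ends e) = v} = E" "{e\<in>E. snd (ends e) = v} = E" using endsV True by auto
  ultimately show ?thesis by (simp add: valence_def)
next
  case False
  then obtain u where u: "u \<in> V" "u \<noteq> v" using v by blast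
  have "(v, u) \<in> (graph_adj E ends)\<^sup>*" using conn v u(1) by (simp add: graph_connected_def)
  then obtain x y where "(x, y) \<in> graph_adj E ends" "x \<in> {v}" "y \<notin> {v}"
    using rtrancl_leaves[of v u _ "{v}"] u(2) by blast
  then obtain e where "e \<in> E" "ends e = (v, y) \<or> ends e = (y, v)" "y \<noteq> v" by (auto simp: graph_adj_def)
  then have "e \<in> graph_cut E ends {v}" by (cases "ends e") (auto simp: graph_cut_def)
  then have ne: "graph_cut E ends {v} \<noteq> {}" by blast
  have cut: "is_cut V E ends (graph_cut E ends {v})" using v unfolding is_cut_def by blast
  have finc: "finite (graph_cut E ends {v})" by (rule is_cut_finite[OF fin cut])
  obtain B where B: "B \<in> bonds V E ends" "B \<subseteq> graph_cut E ends {v}" using bond_in_cut[OF finc ne cut] by blast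
  obtain C where C: "C \<in> col_circuits n a" "B = f ` C" using B(1) circ by (metis imageE)
  have "C \<subseteq> {..<n}" using C(1) by (simp add: col_circuits_def)
  then have "inj_on f C" using f inj_on_subset by (auto simp: bij_betw_def)
  then have "card B \<ge> 3" using s C by (simp add: simple_col_def card_image)
  also have "card B \<le> card (graph_cut E ends {v})" by (rule card_mono[OF finc B(2)])
  also have "\<dots> \<le> card ({e\<in>E. fst (ends e) = v} \<union> {e\<in>E. snd (ends e) = v})"
    using finE by (intro card_mono) (auto simp: graph_cut_def)
  also have "\<dots> \<le> valence E ends v" unfolding valence_def by (rule card_Un_le)
  finally show ?thesis .
qed

end

section \<open>Comparison of the two collections of cells\<close>

theorem cogr_cell_stable_type:
  fixes a :: "nat \<Rightarrow> real^'g::finite"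
  assumes g2: "CARD('g) \<ge> 2" and tu: "totally_unimodular n a" and co: "cographic_col n a" and s: "simple_col n a"
  shows "\<exists>V E ends w. stable_type CARD('g) V E ends w \<and> torelli_cell V E ends w = gl_sat (sigma0 n a)"
proof -
  obtain V0 E ends0 f where G0: "fin_graph V0 E ends0" and f: "bij_betw f {..<n} E"
    and circ0: "(`) f ` col_circuits n a = bonds V0 E ends0"
    using co unfolding cographic_col_def by blast
  obtain V ends where G: "fin_graph V E ends" "graph_connected V E ends"
    and cut: "\<And>B. is_cut V E ends B \<longleftrightarrow> is_cut V0 E ends0 B"
    using connecting[OF G0] by metis
  have circ: "(`) f ` col_circuits n a = bonds V E ends"
    using circ0 bonds_eq_cut_eq[of V E ends V0 E ends0] cut by simp
  interpret cographic_system V E ends n a f by unfold_locales (fact G tu f circ)+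
  obtain v0 where v0: "v0 \<in> V" using neV by blast
  \<comment> \<open>All the genus missing from the graph is placed on a single vertex. If this is
    the only vertex and its weight is still 0, the graph itself has Betti number g.\<close>
  define w where "w v = (if v = v0 then CARD('g) - betti1 V E else 0)" for v
  have w: "(\<Sum>v\<in>V. w v) = CARD('g) - betti1 V E" using v0 finV by (simp add: w_def)
  have "stable_type CARD('g) V E ends w"
    unfolding stable_type_def
  proof (intro conjI ballI impI)
    fix v assume v: "v \<in> V" "w v = 0"
    show "3 \<le> valence E ends v"
    proof (rule valence_ge_3[OF s v(1) g2])
      assume "V = {v}"
      then have "v = v0" using v0 by simp
      then show "betti1 V E = CARD('g)" using v(2) betti1_le by (simp add: w_def)
    qed
  qed (use G w betti1_le in auto)
  then show ?thesis using torelli_cell_exists[OF w] by blast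
qed

text \<open>The quotient by the integral linear group is never formed: cells are invariant sets of
  forms. Fullness then says that the image of each cell is an entire Voronoi cell, and equality of
  the images is equality of two collections of sets.\<close>

theorem mainTheorem11:
  assumes "CARD('g::finite) \<ge> 2"
  shows "(\<forall>V E ends w. stable_type CARD('g) V E ends w \<longrightarrow>
            (\<exists>Q0\<in>(Omega_rt :: (real^'g^'g) set). (torelli_cell V E ends w :: (real^'g^'g) set) = vcell Q0))
       \<and> {torelli_cell V E ends w :: (real^'g^'g) set | V E ends w. stable_type CARD('g) V E ends w}
           = (cogr_cells :: (real^'g^'g) set set)"
proof (intro conjI allI impI set_eqI iffI)
  fix V E ends w assume "stable_type CARD('g) V E ends w"
  then obtain n and a :: "nat \<Rightarrow> real^'g" where a: "totally_unimodular n a" "simple_col n a"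
    "torelli_cell V E ends w = gl_sat (sigma0 n a)"
    using stable_type_cogr_cell by metis
  show "\<exists>Q0\<in>(Omega_rt :: (real^'g^'g) set). torelli_cell V E ends w = vcell Q0"
    unfolding a(3) by (rule gl_sat_sigma0[OF assms a(1,2)])
next
  fix X :: "(real^'g^'g) set"
  assume "X \<in> {torelli_cell V E ends w :: (real^'g^'g) set | V E ends w. stable_type CARD('g) V E ends w}"
  then obtain V E ends w where st: "stable_type CARD('g) V E ends w" "X = torelli_cell V E ends w" by blast
  obtain n and a :: "nat \<Rightarrow> real^'g" where "totally_unimodular n a" "cographic_col n a" "simple_col n a"
    "torelli_cell V E ends w = gl_sat (sigma0 n a)"
    using stable_type_cogr_cell[OF st(1)] by metis
  then show "X \<in> cogr_cells" unfolding cogr_cells_def st(2) by blast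
next
  fix X :: "(real^'g^'g) set"
  assume "X \<in> cogr_cells"
  then obtain n and a :: "nat \<Rightarrow> real^'g" where a: "X = gl_sat (sigma0 n a)"
    "totally_unimodular n a" "cographic_col n a" "simple_col n a"
    unfolding cogr_cells_def by blast
  then obtain V E ends w where "stable_type CARD('g) V E ends w" "torelli_cell V E ends w = X"
    using cogr_cell_stable_type[OF assms a(2-4)] by metis
  then show "X \<in> {torelli_cell V E ends w :: (real^'g^'g) set | V E ends w. stable_type CARD('g) V E ends w}" by blast
qed

end
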